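(* Let $V$ be a finite-dimensional real vector space and let $Q$ be a complete and connected locally convex $V$-parallel space. Let $P\subset V$ be the period group of $Q$ and denote by $\mathbb R P$ the $\mathbb R$-linear span of $P$ in $V$, so that $(\mathbb R P)/P$ is a torus. Let $C$ be a linear complement of $\mathbb R P$ in $V$ and let $p\in Q$. Then there is a convex closed subset $\Delta_p$ of $C$ such that $D_p=\Delta_p+\mathbb R P$. Furthermore the mapping $\Phi_p:(v,w)\mapsto p+(v+w)$ defines an isomorphism of parallel spaces from $\Delta_p\times((\mathbb R P)/P)$ onto $Q$. The projection from $Q$ onto the $\mathbb R P$-orbit space $Q/(\mathbb R P)$ induces an isomorphism from $\Delta_p$, viewed as a $C$-parallel space, onto the $V/(\mathbb R P)$-parallel space $Q/(\mathbb R P)$. There is a collection of linear forms $v_i^*$ on $V$ and real numbers $c_i$, where $i$ runs over some index set $I$, such that $D_p$ is equal to the set of all $v\in V$ such that $v_i^*(v)\ge c_i$ for all $i\in I$. For every such collection $v_i^*,c_i$, the linear subspace $N$ of $V$ (defined in the context) is equal to the common kernel of the linear forms $v_i^*$, $i\in I$, on $V$. $Q$ is compact if and only if $\Delta_p$ is compact, which implies that $N=\mathbb R P$, and that $P$ is a cocompact discrete subgroup of the additive group $N$. If $Q$ is a compact connected locally convex polyhedral $V$-parallel space, then $\Delta_p\simeq Q/(\mathbb R P)$ is a convex polytope in $C\simeq V/(\mathbb R P)$.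
   Context: **$V$-parallel spaces.** Let $V$ be a finite-dimensional vector space. A $V$-parallel space is a Hausdorff topological space $Q$ with an open covering $Q_\alpha$, $\alpha\in A$, and homeomorphisms (charts) $\varphi_\alpha$ from $Q_\alpha$ onto subsets $V_\alpha$ of $V$ such that for all $\alpha,\beta\in A$ with $Q_\alpha\cap Q_\beta\ne\emptyset$ the map $x\mapsto\varphi_\alpha(x)-\varphi_\beta(x):Q_\alpha\cap Q_\beta\to V$ is locally constant. Subsets of $Q$ are $V$-parallel spaces by restriction of the charts, and the product of a $V$-parallel and a $W$-parallel space is a $V\times W$-parallel space. $Q$ is locally convex if all $V_\alpha$ are convex. A locally convex $Q$ is locally convex polyhedral if for every $\alpha$ there are a convex open subset $V'_\alpha$ of $V$ and finitely many linear forms $v^*_{\alpha,j}$ on $V$, $1\le j\le m$, such that $V_\alpha=\{v\in V'_\alpha: v^*_{\alpha,j}(v)\ge0,\ 1\le j\le m\}$. **$L$-maps, isomorphisms.** Let $Q$, $R$ be locally convex $V$- and $W$-parallel spaces with charts $\varphi_\alpha:Q_\alpha\to V$, $\psi_\beta:R_\beta\to W$, and $L:W\to V$ linear. An $L$-map from $R$ to $Q$ is a continuous $f:R\to Q$ such that for all $\alpha,\beta$ and each $U\subset R_\beta\cap f^{-1}(Q_\alpha)$ with $\psi_\beta(U)$ convex, $\varphi_\alpha(f(r))-\varphi_\alpha(f(s))=L(\psi_\beta(r)-\psi_\beta(s))$ for all $r,s\in U$. An isomorphism is an $L$-map which is a homeomorphism and for which $L$ is bijective. (For $\Phi_p$ above,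 $L:C\times\mathbb R P\to V$ is $(w,z)\mapsto w+z$.) The torus $(\mathbb R P)/P$ is an $\mathbb R P$-parallel space with charts the local inverses of $\mathbb R P\to(\mathbb R P)/P$ on small convex open sets; the charts of $Q/(\mathbb R P)$ are those induced by the $\varphi_\alpha$ followed by $V\to V/(\mathbb R P)$. **Completeness.** For a neighborhood $V_0$ of $0$ in $V$ let $P(V_0)$ be the set of $(p,q)\in Q\times Q$ such that for some $\alpha$ one has $p,q\in Q_\alpha$ and $\varphi_\alpha(p)-\varphi_\alpha(q)\in V_0$. The sets $P(V_0)$ define a uniform structure on $Q$ (they form a fundamental system of entourages). $Q$ is complete if every Cauchy filter for this uniform structure converges. **Motions and $D$.** A motion in $Q$ with constant velocity $v\in V$ is a continuous $\gamma:I\to Q$, $I\subset\mathbb R$ an interval, such that for every $\alpha$ and every interval $J\subset\gamma^{-1}(Q_\alpha)$, $\varphi_\alpha(\gamma(t))=\varphi_\alpha(\gamma(s))+(t-s)v$ for all $s,t\in J$. For $p\in Q$ there is a unique maximal motion $\gamma^v_{0,p}:I^v_{0,p}\to Q$ with constant velocity $v$, $0\in I^v_{0,p}$, $\gamma^v_{0,p}(0)=p$. $D$ is the set of $(v,p)\in V\times Q$ with $1\in I^v_{0,p}$, $p+v:=\gamma^v_{0,p}(1)$ for $(v,p)\in D$, and $D_p=\{v\in V:(v,p)\in D\}$. **$N$ and the period group $P$.** For $Q$ complete, connected and locally convex: $N$ is the set of $v\in V$ such that $I^v_{0,p}=\mathbb R$ for some (equivalently every) $p\in Q$; it is a linear subspace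 of $V$ acting on $Q$ by $(v,p)\mapsto p+v$. $P$ is the set of $v\in V$ such that $(v,p)\in D$ and $p+v=p$ for some (equivalently every) $p\in Q$; it is a discrete additive subgroup of $N$.
   Formalization: Completeness uses the sets P(V_0) of the atlas of all compatible convex charts, and that these form a fundamental system of entourages is assumed: for an arbitrary given atlas they need not (e.g. ]0,∞[ with charts ]2^k,2^{k+2}[, where D_p is not closed). *)

theory Defs
  imports "HOL-Analysis.Analysis"
begin

text \<open>
  A finite-dimensional real vector space is a linear subspace \<open>V\<close> of a type of class
  \<open>euclidean_space\<close>; this includes the zero space, which is not such a type itself.
  Linear maps and linear forms on \<open>V\<close> are restrictions of linear maps of the ambient type,
  which is no restriction since every linear map on a subspace extends.
  All inner products give the same topology, so the ambient norm plays no role.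
\<close>


section \<open>Parallel spaces\<close>

record ('a, 'q, 'v) parallel =
  qtop :: "'q topology"
  model :: "'v set"
  index :: "'a set"
  cdom :: "'a \<Rightarrow> 'q set"
  chart :: "'a \<Rightarrow> 'q \<Rightarrow> 'v"

definition locally_constant_on :: "'q topology \<Rightarrow> 'q set \<Rightarrow> ('q \<Rightarrow> 'b) \<Rightarrow> bool" where
  "locally_constant_on X S f \<longleftrightarrow>
     (\<forall>x\<in>S. \<exists>U. openin (subtopology X S) U \<and> x \<in> U \<and> (\<forall>y\<in>U. f y = f x))"

definition is_chart ::
    "'q topology \<Rightarrow> 'v::euclidean_space set \<Rightarrow> 'q set \<Rightarrow> ('q \<Rightarrow> 'v) \<Rightarrow> bool" where
  "is_chart X V U f \<longleftrightarrow>
     openin X U \<and> f ` U \<subseteq> V \<and> homeomorphic_map (subtopology X U) (top_of_set (f ` U)) f"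

definition parallel_space :: "('a, 'q, 'v::euclidean_space) parallel \<Rightarrow> bool" where
  "parallel_space Q \<longleftrightarrow>
     subspace (model Q) \<and>
     Hausdorff_space (qtop Q) \<and>
     topspace (qtop Q) = (\<Union>\<alpha>\<in>index Q. cdom Q \<alpha>) \<and>
     (\<forall>\<alpha>\<in>index Q. is_chart (qtop Q) (model Q) (cdom Q \<alpha>) (chart Q \<alpha>)) \<and>
     (\<forall>\<alpha>\<in>index Q. \<forall>\<beta>\<in>index Q.
        locally_constant_on (qtop Q) (cdom Q \<alpha> \<inter> cdom Q \<beta>) (\<lambda>x. chart Q \<alpha> x - chart Q \<beta> x))"

definition locally_convex :: "('a, 'q, 'v::euclidean_space) parallel \<Rightarrow> bool" where
  "locally_convex Q \<longleftrightarrow>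
     parallel_space Q \<and> (\<forall>\<alpha>\<in>index Q. convex (chart Q \<alpha> ` cdom Q \<alpha>))"

definition locally_convex_polyhedral :: "('a, 'q, 'v::euclidean_space) parallel \<Rightarrow> bool" where
  "locally_convex_polyhedral Q \<longleftrightarrow>
     locally_convex Q \<and>
     (\<forall>\<alpha>\<in>index Q. \<exists>V' (m::nat) (f :: nat \<Rightarrow> 'v \<Rightarrow> real).
        convex V' \<and> openin (top_of_set (model Q)) V' \<and> (\<forall>j\<in>{1..m}. linear (f j)) \<and>
        chart Q \<alpha> ` cdom Q \<alpha> = {v \<in> V'. \<forall>j\<in>{1..m}. f j v \<ge> 0})"

definition vector_parallel :: "'v::euclidean_space set \<Rightarrow> (unit, 'v, 'v) parallel" where
  "vector_parallel V =
     \<lparr>qtop = top_of_set V, model = V, index = UNIV, cdom = (\<lambda>_. V), chart = (\<lambda>_ x. x)\<rparr>"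

definition restrict_parallel ::
    "('a, 'q, 'v) parallel \<Rightarrow> 'q set \<Rightarrow> ('a, 'q, 'v) parallel" where
  "restrict_parallel Q S =
     \<lparr>qtop = subtopology (qtop Q) S, model = model Q, index = index Q,
      cdom = (\<lambda>\<alpha>. cdom Q \<alpha> \<inter> S), chart = chart Q\<rparr>"

definition prod_parallel ::
    "('a, 'q, 'v) parallel \<Rightarrow> ('b, 'r, 'w) parallel \<Rightarrow> ('a \<times> 'b, 'q \<times> 'r, 'v \<times> 'w) parallel" where
  "prod_parallel Q R =
     \<lparr>qtop = prod_topology (qtop Q) (qtop R), model = model Q \<times> model R,
      index = index Q \<times> index R,
      cdom = (\<lambda>(\<alpha>, \<beta>). cdom Q \<alpha> \<times> cdom R \<beta>),
      chart = (\<lambda>(\<alpha>, \<beta>). map_prod (chart Q \<alpha>) (chart R \<beta>))\<rparr>"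


section \<open>Maps of parallel spaces\<close>

definition L_map ::
    "('w \<Rightarrow> 'v) \<Rightarrow> ('b, 'r, 'w::euclidean_space) parallel \<Rightarrow>
     ('a, 'q, 'v::euclidean_space) parallel \<Rightarrow> ('r \<Rightarrow> 'q) \<Rightarrow> bool" where
  "L_map L R Q f \<longleftrightarrow>
     locally_convex R \<and> locally_convex Q \<and> linear L \<and> L ` model R \<subseteq> model Q \<and>
     continuous_map (qtop R) (qtop Q) f \<and>
     (\<forall>\<alpha>\<in>index Q. \<forall>\<beta>\<in>index R. \<forall>U.
        U \<subseteq> cdom R \<beta> \<and> f ` U \<subseteq> cdom Q \<alpha> \<and> convex (chart R \<beta> ` U) \<longrightarrow>
        (\<forall>r\<in>U. \<forall>s\<in>U.
           chart Q \<alpha> (f r) - chart Q \<alpha> (f s) = L (chart R \<beta> r - chart R \<beta> s)))"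

definition parallel_iso ::
    "('w \<Rightarrow> 'v) \<Rightarrow> ('b, 'r, 'w::euclidean_space) parallel \<Rightarrow>
     ('a, 'q, 'v::euclidean_space) parallel \<Rightarrow> ('r \<Rightarrow> 'q) \<Rightarrow> bool" where
  "parallel_iso L R Q f \<longleftrightarrow>
     L_map L R Q f \<and> homeomorphic_map (qtop R) (qtop Q) f \<and> bij_betw L (model R) (model Q)"


section \<open>Completeness\<close>

definition zero_nhds :: "'v::euclidean_space set \<Rightarrow> 'v set set" where
  "zero_nhds V = {V0. V0 \<subseteq> V \<and> (\<exists>T. openin (top_of_set V) T \<and> 0 \<in> T \<and> T \<subseteq> V0)}"

definition entourage :: "('a, 'q, 'v::euclidean_space) parallel \<Rightarrow> 'v set \<Rightarrow> ('q \<times> 'q) set" where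
  "entourage Q V0 =
     {(p, q). \<exists>\<alpha>\<in>index Q. p \<in> cdom Q \<alpha> \<and> q \<in> cdom Q \<alpha> \<and> chart Q \<alpha> p - chart Q \<alpha> q \<in> V0}"

definition fundamental_system :: "'q set \<Rightarrow> ('q \<times> 'q) set set \<Rightarrow> bool" where
  "fundamental_system X B \<longleftrightarrow>
     B \<noteq> {} \<and>
     (\<forall>E\<in>B. Id_on X \<subseteq> E \<and> E \<subseteq> X \<times> X) \<and>
     (\<forall>E\<in>B. \<forall>E'\<in>B. \<exists>F\<in>B. F \<subseteq> E \<inter> E') \<and>
     (\<forall>E\<in>B. \<exists>F\<in>B. F \<subseteq> E\<inverse>) \<and>
     (\<forall>E\<in>B. \<exists>F\<in>B. F O F \<subseteq> E)"

definition chartwise_complete :: "('a, 'q, 'v::euclidean_space) parallel \<Rightarrow> bool" where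
  "chartwise_complete Q \<longleftrightarrow>
     fundamental_system (topspace (qtop Q)) (entourage Q ` zero_nhds (model Q)) \<and>
     (\<forall>F. F \<noteq> bot \<and> F \<le> principal (topspace (qtop Q)) \<and>
          (\<forall>V0\<in>zero_nhds (model Q).
             \<exists>M. eventually (\<lambda>x. x \<in> M) F \<and> M \<times> M \<subseteq> entourage Q V0) \<longrightarrow>
          (\<exists>x\<in>topspace (qtop Q). F \<le> nhdsin (qtop Q) x))"

text \<open>
  The same space with all convex charts that are compatible with the given ones.
\<close>
definition saturate ::
    "('a, 'q, 'v::euclidean_space) parallel \<Rightarrow> ('q set \<times> ('q \<Rightarrow> 'v), 'q, 'v) parallel" where
  "saturate Q =
     \<lparr>qtop = qtop Q, model = model Q,
      index = {(U, f). is_chart (qtop Q) (model Q) U f \<and> convex (f ` U) \<and>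
        (\<forall>\<alpha>\<in>index Q. locally_constant_on (qtop Q) (U \<inter> cdom Q \<alpha>) (\<lambda>x. f x - chart Q \<alpha> x))},
      cdom = fst, chart = snd\<rparr>"

text \<open>
  The uniform structure belongs to the parallel structure, not to one particular atlas: for
  an arbitrary atlas the entourages need not be a fundamental system.  An example is the open
  unit interval covered by the intervals \<open>]1/(n+2), 1/n[\<close>: arbitrarily close to the
  missing endpoint \<open>0\<close> there are points without a common chart, so that no filter tending
  to \<open>0\<close> would be Cauchy.  Hence the charts are taken to be all compatible convex ones.
  Even these do not always give a fundamental system (the punctured plane), so
  \<open>chartwise_complete\<close> requires it explicitly.
\<close>
definition complete_parallel :: "('a, 'q, 'v::euclidean_space) parallel \<Rightarrow> bool" where
  "complete_parallel Q \<longleftrightarrow> chartwise_complete (saturate Q)"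


section \<open>Motions\<close>

definition motion ::
    "('a, 'q, 'v::euclidean_space) parallel \<Rightarrow> 'v \<Rightarrow> real set \<Rightarrow> (real \<Rightarrow> 'q) \<Rightarrow> bool" where
  "motion Q v I \<gamma> \<longleftrightarrow>
     is_interval I \<and> continuous_map (top_of_set I) (qtop Q) \<gamma> \<and>
     (\<forall>\<alpha>\<in>index Q. \<forall>J. is_interval J \<and> J \<subseteq> I \<and> \<gamma> ` J \<subseteq> cdom Q \<alpha> \<longrightarrow>
        (\<forall>s\<in>J. \<forall>t\<in>J. chart Q \<alpha> (\<gamma> t) = chart Q \<alpha> (\<gamma> s) + (t - s) *\<^sub>R v))"

definition motion_from ::
    "('a, 'q, 'v::euclidean_space) parallel \<Rightarrow> 'v \<Rightarrow> 'q \<Rightarrow> real set \<Rightarrow> (real \<Rightarrow> 'q) \<Rightarrow> bool" where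
  "motion_from Q v p I \<gamma> \<longleftrightarrow> motion Q v I \<gamma> \<and> 0 \<in> I \<and> \<gamma> 0 = p"

definition maximal_motion ::
    "('a, 'q, 'v::euclidean_space) parallel \<Rightarrow> 'v \<Rightarrow> 'q \<Rightarrow> real set \<Rightarrow> (real \<Rightarrow> 'q) \<Rightarrow> bool" where
  "maximal_motion Q v p I \<gamma> \<longleftrightarrow>
     motion_from Q v p I \<gamma> \<and>
     (\<forall>I' \<gamma>'. motion_from Q v p I' \<gamma>' \<and> I \<subseteq> I' \<and> (\<forall>t\<in>I. \<gamma>' t = \<gamma> t) \<longrightarrow> I' = I)"

definition max_interval :: "('a, 'q, 'v::euclidean_space) parallel \<Rightarrow> 'v \<Rightarrow> 'q \<Rightarrow> real set" where
  "max_interval Q v p = (THE I. \<exists>\<gamma>. maximal_motion Q v p I \<gamma>)"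

definition max_motion :: "('a, 'q, 'v::euclidean_space) parallel \<Rightarrow> 'v \<Rightarrow> 'q \<Rightarrow> real \<Rightarrow> 'q" where
  "max_motion Q v p =
     (THE \<gamma>. \<gamma> \<in> extensional (max_interval Q v p) \<and> maximal_motion Q v p (max_interval Q v p) \<gamma>)"

definition D_set :: "('a, 'q, 'v::euclidean_space) parallel \<Rightarrow> ('v \<times> 'q) set" where
  "D_set Q = {(v, p). v \<in> model Q \<and> p \<in> topspace (qtop Q) \<and> 1 \<in> max_interval Q v p}"

definition D_at :: "('a, 'q, 'v::euclidean_space) parallel \<Rightarrow> 'q \<Rightarrow> 'v set" where
  "D_at Q p = {v \<in> model Q. (v, p) \<in> D_set Q}"

definition translate :: "('a, 'q, 'v::euclidean_space) parallel \<Rightarrow> 'q \<Rightarrow> 'v \<Rightarrow> 'q" where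
  "translate Q p v = max_motion Q v p 1"

definition N_space :: "('a, 'q, 'v::euclidean_space) parallel \<Rightarrow> 'v set" where
  "N_space Q = {v \<in> model Q. \<exists>p\<in>topspace (qtop Q). max_interval Q v p = UNIV}"

definition periods :: "('a, 'q, 'v::euclidean_space) parallel \<Rightarrow> 'v set" where
  "periods Q = {v \<in> model Q. \<exists>p\<in>topspace (qtop Q). (v, p) \<in> D_set Q \<and> translate Q p v = p}"


section \<open>Quotients\<close>

definition quotient_topology :: "'x topology \<Rightarrow> ('x \<Rightarrow> 'y) \<Rightarrow> 'y topology" where
  "quotient_topology X f =
     topology (\<lambda>U. U \<subseteq> f ` topspace X \<and> openin X {x \<in> topspace X. f x \<in> U})"

lemma openin_quotient_topology:
  "openin (quotient_topology X f) U \<longleftrightarrow>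
     U \<subseteq> f ` topspace X \<and> openin X {x \<in> topspace X. f x \<in> U}"
proof -
  have "istopology (\<lambda>U. U \<subseteq> f ` topspace X \<and> openin X {x \<in> topspace X. f x \<in> U})"
    unfolding istopology_def
  proof (intro conjI allI impI)
    fix S T
    assume "S \<subseteq> f ` topspace X \<and> openin X {x \<in> topspace X. f x \<in> S}"
      and "T \<subseteq> f ` topspace X \<and> openin X {x \<in> topspace X. f x \<in> T}"
    moreover have "{x \<in> topspace X. f x \<in> S \<inter> T} =
        {x \<in> topspace X. f x \<in> S} \<inter> {x \<in> topspace X. f x \<in> T}" by blast
    ultimately show "S \<inter> T \<subseteq> f ` topspace X" "openin X {x \<in> topspace X. f x \<in> S \<inter> T}"
      by auto
  next
    fix K
    assume K: "\<forall>U\<in>K. U \<subseteq> f ` topspace X \<and> openin X {x \<in> topspace X. f x \<in> U}"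
    have "{x \<in> topspace X. f x \<in> \<Union>K} = (\<Union>U\<in>K. {x \<in> topspace X. f x \<in> U})" by blast
    with K show "\<Union>K \<subseteq> f ` topspace X" "openin X {x \<in> topspace X. f x \<in> \<Union>K}"
      by auto
  qed
  then show ?thesis
    unfolding quotient_topology_def by (simp add: topology_inverse')
qed

definition translates :: "'v::real_vector set \<Rightarrow> 'v \<Rightarrow> 'v set" where
  "translates P x = (\<lambda>y. x + y) ` P"

definition quotient_group_topology :: "'v::euclidean_space set \<Rightarrow> 'v set \<Rightarrow> 'v set topology" where
  "quotient_group_topology U P = quotient_topology (top_of_set U) (translates P)"

text \<open>
  For \<open>P\<close> discrete, "small" means here that the projection is injective on the convex open set.
\<close>
definition torus_parallel ::
    "'v::euclidean_space set \<Rightarrow> 'v set \<Rightarrow> ('v set, 'v set, 'v) parallel" where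
  "torus_parallel U P =
     \<lparr>qtop = quotient_group_topology U P, model = U,
      index = {B. openin (top_of_set U) B \<and> convex B \<and> inj_on (translates P) B},
      cdom = (\<lambda>B. translates P ` B), chart = (\<lambda>B. inv_into B (translates P))\<rparr>"

definition orbit :: "('a, 'q, 'v::euclidean_space) parallel \<Rightarrow> 'v set \<Rightarrow> 'q \<Rightarrow> 'q set" where
  "orbit Q U q = (\<lambda>w. translate Q q w) ` U"

definition quotient_projection :: "'v::euclidean_space set \<Rightarrow> 'v set \<Rightarrow> ('v \<Rightarrow> 'w::euclidean_space) \<Rightarrow> bool" where
  "quotient_projection V U \<pi> \<longleftrightarrow> linear \<pi> \<and> {v \<in> V. \<pi> v = 0} = U"

text \<open>
  The quotient vector space of \<open>V\<close> by \<open>U\<close> is represented by \<open>\<pi> ` V\<close>, for a linear \<open>\<pi>\<close> with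
  \<open>quotient_projection V U \<pi>\<close>, and the projection \<open>V \<rightarrow> V/U\<close> by \<open>\<pi>\<close>.  The chart sends the
  orbit of \<open>q \<in> cdom Q \<alpha>\<close> to \<open>\<pi> (chart Q \<alpha> q)\<close>.
\<close>
definition orbit_parallel ::
    "('a, 'q, 'v::euclidean_space) parallel \<Rightarrow> 'v set \<Rightarrow> ('v \<Rightarrow> 'w::euclidean_space) \<Rightarrow>
     ('a, 'q set, 'w) parallel" where
  "orbit_parallel Q U \<pi> =
     \<lparr>qtop = quotient_topology (qtop Q) (orbit Q U), model = \<pi> ` model Q, index = index Q,
      cdom = (\<lambda>\<alpha>. orbit Q U ` cdom Q \<alpha>),
      chart = (\<lambda>\<alpha> c. THE y. \<exists>q\<in>cdom Q \<alpha>. orbit Q U q = c \<and> \<pi> (chart Q \<alpha> q) = y)\<rparr>"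


section \<open>Linear algebra and convexity\<close>

definition linear_complement :: "'v::euclidean_space set \<Rightarrow> 'v set \<Rightarrow> 'v set \<Rightarrow> bool" where
  "linear_complement V U C \<longleftrightarrow>
     subspace C \<and> C \<subseteq> V \<and> C \<inter> U = {0} \<and> {c + u |c u. c \<in> C \<and> u \<in> U} = V"

definition discrete_subgroup :: "'v::euclidean_space set \<Rightarrow> 'v set \<Rightarrow> bool" where
  "discrete_subgroup U P \<longleftrightarrow>
     P \<subseteq> U \<and> 0 \<in> P \<and> (\<forall>x\<in>P. \<forall>y\<in>P. x - y \<in> P) \<and> discrete P"

definition cocompact_subgroup :: "'v::euclidean_space set \<Rightarrow> 'v set \<Rightarrow> bool" where
  "cocompact_subgroup U P \<longleftrightarrow> compact_space (quotient_group_topology U P)"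

definition halfspace_description ::
    "'v::euclidean_space set \<Rightarrow> 'v set \<Rightarrow> 'i set \<Rightarrow> ('i \<Rightarrow> 'v \<Rightarrow> real) \<Rightarrow> ('i \<Rightarrow> real) \<Rightarrow> bool" where
  "halfspace_description V S I f c \<longleftrightarrow>
     (\<forall>i\<in>I. linear (f i)) \<and> S = {v \<in> V. \<forall>i\<in>I. f i v \<ge> c i}"

end

(*
  For a point p of Q let D p be the set of velocities v of motions that start at p and last at
  least up to time 1, and let p + v be the endpoint.  Completeness is used in two ways.  A chart
  around p has a closed image near p, so that Q is locally compact.  A motion that runs up to
  time 1 has a limit there: either it is periodic, or its finite segments have convex
  neighbourhoods, which make it Cauchy.

  The main step is a Tietze-Nakajima argument.  Along a segment p + s c, with 0 <= s <= 1, the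
  sets D (p + s c) near 0 are compact and convex, and the distance to them of a vector that
  depends affinely on s is locally midpoint convex in s.  If this distance vanishes at both ends,
  it vanishes everywhere.  Together with the completeness of motions this shows that D p is closed
  and convex and that (p + v) + w = p + (v + w) whenever either side is defined, so that
  v |-> p + v is an open continuous map from D p onto Q, injective modulo the period group P.
  By convexity D p is invariant under the span of P, hence D p = Delta + span P with Delta the
  part of D p in the complement C, and everything else can be read off from this splitting.

  If Q is compact, closed chart images and limits of motions come for free, and in the polyhedral
  case every point of Delta has a neighbourhood that contains no other extreme point of Delta.
*)
theory Submission
  imports Defs
begin

section \<open>Partial actions that are locally convex\<close>

text \<open>The identity \<open>(p + a) + b = p + (a + b)\<close> is at first known only for
  parallel vectors, or within the radius of \<open>good\<close>. For long vectors of different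
  directions one would have to fill the triangle they span, and a filling might run off the space.
  The quadrilateral lemma fills thin strips along a segment; completeness turns this into a
  continuity argument for arbitrary triangles (\<open>diff_in\<close>). Two points are close for the
  uniform structure only if one convex chart contains both, and charts are injective. Hence a motion
  that passes twice through a point needs a separate argument: no chart contains its loop. For an
  injective motion a chart around a long segment has to be constructed; it counts because
  completeness refers to all compatible convex charts. Completeness reaches the geometry only
  through \<open>compact_charts\<close> and \<open>extend\<close>. Compact spaces satisfy both
  directly, so the polyhedral case uses the same locales without any uniform structure.\<close>

text \<open>Within distance \<open>r\<close> of \<open>p\<close> the partial action of the vectors behaves as in a convex chart with
  closed image.  That it does so globally is a theorem, which needs completeness.\<close>

definition good :: "'q topology \<Rightarrow> ('q \<Rightarrow> 'v::euclidean_space set) \<Rightarrow> ('q \<Rightarrow> 'v \<Rightarrow> 'q) \<Rightarrow> 'q \<Rightarrow> real \<Rightarrow> bool" where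
  "good X D act p r \<longleftrightarrow> r > 0 \<and>
     (\<forall>a\<in>D p. \<forall>b\<in>D (act p a). norm a < r \<longrightarrow> norm (a + b) < r \<longrightarrow>
        a + b \<in> D p \<and> act p (a + b) = act (act p a) b) \<and>
     (\<forall>a\<in>D p. \<forall>b\<in>D p. norm a < r \<longrightarrow> norm b < r \<longrightarrow>
        b - a \<in> D (act p a) \<and> act (act p a) (b - a) = act p b) \<and>
     (\<forall>r'<r. closed (D p \<inter> cball 0 r')) \<and>
     continuous_map (top_of_set (D p \<inter> ball 0 r)) X (act p) \<and>
     open_map (top_of_set (D p \<inter> ball 0 r)) X (act p) \<and>
     inj_on (act p) (D p \<inter> ball 0 r)"

text \<open>Abstracts from charts: \<open>D p\<close> stands for the vectors along which one can
  move from \<open>p\<close> up to time 1. \<open>line_iff\<close> and \<open>line_eq\<close> speak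
  of multiples of a single \<open>v\<close>; relations between different directions can come only
  from \<open>good\<close>.\<close>

locale flat_action =
  fixes X :: "'q topology" and D :: "'q \<Rightarrow> 'v::euclidean_space set"
    and act :: "'q \<Rightarrow> 'v \<Rightarrow> 'q" (infixl "\<oplus>" 65)
  assumes D_base: "v \<in> D p \<Longrightarrow> p \<in> topspace X"
    and zero_in: "p \<in> topspace X \<Longrightarrow> 0 \<in> D p"
    and act_zero: "p \<in> topspace X \<Longrightarrow> p \<oplus> 0 = p"
    and act_in: "v \<in> D p \<Longrightarrow> p \<oplus> v \<in> topspace X"
    and shrink: "v \<in> D p \<Longrightarrow> 0 \<le> s \<Longrightarrow> s \<le> 1 \<Longrightarrow> s *\<^sub>R v \<in> D p"
    and line_iff: "s *\<^sub>R v \<in> D p \<Longrightarrow> t *\<^sub>R v \<in> D (p \<oplus> s *\<^sub>R v) \<longleftrightarrow> (s + t) *\<^sub>R v \<in> D p"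
    and line_eq: "s *\<^sub>R v \<in> D p \<Longrightarrow> (s + t) *\<^sub>R v \<in> D p \<Longrightarrow>
        (p \<oplus> s *\<^sub>R v) \<oplus> t *\<^sub>R v = p \<oplus> (s + t) *\<^sub>R v"
    and ex_good: "p \<in> topspace X \<Longrightarrow> \<exists>r. good X D act p r"
begin

abbreviation gd where "gd \<equiv> good X D act"

lemma gd_pos: "gd p r \<Longrightarrow> r > 0"
  by (simp add: good_def)

lemma gd_add:
  assumes "gd p r" "a \<in> D p" "b \<in> D (p \<oplus> a)" "norm a < r" "norm (a + b) < r"
  shows "a + b \<in> D p" "p \<oplus> (a + b) = p \<oplus> a \<oplus> b"
  using assms unfolding good_def by blast+

lemma gd_diff:
  assumes "gd p r" "a \<in> D p" "b \<in> D p" "norm a < r" "norm b < r"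
  shows "b - a \<in> D (p \<oplus> a)" "p \<oplus> a \<oplus> (b - a) = p \<oplus> b"
  using assms unfolding good_def by blast+

lemma gd_closed: "gd p r \<Longrightarrow> r' < r \<Longrightarrow> closed (D p \<inter> cball 0 r')"
  by (simp add: good_def)

lemma gd_inj: "gd p r \<Longrightarrow> inj_on (act p) (D p \<inter> ball 0 r)"
  by (simp add: good_def)

lemma gd_cont: "gd p r \<Longrightarrow> continuous_map (top_of_set (D p \<inter> ball 0 r)) X (act p)"
  by (simp add: good_def)

lemma gd_open: "gd p r \<Longrightarrow> open_map (top_of_set (D p \<inter> ball 0 r)) X (act p)"
  by (simp add: good_def)

lemma neg_in: "v \<in> D p \<Longrightarrow> - v \<in> D (p \<oplus> v)"
  and act_neg: "v \<in> D p \<Longrightarrow> p \<oplus> v \<oplus> (- v) = p"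
  using line_iff[of 1 v p "-1"] line_eq[of 1 v p "-1"] zero_in act_zero D_base by auto

lemma act_cancel:
  assumes "w \<in> D p" "w \<in> D q" "p \<oplus> w = q \<oplus> w"
  shows "p = q"
  by (metis act_neg assms)

lemma segment_in:
  assumes "v \<in> D p" "0 \<le> s" "s \<le> 1" "0 \<le> t" "t \<le> 1"
  shows "(t - s) *\<^sub>R v \<in> D (p \<oplus> s *\<^sub>R v)" "p \<oplus> s *\<^sub>R v \<oplus> (t - s) *\<^sub>R v = p \<oplus> t *\<^sub>R v"
  using line_iff[of s v p "t - s"] line_eq[of s v p "t - s"] shrink[of v p] assms by auto

lemma gd_mono:
  assumes "gd p r" "0 < r'" "r' \<le> r"
  shows "gd p r'"
proof -
  have sub: "D p \<inter> ball 0 r' \<subseteq> D p \<inter> ball 0 r" using assms by auto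
  have "continuous_map (top_of_set (D p \<inter> ball 0 r')) X (act p)"
    using continuous_map_from_subtopology_mono[OF gd_cont[OF assms(1)] sub] .
  moreover have "open_map (top_of_set (D p \<inter> ball 0 r')) X (act p)"
    unfolding open_map_def
  proof (intro allI impI)
    fix U assume U: "openin (top_of_set (D p \<inter> ball 0 r')) U"
    have "openin (top_of_set (D p \<inter> ball 0 r)) (D p \<inter> ball 0 r')"
    proof -
      have "D p \<inter> ball 0 r' = (D p \<inter> ball 0 r) \<inter> ball 0 r'" using sub by blast
      then show ?thesis by (metis openin_open_Int open_ball)
    qed
    with U have "openin (top_of_set (D p \<inter> ball 0 r)) U" using openin_trans by blast
    then show "openin X (act p ` U)" using gd_open[OF assms(1)] by (simp add: open_map_def)
  qed
  moreover have "inj_on (act p) (D p \<inter> ball 0 r')"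
    using gd_inj[OF assms(1)] sub inj_on_subset by blast
  ultimately show ?thesis using assms unfolding good_def by (auto simp del: mem_ball)
qed

text \<open>Translation by \<open>a\<close> carries the ball of radius \<open>r - norm a\<close>
  into the ball of radius \<open>r\<close>, and every clause of \<open>good\<close> at
  \<open>p \<oplus> a\<close> is a clause at \<open>p\<close> seen through this translation.\<close>

lemma gd_shift:
  assumes "gd p r" "a \<in> D p" "norm a < r"
  shows "gd (p \<oplus> a) (r - norm a)"
proof -
  let ?q = "p \<oplus> a" let ?r = "r - norm a"
  have tri: "norm (a + x) < r" if "norm x < ?r" for x
    using that norm_triangle_ineq[of a x] by linarith
  have add: "a + x \<in> D p" "p \<oplus> (a + x) = ?q \<oplus> x" if "x \<in> D ?q" "norm x < ?r" for x
    using gd_add[OF assms(1,2) that(1) assms(3) tri[OF that(2)]] by auto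
  have sub: "x \<in> D ?q" if "a + x \<in> D p" "norm x < ?r" for x
    using gd_diff(1)[OF assms(1,2) that(1) assms(3) tri[OF that(2)]] by simp
  have "x + y \<in> D ?q \<and> ?q \<oplus> (x + y) = ?q \<oplus> x \<oplus> y"
    if "x \<in> D ?q" "y \<in> D (?q \<oplus> x)" "norm x < ?r" "norm (x + y) < ?r" for x y
  proof -
    have "y \<in> D (p \<oplus> (a + x))" using add(2)[OF that(1,3)] that(2) by simp
    then have "a + x + y \<in> D p" "p \<oplus> (a + x + y) = p \<oplus> (a + x) \<oplus> y"
      using gd_add[OF assms(1) add(1)[OF that(1,3)]] tri[OF that(3)] tri[OF that(4)]
      by (auto simp: add.assoc)
    then show ?thesis using sub add that by (metis add.assoc)
  qed
  moreover have "y - x \<in> D (?q \<oplus> x) \<and> ?q \<oplus> x \<oplus> (y - x) = ?q \<oplus> y"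
    if "x \<in> D ?q" "y \<in> D ?q" "norm x < ?r" "norm y < ?r" for x y
    using gd_diff[OF assms(1) add(1)[OF that(1,3)] add(1)[OF that(2,4)] tri[OF that(3)] tri[OF that(4)]]
      add(2)[OF that(1,3)] add(2)[OF that(2,4)] by simp
  moreover have "closed (D ?q \<inter> cball 0 r')" if "r' < ?r" for r'
  proof -
    have "D ?q \<inter> cball 0 r' = (\<lambda>x. - a + x) ` ((D p \<inter> cball 0 (norm a + r')) \<inter> cball a r')" (is "?L = ?R")
    proof (intro set_eqI iffI)
      fix x assume x: "x \<in> ?L"
      then have "a + x \<in> D p" using add that by auto
      moreover have "norm (a + x) \<le> norm a + r'" using x norm_triangle_ineq[of a x] by auto
      ultimately have "a + x \<in> (D p \<inter> cball 0 (norm a + r')) \<inter> cball a r'"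
        using x dist_norm[of a "a + x"] by simp
      then show "x \<in> ?R" by (rule_tac image_eqI[where x="a+x"]) auto
    next
      fix x assume "x \<in> ?R"
      then obtain y where y: "x = - a + y" "y \<in> D p" "y \<in> cball a r'" by auto
      have "norm x \<le> r'" using y by (simp add: dist_norm norm_minus_commute)
      moreover have "a + x \<in> D p" using y by simp
      ultimately show "x \<in> ?L" using sub[of x] that by auto
    qed
    moreover from that have "closed (D p \<inter> cball 0 (norm a + r'))"
      by (intro gd_closed[OF assms(1)]) simp
    then have "closed ?R" by (rule closed_translation[OF closed_Int[OF _ closed_cball]])
    ultimately show ?thesis by simp
  qed
  moreover have mt: "continuous_map (top_of_set (D ?q \<inter> ball 0 ?r)) (top_of_set (D p \<inter> ball 0 r)) (\<lambda>x. a + x)"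
    using add tri by (auto simp: continuous_map_in_subtopology intro!: continuous_intros)
  have "continuous_map (top_of_set (D ?q \<inter> ball 0 ?r)) X (act ?q)"
    using continuous_map_compose[OF mt gd_cont[OF assms(1)]]
    by (rule continuous_map_eq) (use add in auto)
  moreover have "open_map (top_of_set (D ?q \<inter> ball 0 ?r)) X (act ?q)"
    unfolding open_map_def
  proof (intro allI impI)
    fix U assume "openin (top_of_set (D ?q \<inter> ball 0 ?r)) U"
    then obtain T where T: "open T" "U = D ?q \<inter> ball 0 ?r \<inter> T" by (auto simp: openin_open)
    \<comment> \<open>Translated by \<open>a\<close>, the set \<open>U\<close> is cut out of
      \<open>D p\<close> by an open set inside the ball around \<open>a\<close>.\<close>
    have "act ?q ` U = act p ` (D p \<inter> ball 0 r \<inter> (((\<lambda>x. a + x) ` T) \<inter> ball a ?r))"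
    proof (intro set_eqI iffI)
      fix z assume "z \<in> act ?q ` U"
      then obtain x where "x \<in> U" "z = ?q \<oplus> x" by auto
      then show "z \<in> act p ` (D p \<inter> ball 0 r \<inter> (((\<lambda>x. a + x) ` T) \<inter> ball a ?r))"
        using T add[of x] tri[of x] by (intro image_eqI[where x="a+x"]) (auto simp: dist_norm[of a])
    next
      fix z assume "z \<in> act p ` (D p \<inter> ball 0 r \<inter> (((\<lambda>x. a + x) ` T) \<inter> ball a ?r))"
      then obtain x where x: "a + x \<in> D p" "x \<in> T" "norm x < ?r" "z = p \<oplus> (a + x)"
        by (auto simp: dist_norm[of a])
      then show "z \<in> act ?q ` U"
        using T add[of x] sub[of x] by (intro image_eqI[where x="x"]) auto
    qed
    moreover have "open (((\<lambda>x. a + x) ` T) \<inter> ball a ?r)" using T by (intro open_Int open_translation) auto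
    ultimately show "openin X (act ?q ` U)"
      using gd_open[OF assms(1)] unfolding open_map_def by (simp add: openin_open_Int)
  qed
  moreover have "inj_on (act ?q) (D ?q \<inter> ball 0 ?r)"
  proof (rule inj_onI)
    fix x y assume xy: "x \<in> D ?q \<inter> ball 0 ?r" "y \<in> D ?q \<inter> ball 0 ?r" "?q \<oplus> x = ?q \<oplus> y"
    then have "p \<oplus> (a + x) = p \<oplus> (a + y)" using add by auto
    moreover have "a + x \<in> D p \<inter> ball 0 r" "a + y \<in> D p \<inter> ball 0 r" using xy add tri by auto
    ultimately have "a + x = a + y" using gd_inj[OF assms(1)] by (meson inj_onD)
    then show "x = y" by simp
  qed
  ultimately show ?thesis using assms(3) unfolding good_def by (auto simp del: mem_ball)
qed

text \<open>A Lebesgue number for the segment: by \<open>gd_shift\<close> the radius at one point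
  bounds the radii nearby from below, and bisection makes the bound uniform on the compact
  interval.\<close>

lemma uniform_good:
  assumes "c \<in> D p"
  shows "\<exists>r. \<forall>t\<in>{0..1}. gd (p \<oplus> t *\<^sub>R c) r"
proof -
  define P where "P a b \<longleftrightarrow> (\<exists>r>0. \<forall>t\<in>{0..1}. a \<le> t \<longrightarrow> t \<le> b \<longrightarrow> gd (p \<oplus> t *\<^sub>R c) r)" for a b :: real
  have "P 0 1"
  proof (rule Bolzano)
    show "(0::real) \<le> 1" by simp
  next
    fix a b d :: real
    assume "P a b" "P b d" "a \<le> b" "b \<le> d"
    then obtain r1 r2 where r: "r1 > 0" "\<And>t. t \<in> {0..1} \<Longrightarrow> a \<le> t \<Longrightarrow> t \<le> b \<Longrightarrow> gd (p \<oplus> t *\<^sub>R c) r1"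
       "r2 > 0" "\<And>t. t \<in> {0..1} \<Longrightarrow> b \<le> t \<Longrightarrow> t \<le> d \<Longrightarrow> gd (p \<oplus> t *\<^sub>R c) r2"
      unfolding P_def by metis
    have "gd (p \<oplus> t *\<^sub>R c) (min r1 r2)" if "t \<in> {0..1}" "a \<le> t" "t \<le> d" for t
    proof (cases "t \<le> b")
      case True then show ?thesis using r that by (intro gd_mono[OF r(2)]) auto
    next
      case False then show ?thesis using r that by (intro gd_mono[OF r(4)]) auto
    qed
    then show "P a d" unfolding P_def using r by (intro exI[of _ "min r1 r2"]) auto
  next
    fix x :: real assume x: "0 \<le> x" "x \<le> 1"
    then obtain r where r: "gd (p \<oplus> x *\<^sub>R c) r"
      using ex_good act_in shrink assms by blast
    \<comment> \<open>Within time \<open>d\<close> the segment moves by at most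
      \<open>r / 2\<close>, so half of the radius survives. The summand 1 covers
      \<open>c = 0\<close>.\<close>
    define d where "d = r / (2 * (norm c + 1))"
    have "r > 0" using gd_pos r by blast
    then have d: "d > 0" unfolding d_def by (simp add: add_nonneg_pos)
    have "gd (p \<oplus> t *\<^sub>R c) (r / 2)" if t: "t \<in> {0..1}" "\<bar>t - x\<bar> < d" for t
    proof -
      have "norm ((t - x) *\<^sub>R c) \<le> d * norm c" using t by (simp add: mult_right_mono)
      also have "\<dots> \<le> d * (norm c + 1)" using d by simp
      also have "\<dots> = r / 2" unfolding d_def using norm_ge_zero[of c] by (simp add: field_simps add_nonneg_eq_0_iff)
      finally have n: "norm ((t - x) *\<^sub>R c) \<le> r / 2" .
      have "gd (p \<oplus> x *\<^sub>R c \<oplus> (t - x) *\<^sub>R c) (r - norm ((t - x) *\<^sub>R c))"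
        using n \<open>r > 0\<close> segment_in(1)[OF assms, of x t] x t by (intro gd_shift[OF r]) auto
      then have "gd (p \<oplus> t *\<^sub>R c) (r - norm ((t - x) *\<^sub>R c))"
        using segment_in(2)[OF assms, of x t] x t by simp
      then show ?thesis using n \<open>r > 0\<close> by (elim gd_mono) auto
    qed
    then show "\<exists>d>0. \<forall>a b. a \<le> x \<and> x \<le> b \<and> b - a < d \<longrightarrow> P a b"
      unfolding P_def using d \<open>r > 0\<close> 
      by (intro exI[of _ d]) (auto intro!: exI[of _ "r/2"])
  qed
  then show ?thesis unfolding P_def by auto
qed

text \<open>A path that is a motion of velocity \<open>w\<close> near every time is one single
  motion, because the relation to the starting point spreads along the connected interval.\<close>

lemma local_motion:
  assumes g0: "g 0 \<in> topspace X"
    and loc: "\<And>s. s \<in> {0..1} \<Longrightarrow> \<exists>e>0. \<forall>t\<in>{0..1}. \<bar>t - s\<bar> < e \<longrightarrow>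
      (t - s) *\<^sub>R w \<in> D (g s) \<and> g t = g s \<oplus> (t - s) *\<^sub>R w"
    and s: "s \<in> {0..1::real}"
  shows "s *\<^sub>R w \<in> D (g 0) \<and> g s = g 0 \<oplus> s *\<^sub>R w"
proof -
  define P where "P s \<longleftrightarrow> s *\<^sub>R w \<in> D (g 0) \<and> g s = g 0 \<oplus> s *\<^sub>R w" for s
  have "P s"
  proof (rule connected_induction_simple[of "{0..1::real}" 0 s])
    show "P 0" unfolding P_def using g0 zero_in act_zero by auto
  next
    fix s :: real assume s: "s \<in> {0..1}"
    obtain e where e: "e > 0" "\<forall>t\<in>{0..1}. \<bar>t - s\<bar> < e \<longrightarrow>
      (t - s) *\<^sub>R w \<in> D (g s) \<and> g t = g s \<oplus> (t - s) *\<^sub>R w" using loc[OF s] by auto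
    have st: "P t" if P: "P s" and t: "t \<in> {0..1}" "\<bar>t - s\<bar> < e" for t
      using e(2)[rule_format, OF t] P line_iff[of s w "g 0" "t - s"] line_eq[of s w "g 0" "t - s"]
      unfolding P_def by auto
    \<comment> \<open>The induction on a connected set passes between any two points of a
      neighbourhood, in either order, so the step has to be reversible.\<close>
    have ts: "P s" if P: "P t" and t: "t \<in> {0..1}" "\<bar>t - s\<bar> < e" for t
    proof -
      have "- ((t - s) *\<^sub>R w) \<in> D (g t)" "g t \<oplus> - ((t - s) *\<^sub>R w) = g s"
        using neg_in[of "(t - s) *\<^sub>R w" "g s"] act_neg[of "(t - s) *\<^sub>R w" "g s"] e(2) t by auto
      then have "(s - t) *\<^sub>R w \<in> D (g t)" "g t \<oplus> (s - t) *\<^sub>R w = g s"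
        by (simp_all add: algebra_simps)
      then show ?thesis
        using P line_iff[of t w "g 0" "s - t"] line_eq[of t w "g 0" "s - t"]
        unfolding P_def by auto
    qed
    show "\<exists>T. openin (top_of_set {0..1}) T \<and> s \<in> T \<and> (\<forall>x\<in>T. \<forall>y\<in>T. P x \<longrightarrow> P y)"
    proof (intro exI conjI ballI impI)
      show "openin (top_of_set {0..1}) ({0..1} \<inter> ball s e)" by (rule openin_open_Int) simp
      show "s \<in> {0..1} \<inter> ball s e" using s e(1) by simp
      fix x y assume xy: "x \<in> {0..1} \<inter> ball s e" "y \<in> {0..1} \<inter> ball s e" "P x"
      then have "P s" using ts[of x] by (simp add: dist_real_def abs_minus_commute)
      then show "P y" using st[of y] xy by (simp add: dist_real_def abs_minus_commute)
    qed
  qed (use s in auto)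
  then show ?thesis unfolding P_def .
qed

end

section \<open>Locally midpoint convex functions on an interval\<close>

lemma midpoint_convex_nonpos:
  fixes d :: "real \<Rightarrow> real"
  assumes bdd: "\<And>s. s \<in> {0..1} \<Longrightarrow> d s \<le> B"
    and "d 0 \<le> 0" "d 1 \<le> 0" and "e > 0"
    and mid: "\<And>s h. 0 < h \<Longrightarrow> h < e \<Longrightarrow> 0 \<le> s - h \<Longrightarrow> s + h \<le> 1 \<Longrightarrow> 2 * d s \<le> d (s - h) + d (s + h)"
    and s: "s \<in> {0..1}"
  shows "d s \<le> 0"
proof -
  have half: "d s \<le> 0"
    if bdd: "\<And>s. s \<in> {0..1} \<Longrightarrow> d s \<le> M" and d0: "d 0 \<le> 0" 
     and mid: "\<And>s h. 0 < h \<Longrightarrow> h < e \<Longrightarrow> 0 \<le> s - h \<Longrightarrow> s + h \<le> 1 \<Longrightarrow> 2 * d s \<le> d (s - h) + d (s + h)"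
     \<comment> \<open>The number of steps is fixed before the point \<open>s\<close>: a step
       \<open>s / k\<close> is then shorter than \<open>e\<close>, and \<open>s + h\<close> does not
       pass 1.\<close>
     and k: "real k * min e (1/2) > 1" 
     and s: "0 \<le> s" "s \<le> 1/2" and big: "d s > M - M / 2 ^ k" and M: "M > 0"
    for d :: "real \<Rightarrow> real" and M s and k :: nat
  proof (cases "s = 0")
    case False
    have "k > 0" using k by (cases k) auto
    define h where "h = s / real k"
    have h: "0 < h" using False s \<open>k > 0\<close> unfolding h_def by auto
    have "1 / real k < m" if "real k * m > 1" for m using that \<open>k > 0\<close> by (simp add: field_simps)
    with k have "1 / real k < min e (1/2)" by blast
    moreover have "h \<le> 1 / real k" using s \<open>k > 0\<close> unfolding h_def by (simp add: divide_right_mono)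
    ultimately have h2: "h < e" "h < 1/2" by auto
    have kh: "real k * h = s" unfolding h_def using \<open>k > 0\<close> by simp
    have jh: "real j * h \<le> s" if "j \<le> k" for j
    proof -
      have "real j * h \<le> real k * h" using that h by (intro mult_right_mono) auto
      then show ?thesis using kh by simp
    qed
    have "j \<le> k \<Longrightarrow> d (s - real j * h) > M - 2 ^ j * (M / 2 ^ k)" for j
    proof (induction j)
      case 0 then show ?case using big by simp
    next
      case (Suc j)
      let ?t = "s - real j * h"
      have e: "?t - h = s - real (Suc j) * h" by (simp add: algebra_simps)
      have "0 \<le> ?t - h" using jh[OF Suc.prems] e by simp
      moreover have "?t + h \<le> 1" using s h2 h by (simp add: algebra_simps) (smt (verit) mult_nonneg_nonneg of_nat_0_le_iff)
      ultimately have "2 * d ?t \<le> d (?t - h) + d (?t + h)" using mid h h2 by blast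
      moreover have "d (?t + h) \<le> M" using \<open>0 \<le> ?t - h\<close> \<open>?t + h \<le> 1\<close> h by (intro bdd) auto
      moreover have "d ?t > M - 2 ^ j * (M / 2 ^ k)" using Suc by auto
      ultimately show ?case unfolding e by simp
    qed
    from this[of k] kh have "d 0 > 0" by simp
    then show ?thesis using d0 by auto
  qed (use d0 in auto)
  show ?thesis
  proof (rule ccontr)
    assume n: "\<not> d s \<le> 0"
    define M where "M = (SUP s\<in>{0..1}. d s)"
    have ba: "bdd_above (d ` {0..1})" using bdd by (meson bdd_aboveI2)
    have le: "d t \<le> M" if "t \<in> {0..1}" for t unfolding M_def using ba that by (intro cSUP_upper)
    have M: "M > 0" using le[OF s] n by auto
    obtain k :: nat where k: "real k * min e (1/2) > 1"
      using reals_Archimedean3[of "min e (1/2)"] \<open>e > 0\<close> by (metis min_less_iff_conj zero_less_divide_1_iff zero_less_numeral)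
    have "M - M / 2 ^ k < (SUP s\<in>{0..1}. d s)" using M unfolding M_def[symmetric] by simp
    then obtain t where t: "t \<in> {0..1}" "d t > M - M / 2 ^ k"
      by (subst (asm) less_cSUP_iff) (use ba in auto)
    have "M / 2 ^ k \<le> M" using M by (simp add: divide_le_eq mult_le_cancel_left1)
    then have pos: "d t > 0" using t by simp
    show False
    proof (cases "t \<le> 1/2")
      case True
      then show ?thesis using half[OF le assms(2) mid k, of t] t M pos by auto
    next
      case False
      \<comment> \<open>The right half is the left half after the reflection
        \<open>t \<mapsto> 1 - t\<close>.\<close>
      have mid': "2 * d (1 - s) \<le> d (1 - (s - h)) + d (1 - (s + h))"
        if "0 < h" "h < e" "0 \<le> s - h" "s + h \<le> 1" for s h
        using mid[of h "1 - s"] that by (simp add: algebra_simps)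
      have "d (1 - (1 - t)) \<le> 0"
        by (rule half[of "\<lambda>t. d (1 - t)" M k "1 - t"])
          (use le assms(3) k t M False mid' in auto)
      then show ?thesis using pos by simp
    qed
  qed
qed

lemma continuous_map_locally:
  assumes "\<And>x. x \<in> topspace T \<Longrightarrow> h x \<in> topspace Y"
    and "\<And>x W. x \<in> topspace T \<Longrightarrow> openin Y W \<Longrightarrow> h x \<in> W \<Longrightarrow> \<exists>U. openin T U \<and> x \<in> U \<and> h ` U \<subseteq> W"
  shows "continuous_map T Y h"
  unfolding continuous_map
proof (intro conjI allI impI)
  show "h ` topspace T \<subseteq> topspace Y" using assms(1) by blast
  fix W assume W: "openin Y W"
  show "openin T {x \<in> topspace T. h x \<in> W}"
  proof (subst openin_subopen, intro ballI)
    fix x assume "x \<in> {x \<in> topspace T. h x \<in> W}"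
    then obtain U where "openin T U" "x \<in> U" "h ` U \<subseteq> W" using assms(2)[OF _ W] by blast
    then show "\<exists>U. openin T U \<and> x \<in> U \<and> U \<subseteq> {x \<in> topspace T. h x \<in> W}"
      using openin_subset by (intro exI[of _ U]) auto
  qed
qed

section \<open>Thin quadrilaterals, and the local structure at distant points\<close>

context flat_action begin

lemma gd_convex:
  assumes "gd p r" "a \<in> D p" "b \<in> D p" "norm a < r" "norm b < r" "0 \<le> s" "s \<le> 1"
  shows "a + s *\<^sub>R (b - a) \<in> D p" "p \<oplus> a \<oplus> s *\<^sub>R (b - a) = p \<oplus> (a + s *\<^sub>R (b - a))"
proof -
  have 1: "s *\<^sub>R (b - a) \<in> D (p \<oplus> a)" using gd_diff(1)[OF assms(1-5)] shrink assms by blast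
  have "a + s *\<^sub>R (b - a) \<in> ball 0 r"
    using convexD_alt[of "ball (0::'v) r" a b s] assms by (simp add: convex_ball algebra_simps del: mem_ball) 
  then have 2: "norm (a + s *\<^sub>R (b - a)) < r" by simp
  show "a + s *\<^sub>R (b - a) \<in> D p" "p \<oplus> a \<oplus> s *\<^sub>R (b - a) = p \<oplus> (a + s *\<^sub>R (b - a))"
    using gd_add[OF assms(1,2) 1 assms(4) 2] by auto
qed

text \<open>The distances of the interpolated vectors to the compact convex sets
  \<^term>\<open>D (p \<oplus> s *\<^sub>R c) \<inter> cball 0 (r / 2)\<close> form a locally midpoint convex function of \<open>s\<close>
  that vanishes at both ends.\<close>

lemma quadrilateral:
  assumes c: "c \<in> D p" and g: "\<And>t. t \<in> {0..1} \<Longrightarrow> gd (p \<oplus> t *\<^sub>R c) r"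
    and x: "x \<in> D p" "norm x < r / 4" and y: "y \<in> D (p \<oplus> c)" "norm y < r / 4"
    and s: "s \<in> {0..1}"
  shows "(1 - s) *\<^sub>R x + s *\<^sub>R y \<in> D (p \<oplus> s *\<^sub>R c)"
    and "s *\<^sub>R (c + y - x) \<in> D (p \<oplus> x)"
    and "p \<oplus> x \<oplus> s *\<^sub>R (c + y - x) = p \<oplus> s *\<^sub>R c \<oplus> ((1 - s) *\<^sub>R x + s *\<^sub>R y)"
proof -
  define u where "u s = (1 - s) *\<^sub>R x + s *\<^sub>R y" for s :: real
  define K where "K s = D (p \<oplus> s *\<^sub>R c) \<inter> cball 0 (r / 2)" for s :: real
  define d where "d s = infdist (u s) (K s)" for s :: real
  have p: "p \<in> topspace X" using D_base c by blast
  have r: "r > 0" using gd_pos g[of 0] by simp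
  have zK: "0 \<in> K s" if "s \<in> {0..1}" for s
    unfolding K_def using r zero_in act_in shrink[OF c, of s] that by auto
  have clK: "closed (K s)" if "s \<in> {0..1}" for s
    unfolding K_def using g[OF that] r by (intro gd_closed) auto
  have nu: "norm (u s) < r / 4" if "s \<in> {0..1}" for s
  proof -
    have "(1 - s) *\<^sub>R x + s *\<^sub>R y \<in> ball 0 (r / 4)"
      using that x y by (intro convexD_alt[OF convex_ball, of x 0 "r/4" y s]) auto
    then show ?thesis unfolding u_def by simp
  qed
  have dle: "d s \<le> r / 4" if "s \<in> {0..1}" for s
  proof -
    have "d s \<le> dist (u s) 0" unfolding d_def using zK[OF that] by (rule infdist_le)
    then show ?thesis using nu[OF that] by simp
  qed
  have near: "\<exists>a\<in>K s. d s = dist (u s) a" if "s \<in> {0..1}" for s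
    unfolding d_def using infdist_attains_inf[OF clK[OF that]] zK[OF that] by blast
  \<comment> \<open>Shifting the base point for less than \<open>e\<close> costs less than
    \<open>r / 4\<close>. With nearest points of norm at most \<open>r / 2\<close>, all sums stay
    below \<open>r\<close>.\<close>
  define e where "e = r / (4 * (norm c + 1))"
  have e: "e > 0" unfolding e_def using r by (simp add: add_nonneg_pos)
  have ec: "norm (h *\<^sub>R c) < r / 4" if "\<bar>h\<bar> < e" for h
  proof -
    have "norm (h *\<^sub>R c) \<le> \<bar>h\<bar> * (norm c + 1)" by (simp add: mult_left_mono)
    also have "\<dots> < e * (norm c + 1)" using that by (intro mult_strict_right_mono) (auto simp: add_nonneg_pos)
    also have "\<dots> = r / 4" unfolding e_def using norm_ge_zero[of c] by (simp add: field_simps add_nonneg_eq_0_iff)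
    finally show ?thesis .
  qed
  have mid: "2 * d s \<le> d (s - h) + d (s + h)" if h: "0 < h" "h < e" "0 \<le> s - h" "s + h \<le> 1" for s h
  proof -
    have s: "s \<in> {0..1}" and sm: "s - h \<in> {0..1}" and sp: "s + h \<in> {0..1}" using h by auto
    \<comment> \<open>A vector at the base point with parameter \<open>s + k\<close> is rewritten as
      one at parameter \<open>s\<close>, so that both nearest points are seen in a single
      \<open>good\<close> neighbourhood.\<close>
    have pt: "k *\<^sub>R c + a \<in> D (p \<oplus> s *\<^sub>R c)" "norm (k *\<^sub>R c + a) < r" "norm a \<le> r / 2"
      if a: "a \<in> K (s + k)" and k: "s + k \<in> {0..1}" "\<bar>k\<bar> < e" for a k
    proof -
      have seg: "k *\<^sub>R c \<in> D (p \<oplus> s *\<^sub>R c)" "p \<oplus> s *\<^sub>R c \<oplus> k *\<^sub>R c = p \<oplus> (s + k) *\<^sub>R c"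
        using segment_in[OF c, of s "s + k"] s k by auto
      show na: "norm a \<le> r / 2" using a unfolding K_def by simp
      show n: "norm (k *\<^sub>R c + a) < r"
        using norm_triangle_ineq[of "k *\<^sub>R c" a] ec[OF k(2)] na r by linarith
      show "k *\<^sub>R c + a \<in> D (p \<oplus> s *\<^sub>R c)"
        using gd_add(1)[OF g[OF s] seg(1), of a] a n ec[OF k(2)] r unfolding K_def seg(2) by auto
    qed
    obtain a b where a: "a \<in> K (s - h)" "d (s - h) = dist (u (s - h)) a"
      and b: "b \<in> K (s + h)" "d (s + h) = dist (u (s + h)) b" using near sm sp by blast
    have A: "(-h) *\<^sub>R c + a \<in> D (p \<oplus> s *\<^sub>R c)" "norm ((-h) *\<^sub>R c + a) < r" "norm a \<le> r / 2"
      using pt[of a "-h"] a sm h by auto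
    have B: "h *\<^sub>R c + b \<in> D (p \<oplus> s *\<^sub>R c)" "norm (h *\<^sub>R c + b) < r" "norm b \<le> r / 2"
      using pt[of b h] b sp h by auto
    \<comment> \<open>The shifts by \<open>-h\<close> and \<open>h\<close> cancel in the midpoint,
      which thus becomes a competitor for the distance at \<open>s\<close>.\<close>
    have "(-h) *\<^sub>R c + a + (1/2) *\<^sub>R ((h *\<^sub>R c + b) - ((-h) *\<^sub>R c + a)) \<in> D (p \<oplus> s *\<^sub>R c)"
      using gd_convex(1)[OF g[OF s] A(1) B(1) A(2) B(2), of "1/2"] by simp
    also have "(-h) *\<^sub>R c + a + (1/2) *\<^sub>R ((h *\<^sub>R c + b) - ((-h) *\<^sub>R c + a)) = (1/2) *\<^sub>R (a + b)"
    proof -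
      have "x + (1/2) *\<^sub>R (y - x) = (1/2) *\<^sub>R (x + y)" for x y :: 'v
      proof -
        have "x - (1/2) *\<^sub>R x = (1 - 1/2) *\<^sub>R x" by (simp only: scaleR_left_diff_distrib scaleR_one)
        then show ?thesis by (simp add: scaleR_diff_right scaleR_add_right)
      qed
      then show ?thesis by simp
    qed
    finally have "(1/2) *\<^sub>R (a + b) \<in> K s"
      unfolding K_def using A(3) B(3) norm_triangle_ineq[of a b] by simp
    then have "d s \<le> dist (u s) ((1/2) *\<^sub>R (a + b))" unfolding d_def by (rule infdist_le)
    moreover have "u s - (1/2) *\<^sub>R (a + b) = (1/2) *\<^sub>R ((u (s - h) - a) + (u (s + h) - b))"
    proof -
      have "u (s - h) + u (s + h) = 2 *\<^sub>R u s" unfolding u_def scaleR_2 by (simp add: algebra_simps)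
      then have e: "(u (s - h) - a) + (u (s + h) - b) = 2 *\<^sub>R u s - (a + b)" by simp
      show ?thesis unfolding e by (simp add: scaleR_diff_right)
    qed
    then have "2 * dist (u s) ((1/2) *\<^sub>R (a + b)) = norm ((u (s - h) - a) + (u (s + h) - b))"
      by (simp add: dist_norm)
    ultimately show ?thesis
      using norm_triangle_ineq[of "u (s - h) - a" "u (s + h) - b"] unfolding a(2) b(2) dist_norm by linarith
  qed
  have x': "x \<in> K 0" "y \<in> K 1" using x y r p act_zero unfolding K_def by auto
  then have d01: "d 0 \<le> 0" "d 1 \<le> 0" unfolding d_def u_def by auto
  have uD: "u s \<in> D (p \<oplus> s *\<^sub>R c)" if s: "s \<in> {0..1}" for s
  proof -
    have "d s \<le> 0" using midpoint_convex_nonpos[of d, OF dle d01 e mid s] .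
    with near[OF s] have "u s \<in> K s" by (metis dist_eq_0_iff order_antisym zero_le_dist)
    then show ?thesis unfolding K_def by simp
  qed
  from uD[OF s] show "(1 - s) *\<^sub>R x + s *\<^sub>R y \<in> D (p \<oplus> s *\<^sub>R c)" unfolding u_def .
  \<comment> \<open>\<open>w\<close> is the side opposite to \<open>c\<close>, and \<open>q\<close>
    runs along it from \<open>p \<oplus> x\<close> to
    \<open>p \<oplus> c \<oplus> y\<close>.\<close>
  define w where "w = c + y - x"
  define q where "q s = p \<oplus> s *\<^sub>R c \<oplus> u s" for s
  have q0: "q 0 = p \<oplus> x" unfolding q_def u_def using p act_zero by simp
  have "s *\<^sub>R w \<in> D (q 0) \<and> q s = q 0 \<oplus> s *\<^sub>R w"
  proof (rule local_motion[OF _ _ s])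
    show "q 0 \<in> topspace X" using q0 act_in x by simp
  next
    fix s :: real assume s: "s \<in> {0..1}"
    have "(t - s) *\<^sub>R w \<in> D (q s) \<and> q t = q s \<oplus> (t - s) *\<^sub>R w" if t: "t \<in> {0..1}" "\<bar>t - s\<bar> < e" for t
    proof -
      have seg: "(t - s) *\<^sub>R c \<in> D (p \<oplus> s *\<^sub>R c)" "p \<oplus> s *\<^sub>R c \<oplus> (t - s) *\<^sub>R c = p \<oplus> t *\<^sub>R c"
        using segment_in[OF c, of s t] s t by auto
      have n: "norm ((t - s) *\<^sub>R c + u t) < r"
        using norm_triangle_ineq[of "(t - s) *\<^sub>R c" "u t"] ec[OF t(2)] nu[OF t(1)] r by linarith
      have A: "(t - s) *\<^sub>R c + u t \<in> D (p \<oplus> s *\<^sub>R c)"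
        "p \<oplus> s *\<^sub>R c \<oplus> ((t - s) *\<^sub>R c + u t) = q t"
        using gd_add[OF g[OF s] seg(1), of "u t"] uD[OF t(1)] n ec[OF t(2)] r unfolding seg(2) q_def by auto
      have "(t - s) *\<^sub>R c + u t - u s = (t - s) *\<^sub>R w" unfolding u_def w_def by (simp add: algebra_simps)
      then show ?thesis
        using gd_diff[OF g[OF s] uD[OF s] A(1) _ n] nu[OF s] r unfolding A(2) q_def by auto
    qed
    then show "\<exists>e>0. \<forall>t\<in>{0..1}. \<bar>t - s\<bar> < e \<longrightarrow> (t - s) *\<^sub>R w \<in> D (q s) \<and> q t = q s \<oplus> (t - s) *\<^sub>R w"
      using e by blast
  qed
  then show "s *\<^sub>R (c + y - x) \<in> D (p \<oplus> x)"
    "p \<oplus> x \<oplus> s *\<^sub>R (c + y - x) = p \<oplus> s *\<^sub>R c \<oplus> ((1 - s) *\<^sub>R x + s *\<^sub>R y)"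
    unfolding q0 unfolding q_def u_def w_def by auto
qed

text \<open>For \<open>x = 0\<close> the quadrilateral degenerates to a triangle.\<close>

lemma add_small:
  assumes c: "c \<in> D p" and g: "\<And>t. t \<in> {0..1} \<Longrightarrow> gd (p \<oplus> t *\<^sub>R c) r"
    and y: "y \<in> D (p \<oplus> c)" "norm y < r / 4"
  shows "c + y \<in> D p" "p \<oplus> (c + y) = p \<oplus> c \<oplus> y"
proof -
  have p: "p \<in> topspace X" using D_base c by blast
  have r: "r > 0" using gd_pos g[of 0] by simp
  show "c + y \<in> D p" "p \<oplus> (c + y) = p \<oplus> c \<oplus> y"
    using quadrilateral(2,3)[of c p r 0 y 1, OF c g zero_in[OF p] _ y] r act_zero[OF p] by auto
qed

text \<open>Here the short side \<open>c' - c\<close> is not known to be admissible at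
  \<open>p \<oplus> c\<close>, so no quadrilateral is available. But both motions start at
  \<open>p\<close>, and their gap \<open>s *\<^sub>R (c' - c)\<close> stays below
  \<open>r / 4\<close>; hence each short step takes place in one \<open>good\<close>
  neighbourhood.\<close>

lemma diff_small:
  assumes c: "c \<in> D p" and g: "\<And>t. t \<in> {0..1} \<Longrightarrow> gd (p \<oplus> t *\<^sub>R c) r"
    and c': "c' \<in> D p" "norm (c' - c) < r / 4"
  shows "c' - c \<in> D (p \<oplus> c)" "p \<oplus> c \<oplus> (c' - c) = p \<oplus> c'"
proof -
  define P where "P s \<longleftrightarrow> s *\<^sub>R (c' - c) \<in> D (p \<oplus> s *\<^sub>R c) \<and> p \<oplus> s *\<^sub>R c \<oplus> s *\<^sub>R (c' - c) = p \<oplus> s *\<^sub>R c'" for s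
  have p: "p \<in> topspace X" using D_base c by blast
  have r: "r > 0" using gd_pos g[of 0] by simp
  define e where "e = r / (4 * (norm c + norm c' + 1))"
  have pos: "norm c + norm c' + 1 > 0" by (simp add: add_nonneg_pos)
  have e: "e > 0" unfolding e_def using r pos by simp
  have ec: "norm (h *\<^sub>R c) < r / 4" "norm (h *\<^sub>R c') < r / 4" if "\<bar>h\<bar> < e" for h
  proof -
    have "\<bar>h\<bar> * (norm c + norm c' + 1) < e * (norm c + norm c' + 1)" 
      using that pos by (intro mult_strict_right_mono) auto
    also have "\<dots> = r / 4" unfolding e_def using pos by (simp add: field_simps)
    finally have a: "\<bar>h\<bar> * norm c + \<bar>h\<bar> * norm c' + \<bar>h\<bar> < r / 4" by (simp add: algebra_simps)
    have "0 \<le> \<bar>h\<bar> * norm c" "0 \<le> \<bar>h\<bar> * norm c'" by auto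
    with a show "norm (h *\<^sub>R c) < r / 4" "norm (h *\<^sub>R c') < r / 4" unfolding norm_scaleR by linarith+
  qed
  have step: "P t" if P: "P s" and s: "s \<in> {0..1}" and t: "t \<in> {0..1}" "\<bar>t - s\<bar> < e" for s t
  proof -
    let ?y = "p \<oplus> s *\<^sub>R c" let ?a = "s *\<^sub>R (c' - c)" let ?b = "(t - s) *\<^sub>R c'"
    have na: "norm ?a < r / 4"
    proof -
      have "norm ?a \<le> 1 * norm (c' - c)" unfolding norm_scaleR using s by (intro mult_right_mono) auto
      then show ?thesis using c' by simp
    qed
    have b: "?b \<in> D (?y \<oplus> ?a)" "?y \<oplus> ?a \<oplus> ?b = p \<oplus> t *\<^sub>R c'"
      using segment_in[OF c'(1), of s t] s t P unfolding P_def by auto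
    have n: "norm (?a + ?b) < r / 2"
      using norm_triangle_ineq[of ?a ?b] ec(2)[OF t(2)] na by linarith
    have A: "?a + ?b \<in> D ?y" "?y \<oplus> (?a + ?b) = p \<oplus> t *\<^sub>R c'"
      using gd_add[OF g[OF s] _ b(1)] P n na b(2) r unfolding P_def by auto
    have seg: "(t - s) *\<^sub>R c \<in> D ?y" "?y \<oplus> (t - s) *\<^sub>R c = p \<oplus> t *\<^sub>R c"
      using segment_in[OF c, of s t] s t by auto
    have "?a + ?b - (t - s) *\<^sub>R c = t *\<^sub>R (c' - c)" by (simp add: algebra_simps)
    then show ?thesis
      unfolding P_def using gd_diff[OF g[OF s] seg(1) A(1)] n ec(1)[OF t(2)] r unfolding seg(2) A(2) by auto
  qed
  have "P 1"
  proof (rule connected_induction_simple[of "{0..1::real}" 0 1])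
    show "P 0" unfolding P_def using p zero_in act_zero by auto
  next
    fix s :: real assume s: "s \<in> {0..1}"
    show "\<exists>T. openin (top_of_set {0..1}) T \<and> s \<in> T \<and> (\<forall>x\<in>T. \<forall>y\<in>T. P x \<longrightarrow> P y)"
    proof (intro exI conjI ballI impI)
      \<comment> \<open>Half of \<open>e\<close>, since two points of this set must be less than
        \<open>e\<close> apart.\<close>
      show "openin (top_of_set {0..1}) ({0..1} \<inter> ball s (e/2))" by (rule openin_open_Int) simp
      show "s \<in> {0..1} \<inter> ball s (e/2)" using s e(1) by simp
      fix x y assume xy: "x \<in> {0..1} \<inter> ball s (e/2)" "y \<in> {0..1} \<inter> ball s (e/2)" "P x"
      then have "\<bar>s - x\<bar> < e / 2" "\<bar>s - y\<bar> < e / 2" by (auto simp: dist_real_def)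
      then have "\<bar>y - x\<bar> < e" by arith
      then show "P y" using step[OF xy(3), of y] xy by auto
    qed
  qed auto
  then show "c' - c \<in> D (p \<oplus> c)" "p \<oplus> c \<oplus> (c' - c) = p \<oplus> c'" unfolding P_def by auto
qed

text \<open>Near \<open>c\<close>, the map \<open>act p\<close> is the local map at the end point
  \<open>p \<oplus> c\<close> up to a translation. This carries local properties to any distance
  from \<open>p\<close>.\<close>

lemma nearby:
  assumes c: "c \<in> D p"
  obtains r where "r > 0" "gd (p \<oplus> c) r"
    "\<And>y. y \<in> D (p \<oplus> c) \<Longrightarrow> norm y < r \<Longrightarrow> c + y \<in> D p"
    "\<And>y. y \<in> D (p \<oplus> c) \<Longrightarrow> norm y < r \<Longrightarrow> p \<oplus> (c + y) = p \<oplus> c \<oplus> y"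
    "\<And>c'. c' \<in> D p \<Longrightarrow> norm (c' - c) < r \<Longrightarrow> c' - c \<in> D (p \<oplus> c)"
    "\<And>c'. c' \<in> D p \<Longrightarrow> norm (c' - c) < r \<Longrightarrow> p \<oplus> c \<oplus> (c' - c) = p \<oplus> c'"
proof -
  obtain r where g: "\<forall>t\<in>{0..1}. gd (p \<oplus> t *\<^sub>R c) r" using uniform_good c by blast
  have r: "r > 0" "gd (p \<oplus> c) r" using gd_pos g[rule_format, of 1] by auto
  show ?thesis
    by (rule that[of "r / 4"])
      (use r gd_mono[OF r(2)] add_small[of c p r, OF c g[rule_format]]
         diff_small[of c p r, OF c g[rule_format]] in auto)
qed

lemma act_continuous: "continuous_map (top_of_set (D p)) X (act p)"
proof (rule continuous_map_locally)
  fix c assume "c \<in> topspace (top_of_set (D p))"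
  then show "p \<oplus> c \<in> topspace X" using act_in by simp
next
  fix c W assume "c \<in> topspace (top_of_set (D p))" and W: "openin X W" "p \<oplus> c \<in> W"
  then have c: "c \<in> D p" by simp
  obtain r where r: "r > 0" "gd (p \<oplus> c) r"
    "\<And>y. y \<in> D (p \<oplus> c) \<Longrightarrow> norm y < r \<Longrightarrow> c + y \<in> D p"
    "\<And>y. y \<in> D (p \<oplus> c) \<Longrightarrow> norm y < r \<Longrightarrow> p \<oplus> (c + y) = p \<oplus> c \<oplus> y"
    "\<And>c'. c' \<in> D p \<Longrightarrow> norm (c' - c) < r \<Longrightarrow> c' - c \<in> D (p \<oplus> c)"
    "\<And>c'. c' \<in> D p \<Longrightarrow> norm (c' - c) < r \<Longrightarrow> p \<oplus> c \<oplus> (c' - c) = p \<oplus> c'"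
    by (rule nearby[OF c]) blast
  have cont: "continuous_map (top_of_set (D p \<inter> ball c r)) X (\<lambda>c'. p \<oplus> c \<oplus> (c' - c))"
  proof -
    have "continuous_map (top_of_set (D p \<inter> ball c r)) (top_of_set (D (p \<oplus> c) \<inter> ball 0 r)) (\<lambda>c'. c' - c)"
      using r(5) by (auto simp: continuous_map_in_subtopology dist_norm norm_minus_commute intro!: continuous_intros)
    from continuous_map_compose[OF this gd_cont[OF r(2)]] show ?thesis by (simp add: o_def)
  qed
  have "continuous_map (top_of_set (D p \<inter> ball c r)) X (act p)"
    by (rule continuous_map_eq[OF cont]) (use r(6) in \<open>auto simp: dist_norm norm_minus_commute\<close>)
  then have "openin (top_of_set (D p \<inter> ball c r)) {x \<in> D p \<inter> ball c r. p \<oplus> x \<in> W}"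
    using W unfolding continuous_map by auto
  moreover have "openin (top_of_set (D p)) (D p \<inter> ball c r)" by (rule openin_open_Int) simp
  ultimately have "openin (top_of_set (D p)) {x \<in> D p \<inter> ball c r. p \<oplus> x \<in> W}" using openin_trans by blast
  then show "\<exists>U. openin (top_of_set (D p)) U \<and> c \<in> U \<and> act p ` U \<subseteq> W"
    using c r W by (intro exI[of _ "{x \<in> D p \<inter> ball c r. p \<oplus> x \<in> W}"]) auto
qed

lemma act_open: "open_map (top_of_set (D p)) X (act p)"
  unfolding open_map_def
proof (intro allI impI)
  fix U assume U: "openin (top_of_set (D p)) U"
  show "openin X (act p ` U)"
  proof (subst openin_subopen, intro ballI)
    fix q assume "q \<in> act p ` U"
    then obtain c where c: "c \<in> U" "q = p \<oplus> c" by auto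
    then have cD: "c \<in> D p" using U openin_imp_subset by blast
    obtain r where r: "r > 0" "gd (p \<oplus> c) r"
    "\<And>y. y \<in> D (p \<oplus> c) \<Longrightarrow> norm y < r \<Longrightarrow> c + y \<in> D p"
    "\<And>y. y \<in> D (p \<oplus> c) \<Longrightarrow> norm y < r \<Longrightarrow> p \<oplus> (c + y) = p \<oplus> c \<oplus> y"
    "\<And>c'. c' \<in> D p \<Longrightarrow> norm (c' - c) < r \<Longrightarrow> c' - c \<in> D (p \<oplus> c)"
    "\<And>c'. c' \<in> D p \<Longrightarrow> norm (c' - c) < r \<Longrightarrow> p \<oplus> c \<oplus> (c' - c) = p \<oplus> c'"
    by (rule nearby[OF cD]) blast
    obtain e where e: "e > 0" "ball c e \<inter> D p \<subseteq> U" using U c(1) openin_contains_ball by metis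
    have "openin X (act q ` (D q \<inter> ball 0 r \<inter> ball 0 e))"
      using gd_open[OF r(2)] unfolding open_map_def c(2)[symmetric] by (auto intro!: openin_open_Int)
    moreover have "q \<in> act q ` (D q \<inter> ball 0 r \<inter> ball 0 e)"
      using c(2) act_in[OF cD] zero_in act_zero r(1) e(1) by (intro image_eqI[of _ _ 0]) auto
    moreover have "act q ` (D q \<inter> ball 0 r \<inter> ball 0 e) \<subseteq> act p ` U"
    proof
      fix z assume "z \<in> act q ` (D q \<inter> ball 0 r \<inter> ball 0 e)"
      then obtain y where y: "y \<in> D q" "norm y < r" "norm y < e" "z = q \<oplus> y" by auto
      then have "z = p \<oplus> (c + y)" "c + y \<in> D p" using r(3,4) c by auto
      moreover have "c + y \<in> U" using e(2) y \<open>c + y \<in> D p\<close> by (auto simp: dist_norm)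
      ultimately show "z \<in> act p ` U" by blast
    qed
    ultimately show "\<exists>T. openin X T \<and> q \<in> T \<and> T \<subseteq> act p ` U" by blast
  qed
qed

end

section \<open>End points of motions, and tubes around segments\<close>

context flat_action begin

text \<open>A motion that is close to \<open>q\<close> at a late time spends its remaining time in a
  \<open>good\<close> ball around \<open>q\<close>, where closedness of \<open>D q\<close> supplies
  the end point.\<close>

lemma cluster_extend:
  assumes v: "\<And>s. 0 \<le> s \<Longrightarrow> s < 1 \<Longrightarrow> s *\<^sub>R v \<in> D p" and q: "q \<in> topspace X"
    and cl: "\<And>W s0. openin X W \<Longrightarrow> q \<in> W \<Longrightarrow> s0 < 1 \<Longrightarrow> \<exists>s. s0 \<le> s \<and> 0 \<le> s \<and> s < 1 \<and> p \<oplus> s *\<^sub>R v \<in> W"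
  shows "v \<in> D p"
proof -
  obtain r where r: "gd q r" using ex_good q by blast
  have r0: "r > 0" using gd_pos r .
  have "openin X (act q ` (D q \<inter> ball 0 r \<inter> ball 0 (r/4)))"
    using gd_open[OF r] unfolding open_map_def by (auto intro!: openin_open_Int)
  moreover have "q \<in> act q ` (D q \<inter> ball 0 r \<inter> ball 0 (r/4))"
    using q zero_in act_zero r0 by (intro image_eqI[of _ _ 0]) auto
  \<comment> \<open>From this time on, at most the length \<open>r / 4\<close> remains.\<close>
  moreover have "1 - r / (4 * (norm v + 1)) < 1" using r0 by (simp add: add_nonneg_pos)
  ultimately obtain s where s: "1 - r / (4 * (norm v + 1)) \<le> s" "0 \<le> s" "s < 1"
      "p \<oplus> s *\<^sub>R v \<in> act q ` (D q \<inter> ball 0 r \<inter> ball 0 (r/4))" using cl by blast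
  then obtain z where z: "z \<in> D q" "norm z < r/4" "p \<oplus> s *\<^sub>R v = q \<oplus> z" by auto
  have sn: "norm ((t - s) *\<^sub>R v) \<le> r / 4" if "s \<le> t" "t \<le> 1" for t
  proof -
    have "norm ((t - s) *\<^sub>R v) \<le> (1 - s) * (norm v + 1)" using that by (simp add: mult_mono)
    also have "\<dots> \<le> r / (4 * (norm v + 1)) * (norm v + 1)" using s by (intro mult_right_mono) auto
    also have "\<dots> = r / 4" using add_nonneg_pos[OF norm_ge_zero[of v] zero_less_one] by (simp add: field_simps)
    finally show ?thesis .
  qed
  have nn: "norm (z + (t - s) *\<^sub>R v) \<le> r / 2" if "s \<le> t" "t \<le> 1" for t
    using norm_triangle_ineq[of z "(t - s) *\<^sub>R v"] sn[OF that] z(2) by linarith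
  have mem: "z + (t - s) *\<^sub>R v \<in> D q \<inter> cball 0 (r / 2)" if t: "s \<le> t" "t < 1" for t
  proof -
    have "(t - s) *\<^sub>R v \<in> D (q \<oplus> z)"
      using line_iff[of s v p "t - s"] v[of s] v[of t] t s unfolding z(3) by auto
    then show ?thesis using gd_add(1)[OF r z(1), of "(t - s) *\<^sub>R v"] nn[of t] t r0 z(2) by auto
  qed
  have "z + (1 - s) *\<^sub>R v \<in> D q \<inter> cball 0 (r / 2)"
  proof (rule Lim_in_closed_set)
    show "closed (D q \<inter> cball 0 (r / 2))" using r r0 by (intro gd_closed) auto
    show "((\<lambda>t. z + (t - s) *\<^sub>R v) \<longlongrightarrow> z + (1 - s) *\<^sub>R v) (at_left 1)"
      by (intro tendsto_intros)
    show "eventually (\<lambda>t. z + (t - s) *\<^sub>R v \<in> D q \<inter> cball 0 (r / 2)) (at_left 1)"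
      using eventually_at_left_real[OF s(3)] by eventually_elim (use mem in auto)
  qed (rule trivial_limit_at_left_real)
  then have "z + (1 - s) *\<^sub>R v - z \<in> D (q \<oplus> z)"
    using nn[of 1] s r0 z(2) by (intro gd_diff(1)[OF r z(1)]) auto
  then have "(1 - s) *\<^sub>R v \<in> D (p \<oplus> s *\<^sub>R v)" by (simp add: z(3))
  then show ?thesis using line_iff[of s v p "1 - s"] v[of s] s by simp
qed

text \<open>Supplies a convex chart domain around a whole segment. \<open>G\<close> consists of
  short vectors attached to the segment, and \<open>quadrilateral\<close> makes it convex. If no
  thickness gave injectivity, pairs of vectors with equal images would accumulate at the segment;
  their limits coincide since the segment is injective, contrary to local injectivity at the
  limit.\<close>

lemma tube:
  assumes H: "Hausdorff_space X" and c: "c \<in> D p" and inj: "inj_on (\<lambda>t. p \<oplus> t *\<^sub>R c) {0..1}"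
  shows "\<exists>G. openin (top_of_set (D p)) G \<and> convex G \<and> 0 \<in> G \<and> c \<in> G \<and> inj_on (act p) G"
proof -
  obtain r where g: "\<And>t. t \<in> {0..1} \<Longrightarrow> gd (p \<oplus> t *\<^sub>R c) r" using uniform_good c by blast
  have p: "p \<in> topspace X" using D_base c by blast
  have r: "r > 0" using gd_pos g[of 0] by simp
  have tc: "t *\<^sub>R c \<in> D p" if "t \<in> {0..1}" for t using shrink c that by auto
  define G where "G \<delta> = {t *\<^sub>R c + z |t z. t \<in> {0..1} \<and> z \<in> D (p \<oplus> t *\<^sub>R c) \<and> norm z < \<delta>}" for \<delta>
  have add: "t *\<^sub>R c + z \<in> D p" "p \<oplus> (t *\<^sub>R c + z) = p \<oplus> t *\<^sub>R c \<oplus> z"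
    if "t \<in> {0..1}" "z \<in> D (p \<oplus> t *\<^sub>R c)" "norm z < r / 4" for t z
    using add_small[of "t *\<^sub>R c" p r z] tc g that by (auto simp: mult_le_one)
  have sub: "G \<delta> \<subseteq> D p" if "\<delta> \<le> r / 4" for \<delta> using that add unfolding G_def by force
  have opn: "openin (top_of_set (D p)) (G \<delta>)" if \<delta>: "\<delta> \<le> r / 4" for \<delta>
    unfolding openin_contains_ball
  proof (intro conjI ballI)
    show "G \<delta> \<subseteq> D p" using sub \<delta> .
    fix x assume "x \<in> G \<delta>"
    then obtain t z where tz: "t \<in> {0..1}" "z \<in> D (p \<oplus> t *\<^sub>R c)" "norm z < \<delta>" "x = t *\<^sub>R c + z"
      unfolding G_def by auto
    have xD: "x \<in> D p" "p \<oplus> x = p \<oplus> t *\<^sub>R c \<oplus> z" using add tz \<delta> by auto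
    obtain r' where r': "r' > 0" "\<And>y. y \<in> D p \<Longrightarrow> norm (y - x) < r' \<Longrightarrow> y - x \<in> D (p \<oplus> x)"
      by (rule nearby[OF xD(1)]) blast
    have "ball x (min r' (\<delta> - norm z)) \<inter> D p \<subseteq> G \<delta>"
    proof
      fix y assume y: "y \<in> ball x (min r' (\<delta> - norm z)) \<inter> D p"
      then have ny: "norm (y - x) < r'" "norm (y - x) < \<delta> - norm z" 
        by (auto simp: dist_norm norm_minus_commute)
      have n: "norm (z + (y - x)) < \<delta>" using norm_triangle_ineq[of z "y - x"] ny by linarith
      have "y - x \<in> D (p \<oplus> t *\<^sub>R c \<oplus> z)" using r'(2)[of y] y ny xD by auto
      then have "z + (y - x) \<in> D (p \<oplus> t *\<^sub>R c)"
        using gd_add(1)[OF g[OF tz(1)] tz(2)] n tz(3) \<delta> r by auto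
      then show "y \<in> G \<delta>" unfolding G_def using tz n
        by (intro CollectI exI[of _ t] exI[of _ "z + (y - x)"]) auto
    qed
    then show "\<exists>e>0. ball x e \<inter> D p \<subseteq> G \<delta>" using r'(1) tz(3) by (intro exI[of _ "min r' (\<delta> - norm z)"]) auto
  qed
  have cvx: "convex (G \<delta>)" if \<delta>: "\<delta> \<le> r / 4" for \<delta>
    unfolding convex_alt
  proof (intro ballI allI impI)
    fix x y and u :: real assume xy: "x \<in> G \<delta>" "y \<in> G \<delta>" and u: "0 \<le> u \<and> u \<le> 1"
    obtain t z where tz: "t \<in> {0..1}" "z \<in> D (p \<oplus> t *\<^sub>R c)" "norm z < \<delta>" "x = t *\<^sub>R c + z"
      using xy(1) unfolding G_def by auto
    obtain t' z' where tz': "t' \<in> {0..1}" "z' \<in> D (p \<oplus> t' *\<^sub>R c)" "norm z' < \<delta>" "y = t' *\<^sub>R c + z'"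
      using xy(2) unfolding G_def by auto
    have c1: "(t' - t) *\<^sub>R c \<in> D (p \<oplus> t *\<^sub>R c)" "p \<oplus> t *\<^sub>R c \<oplus> (t' - t) *\<^sub>R c = p \<oplus> t' *\<^sub>R c"
      using segment_in[OF c, of t t'] tz tz' by auto
    have tt: "t + s * (t' - t) \<in> {0..1}" if "s \<in> {0..1}" for s
      using that tz(1) tz'(1) convexD_alt[of "{0..1::real}" t t' s]
      by (auto simp: algebra_simps)
    have c2: "p \<oplus> t *\<^sub>R c \<oplus> s *\<^sub>R (t' - t) *\<^sub>R c = p \<oplus> (t + s * (t' - t)) *\<^sub>R c" if "s \<in> {0..1}" for s
      using segment_in(2)[OF c, of t "t + s * (t' - t)"] tz tt[OF that] by auto
    have c3: "gd (p \<oplus> t *\<^sub>R c \<oplus> s *\<^sub>R (t' - t) *\<^sub>R c) r" if "s \<in> {0..1}" for s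
      using c2[OF that] g[OF tt[OF that]] by simp
    \<comment> \<open>The quadrilateral stands on the part of the segment between the parameters
      \<open>t\<close> and \<open>t'\<close>.\<close>
    have "(1 - u) *\<^sub>R z + u *\<^sub>R z' \<in> D (p \<oplus> t *\<^sub>R c \<oplus> u *\<^sub>R (t' - t) *\<^sub>R c)"
      using quadrilateral(1)[OF c1(1) c3 tz(2) _ _ _, of z' u] tz tz' c1(2) \<delta> u by auto
    then have 1: "(1 - u) *\<^sub>R z + u *\<^sub>R z' \<in> D (p \<oplus> (t + u * (t' - t)) *\<^sub>R c)" using c2[of u] u by auto
    have 2: "norm ((1 - u) *\<^sub>R z + u *\<^sub>R z') < \<delta>"
      using convexD_alt[OF convex_ball, of z 0 \<delta> z' u] tz tz' u by auto
    have "(1 - u) *\<^sub>R x + u *\<^sub>R y = (t + u * (t' - t)) *\<^sub>R c + ((1 - u) *\<^sub>R z + u *\<^sub>R z')"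
      unfolding tz(4) tz'(4) by (simp add: algebra_simps)
    then show "(1 - u) *\<^sub>R x + u *\<^sub>R y \<in> G \<delta>"
      unfolding G_def using 1 2 tt[of u] u by auto
  qed
  have zc: "0 \<in> G \<delta>" "c \<in> G \<delta>" if "\<delta> > 0" for \<delta>
  proof -
    have "0 = 0 *\<^sub>R c + 0" by simp
    moreover have "0 \<in> D (p \<oplus> 0 *\<^sub>R c)" using p act_zero zero_in by simp
    ultimately show "0 \<in> G \<delta>" unfolding G_def using that by fastforce
    have "c = 1 *\<^sub>R c + 0" by simp
    moreover have "0 \<in> D (p \<oplus> 1 *\<^sub>R c)" using act_in[OF c] zero_in by simp
    ultimately show "c \<in> G \<delta>" unfolding G_def using that
      by (intro CollectI exI[of _ 1] exI[of _ 0]) auto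
  qed
  have "\<exists>n::nat. inj_on (act p) (G (r / 4 / (real n + 1)))"
  proof (rule ccontr)
    assume "\<nexists>n::nat. inj_on (act p) (G (r / 4 / (real n + 1)))"
    then have "\<forall>n::nat. \<exists>x y. x \<in> G (r / 4 / (real n + 1)) \<and> y \<in> G (r / 4 / (real n + 1)) \<and> x \<noteq> y \<and> p \<oplus> x = p \<oplus> y"
      unfolding inj_on_def by blast
    then obtain x y where xy: "\<And>n::nat. x n \<in> G (r / 4 / (real n + 1))" "\<And>n::nat. y n \<in> G (r / 4 / (real n + 1))"
      "\<And>n. x n \<noteq> y n" "\<And>n. p \<oplus> x n = p \<oplus> y n" by metis
    have "\<exists>t. \<forall>n. t n \<in> {0..1} \<and> norm (x n - t n *\<^sub>R c) < r / 4 / (real n + 1)"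
      if "\<And>n::nat. x n \<in> G (r / 4 / (real n + 1))" for x
    proof (rule choice, intro allI)
      fix n show "\<exists>t. t \<in> {0..1} \<and> norm (x n - t *\<^sub>R c) < r / 4 / (real n + 1)"
        using that[of n] unfolding G_def by auto
    qed
    then obtain t t' where t: "\<And>n. t n \<in> {0..1}" "\<And>n. norm (x n - t n *\<^sub>R c) < r / 4 / (real n + 1)"
        "\<And>n. t' n \<in> {0..1}" "\<And>n. norm (y n - t' n *\<^sub>R c) < r / 4 / (real n + 1)"
      using xy(1,2) by meson
    have "compact ({0..1::real} \<times> {0..1::real})" by (intro compact_Times compact_Icc)
    moreover have "\<And>n. (t n, t' n) \<in> {0..1::real} \<times> {0..1::real}" using t by auto
    ultimately obtain l \<sigma> where l: "l \<in> {0..1::real} \<times> {0..1::real}" "strict_mono \<sigma>" "((\<lambda>n. (t n, t' n)) \<circ> \<sigma>) \<longlonglongrightarrow> l"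
      unfolding compact_def by meson
    obtain a a' where aa: "l = (a, a')" by (cases l)
    have lim: "(\<lambda>n. t (\<sigma> n)) \<longlonglongrightarrow> a" "(\<lambda>n. t' (\<sigma> n)) \<longlonglongrightarrow> a'"
      using tendsto_fst[OF l(3)] tendsto_snd[OF l(3)] aa by (simp_all add: o_def)
    have a: "a \<in> {0..1}" "a' \<in> {0..1}" using l(1) aa by auto
    have small: "(\<lambda>n. r / 4 / (real (\<sigma> n) + 1)) \<longlonglongrightarrow> 0"
    proof -
      have "(\<lambda>n. r / 4 / (real n + 1)) \<longlonglongrightarrow> 0" by real_asymp
      from LIMSEQ_subseq_LIMSEQ[OF this l(2)] show ?thesis by (simp add: o_def)
    qed
    have conv: "(\<lambda>n. x (\<sigma> n)) \<longlonglongrightarrow> b *\<^sub>R c"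
      if "(\<lambda>n. t (\<sigma> n)) \<longlonglongrightarrow> b" "\<And>n. norm (x n - t n *\<^sub>R c) < r / 4 / (real n + 1)" for x t b
    proof -
      have "(\<lambda>n. x (\<sigma> n) - t (\<sigma> n) *\<^sub>R c) \<longlonglongrightarrow> 0"
        by (rule Lim_null_comparison[OF _ small]) (use that(2) less_imp_le in \<open>auto intro!: eventuallyI\<close>)
      moreover have "(\<lambda>n. t (\<sigma> n) *\<^sub>R c) \<longlonglongrightarrow> b *\<^sub>R c" using that(1) by (intro tendsto_intros)
      ultimately show ?thesis using tendsto_add by fastforce
    qed
    have xl: "(\<lambda>n. x (\<sigma> n)) \<longlonglongrightarrow> a *\<^sub>R c" and yl: "(\<lambda>n. y (\<sigma> n)) \<longlonglongrightarrow> a' *\<^sub>R c"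
      using conv[OF lim(1) t(2)] conv[OF lim(2) t(4)] by auto
    have dle: "r / 4 / (real n + 1) \<le> r / 4" for n using r by (simp add: divide_le_eq mult_le_cancel_left1)
    have xD: "x n \<in> D p" "y n \<in> D p" for n using xy(1,2) sub[OF dle] by blast+
    have "limitin X (act p \<circ> (\<lambda>n. x (\<sigma> n))) (p \<oplus> a *\<^sub>R c) sequentially"
      by (rule continuous_map_limit[OF act_continuous])
        (use xl xD tc[OF a(1)] in \<open>auto simp: limitin_subtopology\<close>)
    moreover have "limitin X (act p \<circ> (\<lambda>n. y (\<sigma> n))) (p \<oplus> a' *\<^sub>R c) sequentially"
      by (rule continuous_map_limit[OF act_continuous])
        (use yl xD tc[OF a(2)] in \<open>auto simp: limitin_subtopology\<close>)
    moreover have "act p \<circ> (\<lambda>n. y (\<sigma> n)) = act p \<circ> (\<lambda>n. x (\<sigma> n))" using xy(4) by auto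
    ultimately have "p \<oplus> a *\<^sub>R c = p \<oplus> a' *\<^sub>R c"
      using limitin_Hausdorff_unique[OF _ _ _ H] by (metis trivial_limit_sequentially)
    then have "a = a'" using inj a by (meson inj_onD)
    let ?b = "a *\<^sub>R c"
    obtain r' where r': "r' > 0" "gd (p \<oplus> ?b) r'"
      "\<And>y. y \<in> D p \<Longrightarrow> norm (y - ?b) < r' \<Longrightarrow> y - ?b \<in> D (p \<oplus> ?b)"
      "\<And>y. y \<in> D p \<Longrightarrow> norm (y - ?b) < r' \<Longrightarrow> p \<oplus> ?b \<oplus> (y - ?b) = p \<oplus> y"
      by (rule nearby[OF tc[OF a(1)]]) blast
    have "eventually (\<lambda>n. norm (x (\<sigma> n) - ?b) < r') sequentially"
      using tendstoD[OF xl r'(1)] by (simp add: dist_norm)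
    moreover have "eventually (\<lambda>n. norm (y (\<sigma> n) - ?b) < r') sequentially"
      using tendstoD[OF yl r'(1)] \<open>a = a'\<close> by (simp add: dist_norm)
    ultimately have "eventually (\<lambda>n. norm (x (\<sigma> n) - ?b) < r' \<and> norm (y (\<sigma> n) - ?b) < r') sequentially"
      by (rule eventually_conj)
    then obtain n where n: "norm (x (\<sigma> n) - ?b) < r'" "norm (y (\<sigma> n) - ?b) < r'"
      using eventually_happens'[OF sequentially_bot] by blast
    have "x (\<sigma> n) - ?b = y (\<sigma> n) - ?b"
      by (rule inj_onD[OF gd_inj[OF r'(2)]]) (use n r'(3,4) xD xy(4) in auto)
    then show False using xy(3) by simp
  qed
  then obtain n :: nat where n: "inj_on (act p) (G (r / 4 / (real n + 1)))" by blast
  have "r / 4 / (real n + 1) \<le> r / 4" "r / 4 / (real n + 1) > 0"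
    using r by (auto simp: divide_le_eq mult_le_cancel_left1)
  then show ?thesis using n opn cvx zc by blast
qed

end

section \<open>Global additivity, convexity and periods\<close>

locale complete_action = flat_action +
  assumes extend: "(\<And>s. 0 \<le> s \<Longrightarrow> s < 1 \<Longrightarrow> s *\<^sub>R v \<in> D p) \<Longrightarrow> v \<in> D p"
    and conn: "connected_space X"
begin

text \<open>Follow \<open>c\<close> as long as possible, up to \<open>t0\<close>; by
  \<open>extend\<close> this time is attained. There the motions of the nearby velocities
  \<open>u n\<close> continue beyond \<open>t0\<close>, and closedness in a \<open>good\<close> ball
  passes their continuation on to the limit.\<close>

lemma D_closed: "closed (D p)"
  unfolding closed_sequential_limits
proof (intro allI impI)
  fix u c assume "(\<forall>n. u n \<in> D p) \<and> u \<longlonglongrightarrow> c"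
  then have u: "\<And>n. u n \<in> D p" "u \<longlonglongrightarrow> c" by auto
  have p: "p \<in> topspace X" using D_base u by blast
  define S where "S = {t \<in> {0..1}. t *\<^sub>R c \<in> D p}"
  have S0: "0 \<in> S" unfolding S_def using zero_in p by simp
  have bdd: "bdd_above S" unfolding S_def by (intro bdd_aboveI[of _ 1]) auto
  define t0 where "t0 = Sup S"
  have t01: "0 \<le> t0" "t0 \<le> 1"
  proof -
    show "0 \<le> t0" unfolding t0_def by (rule cSup_upper[OF S0 bdd])
    show "t0 \<le> 1" unfolding t0_def by (rule cSup_least) (use S0 in blast, simp add: S_def)
  qed
  have t0: "t0 *\<^sub>R c \<in> D p"
  proof (cases "t0 = 0")
    case False
    show ?thesis
    proof (rule extend)
      fix s :: real assume s: "0 \<le> s" "s < 1"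
      then have "s * t0 < t0" using t01 False by simp
      \<comment> \<open>Any time before \<open>t0\<close> lies below some \<open>t\<close> in
        \<open>S\<close>, from which \<open>shrink\<close> leads down to it.\<close>
      then obtain t where t: "t \<in> S" "s * t0 < t" unfolding t0_def using less_cSup_iff[of S] S0 bdd by blast
      note t(2)
      moreover have "0 \<le> s * t0" using s t01 by simp
      ultimately have "t > 0" "0 \<le> s * t0 / t" "s * t0 / t \<le> 1" by (auto simp: divide_le_eq)
      moreover have "t *\<^sub>R c \<in> D p" using t unfolding S_def by simp
      ultimately have "(s * t0 / t) *\<^sub>R t *\<^sub>R c \<in> D p" using shrink by blast
      then show "s *\<^sub>R t0 *\<^sub>R c \<in> D p" using \<open>t > 0\<close> by simp
    qed
  qed (use p zero_in in simp)
  show "c \<in> D p"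
  proof (cases "t0 = 1")
    case False
    then have "t0 < 1" using t01 by simp
    obtain r where g: "\<forall>t\<in>{0..1}. gd (p \<oplus> t *\<^sub>R t0 *\<^sub>R c) r" using uniform_good[OF t0] by blast
    let ?q = "p \<oplus> t0 *\<^sub>R c"
    have r: "r > 0" "gd ?q r" using gd_pos g[rule_format, of 1] by auto
    \<comment> \<open>\<open>norm c + r\<close> bounds the norms of those \<open>u n\<close> that
      are within \<open>r / 4\<close> of \<open>c\<close>, so going on for time \<open>k\<close>
      costs at most \<open>r / 4\<close>.\<close>
    define k where "k = min (1 - t0) (r / (4 * (norm c + r + 1)))"
    have pos: "norm c + r + 1 > 0" using r by (simp add: add_nonneg_pos)
    have k: "k > 0" "t0 + k \<le> 1" unfolding k_def using \<open>t0 < 1\<close> r pos by auto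
    have kc: "norm (k *\<^sub>R d) \<le> r / 4" if "norm d \<le> norm c + r" for d
    proof -
      have "norm (k *\<^sub>R d) \<le> k * (norm c + r + 1)" using that k by (simp add: mult_left_mono)
      also have "\<dots> \<le> r / (4 * (norm c + r + 1)) * (norm c + r + 1)"
        unfolding k_def using pos by (intro mult_right_mono) auto
      also have "\<dots> = r / 4" using pos by (simp add: field_simps)
      finally show ?thesis .
    qed
    have ev: "eventually (\<lambda>n. norm (u n - c) < r / 4) sequentially"
      using tendstoD[OF u(2), of "r/4"] r by (simp add: dist_norm)
    have "k *\<^sub>R c \<in> D ?q \<inter> cball 0 (r / 2)"
    proof (rule Lim_in_closed_set)
      show "closed (D ?q \<inter> cball 0 (r / 2))" using r by (intro gd_closed) auto
      \<comment> \<open>The vector is \<open>(t0 + k) *\<^sub>R u n - t0 *\<^sub>R c\<close>: across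
        from the motion along \<open>c\<close> to the one along \<open>u n\<close>, then onwards for
        time \<open>k\<close>.\<close>
      have "(\<lambda>n. t0 *\<^sub>R (u n - c) + k *\<^sub>R u n) \<longlonglongrightarrow> t0 *\<^sub>R (c - c) + k *\<^sub>R c"
        by (intro tendsto_intros u)
      then show "(\<lambda>n. t0 *\<^sub>R (u n - c) + k *\<^sub>R u n) \<longlonglongrightarrow> k *\<^sub>R c" by simp
      show "eventually (\<lambda>n. t0 *\<^sub>R (u n - c) + k *\<^sub>R u n \<in> D ?q \<inter> cball 0 (r / 2)) sequentially"
        using ev
      proof eventually_elim
        case (elim n)
        have n1: "norm (t0 *\<^sub>R (u n - c)) < r / 4"
        proof -
          have "norm (t0 *\<^sub>R (u n - c)) \<le> 1 * norm (u n - c)" unfolding norm_scaleR using t01 by (intro mult_right_mono) auto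
          then show ?thesis using elim by simp
        qed
        have tu: "t0 *\<^sub>R u n \<in> D p" using shrink u t01 by blast
        have d: "t0 *\<^sub>R (u n - c) \<in> D ?q" "?q \<oplus> t0 *\<^sub>R (u n - c) = p \<oplus> t0 *\<^sub>R u n"
          using diff_small[OF t0 g[rule_format] tu] n1 by (auto simp: scaleR_diff_right)
        have "norm (u n) \<le> norm c + r" using elim norm_triangle_sub[of "u n" c] r by linarith
        then have n2: "norm (k *\<^sub>R u n) \<le> r / 4" by (rule kc)
        have "k *\<^sub>R u n \<in> D (p \<oplus> t0 *\<^sub>R u n)"
          using segment_in(1)[OF u(1), of t0 "t0 + k" n] t01 k by simp
        moreover have n3: "norm (t0 *\<^sub>R (u n - c) + k *\<^sub>R u n) \<le> r / 2"
          using norm_triangle_ineq[of "t0 *\<^sub>R (u n - c)" "k *\<^sub>R u n"] n1 n2 by linarith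
        ultimately show ?case using gd_add(1)[OF r(2) d(1)] n1 r unfolding d(2) by auto
      qed
    qed simp
    then have "(t0 + k) *\<^sub>R c \<in> D p" using line_iff[OF t0, of k] by simp
    then have "t0 + k \<in> S" unfolding S_def using k t01 by auto
    then have "t0 + k \<le> t0" unfolding t0_def using bdd by (rule cSup_upper)
    then show ?thesis using k by simp
  qed (use t0 in simp)
qed

text \<open>The start moves along \<open>a\<close> while the target \<open>q \<oplus> b\<close> is
  held fixed. The set of admissible times is open by a quadrilateral with \<open>y = 0\<close>. It
  is closed because, seen from the fixed target, the reversed sides all lie in one closed
  set.\<close>

lemma diff_in:
  assumes a: "a \<in> D q" and b: "b \<in> D q"
  shows "b - a \<in> D (q \<oplus> a)" "q \<oplus> a \<oplus> (b - a) = q \<oplus> b"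
proof -
  define P where "P s \<longleftrightarrow> b - s *\<^sub>R a \<in> D (q \<oplus> s *\<^sub>R a) \<and> q \<oplus> s *\<^sub>R a \<oplus> (b - s *\<^sub>R a) = q \<oplus> b" for s
  let ?T = "{s \<in> {0..1::real}. P s}"
  have q: "q \<in> topspace X" using D_base a by blast
  have "openin (top_of_set {0..1}) ?T"
    unfolding openin_contains_ball
  proof (intro conjI ballI)
    fix s assume "s \<in> ?T"
    then have s: "s \<in> {0..1}" and P: "b - s *\<^sub>R a \<in> D (q \<oplus> s *\<^sub>R a)" "q \<oplus> s *\<^sub>R a \<oplus> (b - s *\<^sub>R a) = q \<oplus> b"
      unfolding P_def by auto
    let ?p = "q \<oplus> s *\<^sub>R a" let ?c = "b - s *\<^sub>R a"
    obtain r where g: "\<forall>t\<in>{0..1}. gd (?p \<oplus> t *\<^sub>R ?c) r" using uniform_good[OF P(1)] by blast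
    have r: "r > 0" using gd_pos g[rule_format, of 1] by auto
    have "P t" if t: "t \<in> {0..1}" "\<bar>t - s\<bar> < r / (4 * (norm a + 1))" for t
    proof -
      let ?x = "(t - s) *\<^sub>R a"
      have "norm ?x \<le> \<bar>t - s\<bar> * (norm a + 1)" by (simp add: mult_left_mono)
      also have "\<dots> < r / (4 * (norm a + 1)) * (norm a + 1)"
        using t by (intro mult_strict_right_mono) (auto simp: add_nonneg_pos)
      also have "\<dots> = r / 4" using add_nonneg_pos[OF norm_ge_zero[of a] zero_less_one] by (simp add: field_simps)
      finally have nx: "norm ?x < r / 4" .
      have x: "?x \<in> D ?p" "?p \<oplus> ?x = q \<oplus> t *\<^sub>R a" using segment_in[OF a, of s t] s t by auto
      have e: "?c + 0 - ?x = b - t *\<^sub>R a" by (simp add: algebra_simps)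
      have z: "0 \<in> D (?p \<oplus> ?c)" using zero_in act_in P(1) by blast
      show ?thesis
        using quadrilateral(2,3)[OF P(1) g[rule_format] x(1) nx z, of 1] r act_zero[OF act_in[OF b]]
        unfolding e P_def x(2) P(2)[symmetric] by auto
    qed
    then show "\<exists>e>0. ball s e \<inter> {0..1} \<subseteq> ?T"
      using r by (intro exI[of _ "r / (4 * (norm a + 1))"])
         (auto simp: dist_real_def abs_minus_commute add_nonneg_pos)
  qed auto
  moreover have "closed ?T"
    unfolding closed_sequential_limits
  proof (intro allI impI)
    fix u s assume "(\<forall>n. u n \<in> ?T) \<and> u \<longlonglongrightarrow> s"
    then have u: "\<And>n. u n \<in> {0..1}" "\<And>n. P (u n)" "u \<longlonglongrightarrow> s" by auto
    have s: "s \<in> {0..1}" using closed_sequentially[OF closed_atLeastAtMost, of u 0 1 s] u by auto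
    let ?B = "q \<oplus> b" let ?c = "- (b - s *\<^sub>R a)"
    have un: "- (b - u n *\<^sub>R a) \<in> D ?B" "?B \<oplus> - (b - u n *\<^sub>R a) = q \<oplus> u n *\<^sub>R a" for n
      using neg_in act_neg u(2)[of n] unfolding P_def by metis+
    have lim: "(\<lambda>n. - (b - u n *\<^sub>R a)) \<longlonglongrightarrow> ?c" by (intro tendsto_intros u)
    have cD: "?c \<in> D ?B" using closed_sequentially[OF D_closed un(1) lim] .
    obtain r where r: "r > 0" 
      "\<And>y. y \<in> D ?B \<Longrightarrow> norm (y - ?c) < r \<Longrightarrow> y - ?c \<in> D (?B \<oplus> ?c)"
      "\<And>y. y \<in> D ?B \<Longrightarrow> norm (y - ?c) < r \<Longrightarrow> ?B \<oplus> ?c \<oplus> (y - ?c) = ?B \<oplus> y"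
      by (rule nearby[OF cD]) blast
    obtain n where n: "norm (- (b - u n *\<^sub>R a) - ?c) < r"
      using tendstoD[OF lim r(1)] eventually_happens'[OF sequentially_bot] unfolding dist_norm by blast
    have e: "- (b - u n *\<^sub>R a) - ?c = (u n - s) *\<^sub>R a" by (simp add: algebra_simps)
    \<comment> \<open>The limit vector has the right end point because one common short vector takes
      both points to \<open>q \<oplus> u n *\<^sub>R a\<close>.\<close>
    have "?B \<oplus> ?c = q \<oplus> s *\<^sub>R a"
    proof (rule act_cancel)
      show "(u n - s) *\<^sub>R a \<in> D (?B \<oplus> ?c)" using r(2)[OF un(1) n] unfolding e .
      show "(u n - s) *\<^sub>R a \<in> D (q \<oplus> s *\<^sub>R a)" using segment_in[OF a, of s "u n"] s u(1)[of n] by auto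
      show "?B \<oplus> ?c \<oplus> (u n - s) *\<^sub>R a = q \<oplus> s *\<^sub>R a \<oplus> (u n - s) *\<^sub>R a"
        using r(3)[OF un(1) n] segment_in(2)[OF a, of s "u n"] s u(1)[of n] un(2)[of n] unfolding e by auto
    qed
    then have "P s" unfolding P_def using neg_in[OF cD] act_neg[OF cD] by simp
    then show "s \<in> ?T" using s by simp
  qed
  then have "closedin (top_of_set {0..1}) ?T" by (intro closed_subset) auto
  ultimately have "?T = {} \<or> ?T = {0..1}"
    using connected_clopen[of "{0..1::real}"] connected_Icc by metis
  moreover have "0 \<in> ?T" unfolding P_def using q act_zero b by simp
  ultimately have "?T = {0..1}" by (metis empty_iff)
  moreover have "(1::real) \<in> {0..1}" by simp
  ultimately have "1 \<in> ?T" by metis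
  then show "b - a \<in> D (q \<oplus> a)" "q \<oplus> a \<oplus> (b - a) = q \<oplus> b" unfolding P_def by auto
qed

text \<open>From \<open>q \<oplus> a\<close> the vectors \<open>- a\<close> and \<open>b\<close>
  lead to the two points to be joined, so this is \<open>diff_in\<close> at
  \<open>q \<oplus> a\<close>.\<close>

lemma add_in:
  assumes a: "a \<in> D q" and b: "b \<in> D (q \<oplus> a)"
  shows "a + b \<in> D q" "q \<oplus> (a + b) = q \<oplus> a \<oplus> b"
  using diff_in[OF neg_in[OF a] b] unfolding act_neg[OF a] by (simp_all add: add.commute)

lemma D_shift: "a \<in> D q \<Longrightarrow> x \<in> D (q \<oplus> a) \<longleftrightarrow> a + x \<in> D q"
  using add_in(1) diff_in(1)[of a q "a + x"] by auto

lemma act_act: "a \<in> D q \<Longrightarrow> a + x \<in> D q \<Longrightarrow> q \<oplus> a \<oplus> x = q \<oplus> (a + x)"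
  using add_in(2) D_shift by metis

lemma D_convex: "convex (D p)"
  unfolding convex_alt
proof (intro ballI allI impI)
  fix x y and u :: real assume xy: "x \<in> D p" "y \<in> D p" and u: "0 \<le> u \<and> u \<le> 1"
  have "u *\<^sub>R (y - x) \<in> D (p \<oplus> x)" using shrink diff_in(1)[OF xy] u by blast
  then have "x + u *\<^sub>R (y - x) \<in> D p" using D_shift xy by blast
  then show "(1 - u) *\<^sub>R x + u *\<^sub>R y \<in> D p" by (simp add: algebra_simps)
qed

text \<open>The points reachable from \<open>p\<close> form an open set. So do the others, because
  \<open>add_in\<close> and reversal make reachability an equivalence relation. Connectedness leaves
  a single class.\<close>

lemma reach:
  assumes "p \<in> topspace X" "q \<in> topspace X"
  shows "\<exists>u\<in>D p. q = p \<oplus> u"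
proof -
  have opn: "openin X (act p ` D p)" for p
    using act_open[of p] unfolding open_map_def by (metis openin_subtopology_self)
  let ?A = "act p ` D p"
  have self: "q \<in> act q ` D q" if "q \<in> topspace X" for q
    using that zero_in act_zero by (intro image_eqI[of _ _ 0]) auto
  have sub: "act q ` D q \<subseteq> topspace X" for q using act_in by auto
  have "topspace X - ?A = (\<Union>q\<in>topspace X - ?A. act q ` D q)"
  proof (intro equalityI subsetI)
    fix q assume "q \<in> topspace X - ?A"
    then show "q \<in> (\<Union>q\<in>topspace X - ?A. act q ` D q)" using self by blast
  next
    fix z assume "z \<in> (\<Union>q\<in>topspace X - ?A. act q ` D q)"
    then obtain q u where q: "q \<in> topspace X" "q \<notin> ?A" "u \<in> D q" "z = q \<oplus> u" by auto
    have "z \<notin> ?A"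
    proof
      assume "z \<in> ?A"
      then obtain w where w: "w \<in> D p" "z = p \<oplus> w" by auto
      have "- u \<in> D (p \<oplus> w)" "p \<oplus> w \<oplus> - u = q" using neg_in[OF q(3)] act_neg[OF q(3)] q w by auto
      then have "w + - u \<in> D p" "p \<oplus> (w + - u) = q" using add_in[OF w(1), of "- u"] by auto
      then show False using q(2) by blast
    qed
    then show "z \<in> topspace X - ?A" using q sub by blast
  qed
  then have "openin X (topspace X - ?A)" using opn by (metis (no_types, lifting) imageE openin_Union)
  then have "closedin X ?A" using sub by (simp add: closedin_def)
  then have "?A = {} \<or> ?A = topspace X" using conn opn unfolding connected_space_clopen_in by blast
  then show ?thesis using self assms by blast
qed

definition Per :: "'b set" where "Per = {v. \<exists>p. v \<in> D p \<and> p \<oplus> v = p}"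

text \<open>A period at one point is a period everywhere, since it commutes with the vector
  \<open>w\<close> leading from \<open>p\<close> to \<open>q\<close>.\<close>

lemma Per_act:
  assumes "v \<in> Per" "q \<in> topspace X"
  shows "v \<in> D q" "q \<oplus> v = q"
proof -
  obtain p where p: "v \<in> D p" "p \<oplus> v = p" using assms unfolding Per_def by blast
  obtain w where w: "w \<in> D p" "q = p \<oplus> w" using reach D_base p assms by blast
  have vw: "v + w \<in> D p" "p \<oplus> (v + w) = p \<oplus> w" using add_in[OF p(1)] w p(2) by auto
  show "v \<in> D q" using D_shift[OF w(1), of v] vw w by (simp add: add.commute)
  then show "q \<oplus> v = q" using act_act[OF w(1), of v] vw w by (simp add: add.commute)
qed

lemma act_eq_iff:
  assumes "u \<in> D p" "w \<in> D p"
  shows "p \<oplus> u = p \<oplus> w \<longleftrightarrow> w - u \<in> Per"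
proof
  assume "p \<oplus> u = p \<oplus> w"
  then have "p \<oplus> u \<oplus> (w - u) = p \<oplus> u" using diff_in(2)[OF assms] by simp
  then show "w - u \<in> Per" unfolding Per_def using diff_in(1)[OF assms] by blast
next
  assume "w - u \<in> Per"
  then show "p \<oplus> u = p \<oplus> w" using Per_act(2)[of "w - u" "p \<oplus> u"] diff_in(2)[OF assms] act_in assms by metis
qed

lemma Per_zero:
  assumes "p \<in> topspace X" shows "0 \<in> Per"
  unfolding Per_def using zero_in[OF assms] act_zero[OF assms] by blast

lemma Per_diff:
  assumes "x \<in> Per" "y \<in> Per" shows "x - y \<in> Per"
proof -
  obtain p where p: "x \<in> D p" "p \<oplus> x = p" using assms unfolding Per_def by blast
  then have "y \<in> D p" "p \<oplus> y = p" using Per_act[OF assms(2)] D_base by blast+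
  then show ?thesis using act_eq_iff[of y p x] p by simp
qed

text \<open>Short vectors of \<open>D p\<close> with the same end point coincide, and 0 is one of
  those that end at \<open>p\<close>.\<close>

lemma Per_separated:
  assumes p: "p \<in> topspace X"
  shows "\<exists>r>0. \<forall>v\<in>Per. norm v < r \<longrightarrow> v = 0"
proof -
  obtain r where r: "gd p r" using ex_good p by blast
  have "v = 0" if "v \<in> Per" "norm v < r" for v
    by (rule inj_onD[OF gd_inj[OF r]]) (use that Per_act[OF that(1) p] p act_zero zero_in gd_pos[OF r] in auto)
  then show ?thesis using gd_pos[OF r] by blast
qed

lemma D_add_Per:
  assumes "x \<in> D p" "v \<in> Per" shows "x + v \<in> D p"
  using add_in(1)[of v p x] Per_act[OF assms(2)] D_base assms by (metis add.commute)

text \<open>The directions in which \<open>D p\<close> is invariant form a subspace. Periods belong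
  to it: their integer multiples preserve \<open>D p\<close>, and convexity fills the gaps.\<close>

lemma D_add_span:
  assumes x: "x \<in> D p" and w: "w \<in> span Per" shows "x + w \<in> D p"
proof -
  have p: "p \<in> topspace X" using D_base x .
  define L where "L = {w. \<forall>x\<in>D p. \<forall>t::real. x + t *\<^sub>R w \<in> D p}"
  have "subspace L"
    unfolding subspace_def
  proof (intro conjI ballI allI)
    show "0 \<in> L" unfolding L_def by simp
    show "x + y \<in> L" if "x \<in> L" "y \<in> L" for x y
      using that unfolding L_def by (auto simp: scaleR_add_right add.assoc[symmetric])
    show "c *\<^sub>R x \<in> L" if "x \<in> L" for c x using that unfolding L_def by auto
  qed
  moreover have "Per \<subseteq> L"
  proof
    fix v assume v: "v \<in> Per"
    have nat: "x + real n *\<^sub>R v \<in> D p" if "x \<in> D p" "v \<in> Per" for n x v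
    proof (induction n)
      case (Suc n)
      then show ?case using D_add_Per[OF Suc that(2)] by (simp add: algebra_simps)
    qed (use that in simp)
    have neg: "- v \<in> Per" using Per_diff[OF Per_diff[OF v v] v] by simp
    have int: "x + real_of_int n *\<^sub>R v \<in> D p" if "x \<in> D p" for n x
    proof (cases "n \<ge> 0")
      case True then show ?thesis using nat[OF that v, of "nat n"] by simp
    next
      case False then show ?thesis using nat[OF that neg, of "nat (- n)"] by simp
    qed
    have "x + t *\<^sub>R v \<in> D p" if "x \<in> D p" for x t
    proof -
      \<comment> \<open>\<open>x + t *\<^sub>R v\<close> lies on the segment between the translates
        by the integers on both sides of \<open>t\<close>.\<close>
      have "(1 - frac t) *\<^sub>R (x + real_of_int \<lfloor>t\<rfloor> *\<^sub>R v) + frac t *\<^sub>R (x + real_of_int (\<lfloor>t\<rfloor> + 1) *\<^sub>R v) \<in> D p"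
        by (intro convexD_alt[OF D_convex] int that) (simp_all add: frac_lt_1 less_imp_le)
      also have "(1 - frac t) *\<^sub>R (x + real_of_int \<lfloor>t\<rfloor> *\<^sub>R v) + frac t *\<^sub>R (x + real_of_int (\<lfloor>t\<rfloor> + 1) *\<^sub>R v) = x + (real_of_int \<lfloor>t\<rfloor> + frac t) *\<^sub>R v"
        by (simp add: algebra_simps)
      also have "real_of_int \<lfloor>t\<rfloor> + frac t = t" by (simp add: frac_def)
      finally show ?thesis .
    qed
    then show "v \<in> L" unfolding L_def by simp
  qed
  ultimately have "w \<in> L" using span_minimal w by blast
  then show ?thesis unfolding L_def using x by (metis (mono_tags) mem_Collect_eq scaleR_one)
qed

end

section \<open>Motions in a locally convex parallel space\<close>

text \<open>These are the charts to which completeness refers. Motions are defined by the given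
  atlas but will be read in all of these, so that charts constructed later have the same
  standing.\<close>

definition flat_chart ::
    "('a, 'q, 'v::euclidean_space) parallel \<Rightarrow> 'q set \<Rightarrow> ('q \<Rightarrow> 'v) \<Rightarrow> bool" where
  "flat_chart Q U f \<longleftrightarrow> (U, f) \<in> index (saturate Q)"

lemma flat_chart_iff:
  "flat_chart Q U f \<longleftrightarrow> is_chart (qtop Q) (model Q) U f \<and> convex (f ` U) \<and>
     (\<forall>\<alpha>\<in>index Q. locally_constant_on (qtop Q) (U \<inter> cdom Q \<alpha>) (\<lambda>x. f x - chart Q \<alpha> x))"
  by (simp add: flat_chart_def saturate_def)

lemma flat_chart_openin: "flat_chart Q U f \<Longrightarrow> openin (qtop Q) U"
  and flat_chart_model: "flat_chart Q U f \<Longrightarrow> f ` U \<subseteq> model Q"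
  and flat_chart_convex: "flat_chart Q U f \<Longrightarrow> convex (f ` U)"
  and flat_chart_homeo: "flat_chart Q U f \<Longrightarrow>
    homeomorphic_map (subtopology (qtop Q) U) (top_of_set (f ` U)) f"
  by (auto simp: flat_chart_iff is_chart_def)

lemma flat_chart_topspace:
  assumes "flat_chart Q U f" shows "topspace (subtopology (qtop Q) U) = U"
  using openin_subset[OF flat_chart_openin[OF assms]] by auto

lemma flat_chart_inj: "flat_chart Q U f \<Longrightarrow> inj_on f U"
  using homeomorphic_imp_injective_map[OF flat_chart_homeo] flat_chart_topspace by metis

lemma flat_chart_open_vimage:
  assumes U: "flat_chart Q U f" and "open G"
  shows "openin (qtop Q) {x \<in> U. f x \<in> G}"
proof -
  have "openin (top_of_set (f ` U)) (f ` U \<inter> G)" using assms by (simp add: openin_open_Int)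
  then have "openin (subtopology (qtop Q) U) {x \<in> topspace (subtopology (qtop Q) U). f x \<in> f ` U \<inter> G}"
    using homeomorphic_imp_continuous_map[OF flat_chart_homeo[OF U]] unfolding continuous_map by blast
  also have "{x \<in> topspace (subtopology (qtop Q) U). f x \<in> f ` U \<inter> G} = {x \<in> U. f x \<in> G}"
    using flat_chart_topspace[OF U] by auto
  finally show ?thesis using openin_trans_full flat_chart_openin[OF U] by blast
qed

lemma flat_chart_ball:
  assumes U: "flat_chart Q U f" and W: "openin (qtop Q) W" and q: "q \<in> U" "q \<in> W"
  shows "\<exists>e>0. \<forall>x\<in>U. dist (f q) (f x) < e \<longrightarrow> x \<in> W"
proof -
  have "openin (subtopology (qtop Q) U) (U \<inter> W)" using W by (auto simp: openin_subtopology)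
  then have "openin (top_of_set (f ` U)) (f ` (U \<inter> W))"
    using homeomorphic_imp_open_map[OF flat_chart_homeo[OF U]] by (simp add: open_map_def)
  then obtain e where e: "e > 0" "ball (f q) e \<inter> f ` U \<subseteq> f ` (U \<inter> W)"
    using q unfolding openin_contains_ball by blast
  have "x \<in> W" if "x \<in> U" "dist (f q) (f x) < e" for x
  proof -
    have "f x \<in> f ` (U \<inter> W)" using e that by auto
    then obtain y where y: "y \<in> U" "y \<in> W" "f x = f y" by blast
    then have "x = y" using inj_onD[OF flat_chart_inj[OF U] y(3)] that by blast
    then show ?thesis using y by simp
  qed
  then show ?thesis using e(1) by blast
qed

lemma affine_shift:
  fixes A B v :: "'v::real_vector"
  shows "A = B + (x - a) *\<^sub>R v \<longleftrightarrow> A - x *\<^sub>R v = B - a *\<^sub>R v"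
  by (simp add: algebra_simps)

lemma locally_affine_imp_affine:
  fixes F :: "real \<Rightarrow> 'v::real_normed_vector"
  assumes J: "is_interval J" and st: "s \<in> J" "t \<in> J"
    and loc: "\<And>a. a \<in> J \<Longrightarrow> \<exists>e>0. \<forall>x\<in>J. \<bar>x - a\<bar> < e \<longrightarrow> F x = F a + (x - a) *\<^sub>R v"
  shows "F t = F s + (t - s) *\<^sub>R v"
proof (rule connected_induction_simple[of J s t])
  show "connected J" using J by (rule is_interval_connected)
  fix a assume a: "a \<in> J"
  then obtain e where e: "e > 0" "\<forall>x\<in>J. \<bar>x - a\<bar> < e \<longrightarrow> F x = F a + (x - a) *\<^sub>R v" using loc by blast
  show "\<exists>T. openin (top_of_set J) T \<and> a \<in> T \<and>
      (\<forall>x\<in>T. \<forall>y\<in>T. F x = F s + (x - s) *\<^sub>R v \<longrightarrow> F y = F s + (y - s) *\<^sub>R v)"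
  proof (intro exI conjI ballI impI)
    show "openin (top_of_set J) (J \<inter> ball a e)" by (rule openin_open_Int) simp
    show "a \<in> J \<inter> ball a e" using a e(1) by simp
    fix x y assume xy: "x \<in> J \<inter> ball a e" "y \<in> J \<inter> ball a e" "F x = F s + (x - s) *\<^sub>R v"
    then have "F x = F a + (x - a) *\<^sub>R v" "F y = F a + (y - a) *\<^sub>R v"
      using e(2) by (auto simp: dist_real_def abs_minus_commute)
    then show "F y = F s + (y - s) *\<^sub>R v" using xy(3) unfolding affine_shift by simp
  qed
qed (use st in auto)

locale convex_parallel =
  fixes Q :: "('a, 'q, 'v::euclidean_space) parallel"
  assumes lc: "locally_convex Q"
begin

abbreviation X where "X \<equiv> qtop Q"
abbreviation V where "V \<equiv> model Q"

lemma ps: "parallel_space Q" using lc by (simp add: locally_convex_def)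

lemma V_sub: "subspace V" and X_haus: "Hausdorff_space X"
  using ps by (auto simp: parallel_space_def)

lemma chart_flat: "\<alpha> \<in> index Q \<Longrightarrow> flat_chart Q (cdom Q \<alpha>) (chart Q \<alpha>)"
  using lc by (auto simp: locally_convex_def parallel_space_def flat_chart_iff)

lemma ex_chart: "p \<in> topspace X \<Longrightarrow> \<exists>\<alpha>\<in>index Q. p \<in> cdom Q \<alpha>"
  using ps by (auto simp: parallel_space_def)

lemma ex_flat_chart: "p \<in> topspace X \<Longrightarrow> \<exists>U f. flat_chart Q U f \<and> p \<in> U"
  using ex_chart chart_flat by blast

lemma flat_chart_in: "flat_chart Q U f \<Longrightarrow> x \<in> U \<Longrightarrow> x \<in> topspace X"
  using flat_chart_openin openin_subset by blast

text \<open>The saturated atlas demands compatibility only with the given charts, so two of its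
  members are compared through a given chart around \<open>q\<close>.\<close>

lemma flat_chart_agree:
  assumes U: "flat_chart Q U f" "flat_chart Q U' f'" and q: "q \<in> U" "q \<in> U'"
  shows "\<exists>W. openin X W \<and> q \<in> W \<and> W \<subseteq> U \<inter> U' \<and> (\<forall>x\<in>W. f x - f q = f' x - f' q)"
proof -
  obtain \<alpha> where \<alpha>: "\<alpha> \<in> index Q" "q \<in> cdom Q \<alpha>" using ex_chart flat_chart_in U q by blast
  have *: "\<exists>W. openin X W \<and> q \<in> W \<and> W \<subseteq> U \<inter> cdom Q \<alpha> \<and> (\<forall>x\<in>W. f x - f q = chart Q \<alpha> x - chart Q \<alpha> q)"
    if U: "flat_chart Q U f" "q \<in> U" for U f
  proof -
    have "locally_constant_on X (U \<inter> cdom Q \<alpha>) (\<lambda>x. f x - chart Q \<alpha> x)"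
      using U \<alpha> by (auto simp: flat_chart_iff)
    then obtain W where W: "openin (subtopology X (U \<inter> cdom Q \<alpha>)) W" "q \<in> W"
        "\<forall>x\<in>W. f x - chart Q \<alpha> x = f q - chart Q \<alpha> q"
      using U \<alpha> unfolding locally_constant_on_def by blast
    have "openin X (U \<inter> cdom Q \<alpha>)"
      using flat_chart_openin[OF U(1)] flat_chart_openin[OF chart_flat[OF \<alpha>(1)]] by blast
    then have "openin X W" "W \<subseteq> U \<inter> cdom Q \<alpha>"
      using W(1) openin_trans_full openin_subset[OF W(1)] by auto
    moreover have "f x - f q = chart Q \<alpha> x - chart Q \<alpha> q" if "x \<in> W" for x
      using W(3)[rule_format, OF that] by (simp add: algebra_simps)
    ultimately show ?thesis using W(2) by blast
  qed
  obtain W where W: "openin X W" "q \<in> W" "W \<subseteq> U \<inter> cdom Q \<alpha>" "\<forall>x\<in>W. f x - f q = chart Q \<alpha> x - chart Q \<alpha> q"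
    using *[OF U(1) q(1)] by blast
  obtain W' where W': "openin X W'" "q \<in> W'" "W' \<subseteq> U' \<inter> cdom Q \<alpha>" "\<forall>x\<in>W'. f' x - f' q = chart Q \<alpha> x - chart Q \<alpha> q"
    using *[OF U(2) q(2)] by blast
  show ?thesis using W W' by (intro exI[of _ "W \<inter> W'"]) auto
qed

lemma motion_near:
  assumes "motion Q v I \<gamma>" "a \<in> I" "openin X W" "\<gamma> a \<in> W"
  shows "\<exists>e>0. \<forall>x\<in>I. \<bar>x - a\<bar> < e \<longrightarrow> \<gamma> x \<in> W"
proof -
  have "openin (top_of_set I) {x \<in> I. \<gamma> x \<in> W}"
    using assms unfolding motion_def continuous_map by auto
  then obtain e where "e > 0" "ball a e \<inter> I \<subseteq> {x \<in> I. \<gamma> x \<in> W}"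
    using assms unfolding openin_contains_ball by blast
  then show ?thesis by (intro exI[of _ e]) (auto simp: dist_real_def abs_minus_commute subset_iff)
qed

lemma motion_in: "motion Q v I \<gamma> \<Longrightarrow> a \<in> I \<Longrightarrow> \<gamma> a \<in> topspace X"
  unfolding motion_def continuous_map by auto

lemma motion_interval: "motion Q v I \<gamma> \<Longrightarrow> is_interval I"
  by (simp add: motion_def)

lemma near_interval: "is_interval (I::real set) \<Longrightarrow> is_interval {x \<in> I. \<bar>x - a\<bar> < e}"
proof -
  assume "is_interval I"
  moreover have "{x \<in> I. \<bar>x - a\<bar> < e} = I \<inter> {a - e<..<a + e}" by auto
  moreover have "is_interval {a - e<..<a + e}" by (simp add: is_interval_oo)
  ultimately show ?thesis by (metis is_interval_Int)
qed

text \<open>Transfers the equation of motion from a given chart to a compatible one, where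
  differences of nearby points are the same.\<close>

lemma motion_chart_near:
  assumes m: "motion Q v I \<gamma>" and a: "a \<in> I" and U: "flat_chart Q U f" "\<gamma> a \<in> U"
  shows "\<exists>e>0. \<forall>x\<in>I. \<bar>x - a\<bar> < e \<longrightarrow> \<gamma> x \<in> U \<and> f (\<gamma> x) = f (\<gamma> a) + (x - a) *\<^sub>R v"
proof -
  obtain \<alpha> where \<alpha>: "\<alpha> \<in> index Q" "\<gamma> a \<in> cdom Q \<alpha>" using ex_chart motion_in[OF m a] by blast
  obtain W where W: "openin X W" "\<gamma> a \<in> W" "W \<subseteq> U \<inter> cdom Q \<alpha>"
      "\<forall>x\<in>W. f x - f (\<gamma> a) = chart Q \<alpha> x - chart Q \<alpha> (\<gamma> a)"
    using flat_chart_agree[OF U(1) chart_flat[OF \<alpha>(1)] U(2) \<alpha>(2)] by blast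
  obtain e where e: "e > 0" "\<forall>x\<in>I. \<bar>x - a\<bar> < e \<longrightarrow> \<gamma> x \<in> W" using motion_near[OF m a W(1,2)] by blast
  let ?J = "{x \<in> I. \<bar>x - a\<bar> < e}"
  have "is_interval ?J \<and> ?J \<subseteq> I \<and> \<gamma> ` ?J \<subseteq> cdom Q \<alpha>"
    using near_interval motion_interval[OF m] e W(3) by auto
  then have *: "chart Q \<alpha> (\<gamma> x) = chart Q \<alpha> (\<gamma> a) + (x - a) *\<^sub>R v" if "x \<in> ?J" for x
    using m[unfolded motion_def, THEN conjunct2, THEN conjunct2, rule_format, OF \<alpha>(1), of ?J a x] that a e(1)
    by auto
  have "\<gamma> x \<in> U \<and> f (\<gamma> x) = f (\<gamma> a) + (x - a) *\<^sub>R v" if "x \<in> I" "\<bar>x - a\<bar> < e" for x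
  proof -
    have "\<gamma> x \<in> W" using e(2) that by blast
    then have "f (\<gamma> x) - f (\<gamma> a) = (x - a) *\<^sub>R v" using *[of x] W(4) that by simp
    then show ?thesis using \<open>\<gamma> x \<in> W\<close> W(3) by (auto simp: diff_eq_eq add.commute)
  qed
  then show ?thesis using e(1) by blast
qed

lemma motion_chart:
  assumes m: "motion Q v I \<gamma>" and U: "flat_chart Q U f"
    and J: "is_interval J" "J \<subseteq> I" "\<gamma> ` J \<subseteq> U" and st: "s \<in> J" "t \<in> J"
  shows "f (\<gamma> t) = f (\<gamma> s) + (t - s) *\<^sub>R v"
proof (rule locally_affine_imp_affine[OF J(1) st])
  fix a assume a: "a \<in> J"
  then show "\<exists>e>0. \<forall>x\<in>J. \<bar>x - a\<bar> < e \<longrightarrow> f (\<gamma> x) = f (\<gamma> a) + (x - a) *\<^sub>R v"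
    using motion_chart_near[OF m _ U, of a] J(2,3) by blast
qed

text \<open>One compatible chart around each time suffices. Even continuity follows, since the path
  is affine in a chart and charts are homeomorphisms.\<close>

lemma motionI:
  assumes I: "is_interval I"
    and loc: "\<And>a. a \<in> I \<Longrightarrow> \<exists>U f e. flat_chart Q U f \<and> e > 0 \<and>
      (\<forall>t\<in>I. \<bar>t - a\<bar> < e \<longrightarrow> \<gamma> t \<in> U \<and> f (\<gamma> t) = f (\<gamma> a) + (t - a) *\<^sub>R v)"
  shows "motion Q v I \<gamma>"
proof -
  have inX: "\<gamma> a \<in> topspace X" if a: "a \<in> I" for a
    using loc[OF a] flat_chart_in a by (metis abs_zero diff_self)
  have near: "\<exists>e>0. \<forall>t\<in>I. \<bar>t - a\<bar> < e \<longrightarrow> \<gamma> t \<in> W" if a: "a \<in> I" and W: "openin X W" "\<gamma> a \<in> W" for a W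
  proof -
    obtain U f e where U: "flat_chart Q U f" "e > 0"
      "\<And>t. t \<in> I \<Longrightarrow> \<bar>t - a\<bar> < e \<Longrightarrow> \<gamma> t \<in> U \<and> f (\<gamma> t) = f (\<gamma> a) + (t - a) *\<^sub>R v" using loc[OF a] by blast
    have aU: "\<gamma> a \<in> U" using U(2) U(3)[of a] a by simp
    obtain d where d: "d > 0" "\<forall>x\<in>U. dist (f (\<gamma> a)) (f x) < d \<longrightarrow> x \<in> W" using flat_chart_ball[OF U(1) W(1) aU W(2)] by blast
    have pos: "norm v + 1 > 0" by (simp add: add_nonneg_pos)
    have "\<gamma> t \<in> W" if t: "t \<in> I" "\<bar>t - a\<bar> < min e (d / (norm v + 1))" for t
    proof -
      have "dist (f (\<gamma> a)) (f (\<gamma> t)) = norm ((t - a) *\<^sub>R v)" using U(3)[of t] t by (simp add: dist_norm)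
      also have "\<dots> \<le> \<bar>t - a\<bar> * (norm v + 1)" by (simp add: mult_left_mono)
      also have "\<dots> < d / (norm v + 1) * (norm v + 1)" using t pos by (intro mult_strict_right_mono) auto
      also have "\<dots> = d" using pos by simp
      finally show ?thesis using d(2) U(3)[of t] t by auto
    qed
    then show ?thesis using U(2) d(1) pos by (intro exI[of _ "min e (d / (norm v + 1))"]) auto
  qed
  have "continuous_map (top_of_set I) X \<gamma>"
  proof (rule continuous_map_locally)
    show "\<gamma> x \<in> topspace X" if "x \<in> topspace (top_of_set I)" for x using inX that by simp
    fix a W assume a: "a \<in> topspace (top_of_set I)" and W: "openin X W" "\<gamma> a \<in> W"
    then obtain e where e: "e > 0" "\<forall>t\<in>I. \<bar>t - a\<bar> < e \<longrightarrow> \<gamma> t \<in> W" using near[of a W] by auto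
    have "openin (top_of_set I) (I \<inter> ball a e)" by (rule openin_open_Int) simp
    moreover have "\<gamma> ` (I \<inter> ball a e) \<subseteq> W" using e(2) by (auto simp: dist_real_def abs_minus_commute)
    ultimately show "\<exists>U. openin (top_of_set I) U \<and> a \<in> U \<and> \<gamma> ` U \<subseteq> W" using a e(1) by (intro exI[of _ "I \<inter> ball a e"]) auto
  qed
  moreover have "chart Q \<alpha> (\<gamma> t) = chart Q \<alpha> (\<gamma> s) + (t - s) *\<^sub>R v"
    if \<alpha>: "\<alpha> \<in> index Q" and J: "is_interval J" "J \<subseteq> I" "\<gamma> ` J \<subseteq> cdom Q \<alpha>" and st: "s \<in> J" "t \<in> J" for \<alpha> J s t
  proof (rule locally_affine_imp_affine[OF J(1) st])
    fix a assume a: "a \<in> J"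
    then obtain U f e where U: "flat_chart Q U f" "e > 0"
      "\<And>t. t \<in> I \<Longrightarrow> \<bar>t - a\<bar> < e \<Longrightarrow> \<gamma> t \<in> U \<and> f (\<gamma> t) = f (\<gamma> a) + (t - a) *\<^sub>R v" using loc[of a] J by blast
    have aU: "\<gamma> a \<in> U" using U(2) U(3)[of a] a J by auto
    obtain W where W: "openin X W" "\<gamma> a \<in> W" "W \<subseteq> U \<inter> cdom Q \<alpha>"
        "\<forall>x\<in>W. f x - f (\<gamma> a) = chart Q \<alpha> x - chart Q \<alpha> (\<gamma> a)"
      using flat_chart_agree[OF U(1) chart_flat[OF \<alpha>] aU] J a by blast
    obtain d where d: "d > 0" "\<forall>t\<in>I. \<bar>t - a\<bar> < d \<longrightarrow> \<gamma> t \<in> W" using near[of a W] W a J by auto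
    have "chart Q \<alpha> (\<gamma> x) = chart Q \<alpha> (\<gamma> a) + (x - a) *\<^sub>R v" if x: "x \<in> J" "\<bar>x - a\<bar> < min d e" for x
    proof -
      have xI: "x \<in> I" "\<bar>x - a\<bar> < d" "\<bar>x - a\<bar> < e" using x J by auto
      then have "f (\<gamma> x) - f (\<gamma> a) = chart Q \<alpha> (\<gamma> x) - chart Q \<alpha> (\<gamma> a)" using d(2) W(4) by blast
      then show ?thesis using U(3)[OF xI(1,3)] by (simp add: algebra_simps)
    qed
    moreover have "min d e > 0" using d(1) U(2) by simp
    ultimately show "\<exists>e>0. \<forall>x\<in>J. \<bar>x - a\<bar> < e \<longrightarrow> chart Q \<alpha> (\<gamma> x) = chart Q \<alpha> (\<gamma> a) + (x - a) *\<^sub>R v"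
      by blast
  qed
  ultimately show ?thesis unfolding motion_def using I by blast
qed

lemma motion_cong:
  assumes m: "motion Q v I \<gamma>" and eq: "\<And>t. t \<in> I \<Longrightarrow> \<gamma>' t = \<gamma> t"
  shows "motion Q v I \<gamma>'"
proof (rule motionI[OF motion_interval[OF m]])
  fix a assume a: "a \<in> I"
  obtain U f where U: "flat_chart Q U f" "\<gamma> a \<in> U" using ex_flat_chart motion_in[OF m a] by blast
  show "\<exists>U f e. flat_chart Q U f \<and> e > 0 \<and>
      (\<forall>t\<in>I. \<bar>t - a\<bar> < e \<longrightarrow> \<gamma>' t \<in> U \<and> f (\<gamma>' t) = f (\<gamma>' a) + (t - a) *\<^sub>R v)"
    using motion_chart_near[OF m a U] U(1) eq a by (metis (no_types, lifting))
qed

lemma motion_subset: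
  assumes m: "motion Q v I \<gamma>" and J: "is_interval J" "J \<subseteq> I"
  shows "motion Q v J \<gamma>"
  unfolding motion_def
proof (intro conjI)
  show "continuous_map (top_of_set J) X \<gamma>"
    by (rule continuous_map_from_subtopology_mono[OF _ J(2)]) (use m in \<open>simp add: motion_def\<close>)
  show "\<forall>\<alpha>\<in>index Q. \<forall>J'. is_interval J' \<and> J' \<subseteq> J \<and> \<gamma> ` J' \<subseteq> cdom Q \<alpha> \<longrightarrow>
      (\<forall>s\<in>J'. \<forall>t\<in>J'. chart Q \<alpha> (\<gamma> t) = chart Q \<alpha> (\<gamma> s) + (t - s) *\<^sub>R v)"
  proof (intro ballI allI impI)
    fix \<alpha> J' s t
    assume \<alpha>: "\<alpha> \<in> index Q" and J': "is_interval J' \<and> J' \<subseteq> J \<and> \<gamma> ` J' \<subseteq> cdom Q \<alpha>" and st: "s \<in> J'" "t \<in> J'"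
    then show "chart Q \<alpha> (\<gamma> t) = chart Q \<alpha> (\<gamma> s) + (t - s) *\<^sub>R v"
      using motion_chart[OF m chart_flat[OF \<alpha>], of J' s t] J(2) by auto
  qed
qed (rule J(1))

lemma motion_affine:
  assumes m: "motion Q v I \<gamma>"
  shows "motion Q (c *\<^sub>R v) {t. c * t + s \<in> I} (\<lambda>t. \<gamma> (c * t + s))"
proof (rule motionI)
  show "is_interval {t. c * t + s \<in> I}"
  proof -
    have i: "is_interval I" by (rule motion_interval[OF m])
    have "c * x + s \<in> I" if "a \<le> x" "x \<le> b" "c * a + s \<in> I" "c * b + s \<in> I" for a b x
    proof (cases "c \<ge> 0")
      case True
      then have "c * a + s \<le> c * x + s" "c * x + s \<le> c * b + s" using that by (auto intro: mult_left_mono)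
      then show ?thesis using i that unfolding is_interval_1 by blast
    next
      case False
      then have "c * b + s \<le> c * x + s" "c * x + s \<le> c * a + s" using that by (auto intro: mult_left_mono_neg)
      then show ?thesis using i that unfolding is_interval_1 by blast
    qed
    then show ?thesis unfolding is_interval_1 by blast
  qed
  fix a assume "a \<in> {t. c * t + s \<in> I}"
  then have a: "c * a + s \<in> I" by simp
  obtain U f where U: "flat_chart Q U f" "\<gamma> (c * a + s) \<in> U" using ex_flat_chart motion_in[OF m a] by blast
  obtain e where e: "e > 0" "\<And>x. x \<in> I \<Longrightarrow> \<bar>x - (c * a + s)\<bar> < e \<Longrightarrow> \<gamma> x \<in> U \<and> f (\<gamma> x) = f (\<gamma> (c * a + s)) + (x - (c * a + s)) *\<^sub>R v"
    using motion_chart_near[OF m a U] by blast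
  have pos: "\<bar>c\<bar> + 1 > 0" by simp
  have "\<gamma> (c * t + s) \<in> U \<and> f (\<gamma> (c * t + s)) = f (\<gamma> (c * a + s)) + (t - a) *\<^sub>R c *\<^sub>R v"
    if t: "c * t + s \<in> I" "\<bar>t - a\<bar> < e / (\<bar>c\<bar> + 1)" for t
  proof -
    have "\<bar>(c * t + s) - (c * a + s)\<bar> = \<bar>t - a\<bar> * \<bar>c\<bar>" by (simp add: abs_mult[symmetric] algebra_simps)
    also have "\<dots> \<le> \<bar>t - a\<bar> * (\<bar>c\<bar> + 1)" by (simp add: mult_left_mono)
    also have "\<dots> < e / (\<bar>c\<bar> + 1) * (\<bar>c\<bar> + 1)" using t pos by (intro mult_strict_right_mono) auto
    also have "\<dots> = e" using pos by simp
    finally show ?thesis using e(2)[OF t(1)] by (simp add: algebra_simps)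
  qed
  then show "\<exists>U f e. flat_chart Q U f \<and> e > 0 \<and> (\<forall>t\<in>{t. c * t + s \<in> I}. \<bar>t - a\<bar> < e \<longrightarrow>
      \<gamma> (c * t + s) \<in> U \<and> f (\<gamma> (c * t + s)) = f (\<gamma> (c * a + s)) + (t - a) *\<^sub>R c *\<^sub>R v)"
    using U(1) e(1) pos by (intro exI[of _ U] exI[of _ f] exI[of _ "e / (\<bar>c\<bar> + 1)"]) auto
qed

text \<open>Where two motions agree they agree nearby, because charts are injective; where they
  differ they differ nearby, because the space is Hausdorff.\<close>

lemma motion_unique:
  assumes m: "motion Q v I \<gamma>" "motion Q v I' \<gamma>'" and a: "a \<in> I" "a \<in> I'" "\<gamma> a = \<gamma>' a"
    and t: "t \<in> I" "t \<in> I'"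
  shows "\<gamma> t = \<gamma>' t"
proof -
  let ?J = "I \<inter> I'"
  have J: "is_interval ?J" using m motion_interval is_interval_Int by blast
  have mJ: "motion Q v ?J \<gamma>" "motion Q v ?J \<gamma>'" using m J motion_subset by auto
  show ?thesis
  proof (rule connected_induction_simple[of ?J a t])
    show "connected ?J" using J by (rule is_interval_connected)
    fix b assume b: "b \<in> ?J"
    show "\<exists>T. openin (top_of_set ?J) T \<and> b \<in> T \<and> (\<forall>x\<in>T. \<forall>y\<in>T. \<gamma> x = \<gamma>' x \<longrightarrow> \<gamma> y = \<gamma>' y)"
    proof (cases "\<gamma> b = \<gamma>' b")
      case True
      obtain U f where U: "flat_chart Q U f" "\<gamma> b \<in> U" using ex_flat_chart motion_in[OF mJ(1) b] by blast
      obtain e where e: "e > 0" "\<And>x. x \<in> ?J \<Longrightarrow> \<bar>x - b\<bar> < e \<Longrightarrow> \<gamma> x \<in> U \<and> f (\<gamma> x) = f (\<gamma> b) + (x - b) *\<^sub>R v"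
        using motion_chart_near[OF mJ(1) b U] by blast
      obtain e' where e': "e' > 0" "\<And>x. x \<in> ?J \<Longrightarrow> \<bar>x - b\<bar> < e' \<Longrightarrow> \<gamma>' x \<in> U \<and> f (\<gamma>' x) = f (\<gamma> b) + (x - b) *\<^sub>R v"
        using motion_chart_near[OF mJ(2) b U(1)] U(2) True by metis
      have "\<gamma> y = \<gamma>' y" if "y \<in> ?J \<inter> ball b (min e e')" for y
        using e(2)[of y] e'(2)[of y] that flat_chart_inj[OF U(1)]
        by (auto simp: dist_real_def abs_minus_commute inj_on_def)
      moreover have "openin (top_of_set ?J) (?J \<inter> ball b (min e e'))" by (rule openin_open_Int) simp
      ultimately show ?thesis using b e(1) e'(1) by (intro exI[of _ "?J \<inter> ball b (min e e')"]) auto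
    next
      case False
      then obtain W W' where W: "openin X W" "openin X W'" "\<gamma> b \<in> W" "\<gamma>' b \<in> W'" "disjnt W W'"
        using X_haus motion_in[OF mJ(1) b] motion_in[OF mJ(2) b] unfolding Hausdorff_space_def by meson
      obtain e where e: "e > 0" "\<forall>x\<in>?J. \<bar>x - b\<bar> < e \<longrightarrow> \<gamma> x \<in> W" using motion_near[OF mJ(1) b W(1,3)] by blast
      obtain e' where e': "e' > 0" "\<forall>x\<in>?J. \<bar>x - b\<bar> < e' \<longrightarrow> \<gamma>' x \<in> W'" using motion_near[OF mJ(2) b W(2,4)] by blast
      have "\<gamma> y \<noteq> \<gamma>' y" if "y \<in> ?J \<inter> ball b (min e e')" for y
      proof -
        have "\<bar>y - b\<bar> < e" "\<bar>y - b\<bar> < e'" using that by (auto simp: dist_real_def)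
        then show ?thesis using e(2) e'(2) that W(5) unfolding disjnt_iff by (metis IntD1)
      qed
      moreover have "openin (top_of_set ?J) (?J \<inter> ball b (min e e'))" by (rule openin_open_Int) simp
      ultimately show ?thesis using b e(1) e'(1) by (intro exI[of _ "?J \<inter> ball b (min e e')"]) auto
    qed
  qed (use a t in auto)
qed

lemma motion_union:
  assumes m: "motion Q v I \<gamma>" "motion Q v I' \<gamma>" and z: "0 \<in> I" "0 \<in> I'"
  shows "motion Q v (I \<union> I') \<gamma>"
proof (rule motionI)
  have i: "is_interval I" "is_interval I'" using m motion_interval by auto
  show "is_interval (I \<union> I')"
    using is_interval_connected[OF i(1)] is_interval_connected[OF i(2)] z
    by (intro connected_Un[THEN is_interval_connected_1[THEN iffD2]]) auto
  have *: "\<exists>e>0. \<forall>t\<in>I. \<bar>t - a\<bar> < e \<longrightarrow> \<gamma> t \<in> U \<and> f (\<gamma> t) = f (\<gamma> a) + (t - a) *\<^sub>R v"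
    if m: "motion Q v I \<gamma>" "motion Q v I' \<gamma>" and z: "0 \<in> I" "0 \<in> I'" and a: "a \<in> I \<union> I'" and U: "flat_chart Q U f" "\<gamma> a \<in> U"
    for I I' a U f
  proof (cases "a \<in> I")
    case True
    then show ?thesis using motion_chart_near[OF m(1) True U] by blast
  next
    case False
    then have a': "a \<in> I'" using a by simp
    have i: "is_interval I" "is_interval I'" using m motion_interval by auto
    obtain e where e: "e > 0" "\<And>x. x \<in> I' \<Longrightarrow> \<bar>x - a\<bar> < e \<Longrightarrow> \<gamma> x \<in> U \<and> f (\<gamma> x) = f (\<gamma> a) + (x - a) *\<^sub>R v"
      using motion_chart_near[OF m(2) a' U] by blast
    have "a \<noteq> 0" using z False by auto
    \<comment> \<open>An element of \<open>I\<close> this close to \<open>a\<close> has the sign of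
      \<open>a\<close> and cannot lie beyond \<open>a\<close>, since \<open>I\<close> contains 0 but
      not \<open>a\<close>. So it lies between 0 and \<open>a\<close>, inside
      \<open>I'\<close>.\<close>
    have "t \<in> I'" if t: "t \<in> I" "\<bar>t - a\<bar> < \<bar>a\<bar>" for t
    proof (cases "a > 0")
      case True
      have "\<not> a \<le> t" using i(1) z(1) t(1) False True unfolding is_interval_1 by (meson less_imp_le)
      then have "0 \<le> t" "t \<le> a" using t(2) True by auto
      then show ?thesis using i(2) z(2) a' unfolding is_interval_1 by blast
    next
      case False2: False
      have "\<not> t \<le> a" using i(1) z(1) t(1) False False2 unfolding is_interval_1 by (meson not_less)
      then have "a \<le> t" "t \<le> 0" using t(2) False2 by auto
      then show ?thesis using i(2) z(2) a' unfolding is_interval_1 by blast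
    qed
    then show ?thesis using e \<open>a \<noteq> 0\<close> by (intro exI[of _ "min e \<bar>a\<bar>"]) auto
  qed
  fix a assume a: "a \<in> I \<union> I'"
  then have "\<gamma> a \<in> topspace X" using motion_in[OF m(1)] motion_in[OF m(2)] by (metis Un_iff)
  then obtain U f where U: "flat_chart Q U f" "\<gamma> a \<in> U" using ex_flat_chart by blast
  obtain e where e: "e > 0" "\<forall>t\<in>I. \<bar>t - a\<bar> < e \<longrightarrow> \<gamma> t \<in> U \<and> f (\<gamma> t) = f (\<gamma> a) + (t - a) *\<^sub>R v"
    using *[OF m z a U] by blast
  obtain e' where e': "e' > 0" "\<forall>t\<in>I'. \<bar>t - a\<bar> < e' \<longrightarrow> \<gamma> t \<in> U \<and> f (\<gamma> t) = f (\<gamma> a) + (t - a) *\<^sub>R v"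
    using *[OF m(2,1) z(2,1) _ U] a by blast
  show "\<exists>U f e. flat_chart Q U f \<and> e > 0 \<and>
      (\<forall>t\<in>I \<union> I'. \<bar>t - a\<bar> < e \<longrightarrow> \<gamma> t \<in> U \<and> f (\<gamma> t) = f (\<gamma> a) + (t - a) *\<^sub>R v)"
    using U(1) e e' by (intro exI[of _ U] exI[of _ f] exI[of _ "min e e'"]) auto
qed

text \<open>Prepares the maximal motion: two given times are covered by the union of two intervals
  of motion, which says nothing at once about the union of all of them.\<close>

lemma motion_compact:
  assumes I: "is_interval I" and m: "\<And>a b. a \<in> I \<Longrightarrow> b \<in> I \<Longrightarrow> a \<le> b \<Longrightarrow> motion Q v {a..b} \<gamma>"
  shows "motion Q v I \<gamma>"
proof (rule motionI[OF I])
  fix s assume s: "s \<in> I"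
  obtain a where a: "a \<in> I" "a \<le> s" "\<exists>e>0. \<forall>t\<in>I. \<bar>t - s\<bar> < e \<longrightarrow> a \<le> t"
  proof (cases "\<exists>a\<in>I. a < s")
    case True
    then obtain a where "a \<in> I" "a < s" by blast
    then show ?thesis by (intro that[of a] exI[of _ "s - a"]) auto
  next
    case False
    then show ?thesis using s by (intro that[of s] exI[of _ 1]) (auto simp: not_less)
  qed
  obtain b where b: "b \<in> I" "s \<le> b" "\<exists>e>0. \<forall>t\<in>I. \<bar>t - s\<bar> < e \<longrightarrow> t \<le> b"
  proof (cases "\<exists>b\<in>I. s < b")
    case True
    then obtain b where "b \<in> I" "s < b" by blast
    then show ?thesis by (intro that[of b] exI[of _ "b - s"]) auto
  next
    case False
    then show ?thesis using s by (intro that[of s] exI[of _ 1]) (auto simp: not_less)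
  qed
  have mab: "motion Q v {a..b} \<gamma>" using m a b by auto
  have sab: "s \<in> {a..b}" using a b by simp
  obtain U f where U: "flat_chart Q U f" "\<gamma> s \<in> U" using ex_flat_chart motion_in[OF mab sab] by blast
  obtain e where e: "e > 0" "\<And>t. t \<in> {a..b} \<Longrightarrow> \<bar>t - s\<bar> < e \<Longrightarrow> \<gamma> t \<in> U \<and> f (\<gamma> t) = f (\<gamma> s) + (t - s) *\<^sub>R v"
    using motion_chart_near[OF mab sab U] by blast
  obtain e1 e2 where e12: "e1 > 0" "\<forall>t\<in>I. \<bar>t - s\<bar> < e1 \<longrightarrow> a \<le> t" "e2 > 0" "\<forall>t\<in>I. \<bar>t - s\<bar> < e2 \<longrightarrow> t \<le> b"
    using a(3) b(3) by blast
  show "\<exists>U f e. flat_chart Q U f \<and> e > 0 \<and>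
      (\<forall>t\<in>I. \<bar>t - s\<bar> < e \<longrightarrow> \<gamma> t \<in> U \<and> f (\<gamma> t) = f (\<gamma> s) + (t - s) *\<^sub>R v)"
    using U(1) e e12 by (intro exI[of _ U] exI[of _ f] exI[of _ "min e (min e1 e2)"]) auto
qed

end

lemma dist_add_self: "dist (x::'v::real_normed_vector) (x + y) = norm y"
  by (simp add: dist_norm)

section \<open>Maximal motions and the partial action of the vectors\<close>

context convex_parallel begin

text \<open>By uniqueness all motions from \<open>p\<close> are restrictions of one function on the
  union of their intervals. This gives meaning to the definite descriptions in
  \<open>max_interval\<close> and \<open>max_motion\<close>.\<close>

lemma max_motion_unique_exists:
  assumes p: "p \<in> topspace X"
  shows "motion_from Q v p (max_interval Q v p) (max_motion Q v p)"
    and "motion_from Q v p I \<gamma> \<Longrightarrow> t \<in> I \<Longrightarrow> t \<in> max_interval Q v p \<and> max_motion Q v p t = \<gamma> t"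
proof -
  define M where "M = \<Union>{I. \<exists>\<gamma>. motion_from Q v p I \<gamma>}"
  define \<mu> where "\<mu> t = (SOME x. \<exists>I \<gamma>. motion_from Q v p I \<gamma> \<and> t \<in> I \<and> x = \<gamma> t)" for t
  have \<mu>: "\<mu> t = \<gamma> t" if "motion_from Q v p I \<gamma>" "t \<in> I" for I \<gamma> t
  proof -
    have "\<exists>I \<gamma>. motion_from Q v p I \<gamma> \<and> t \<in> I \<and> \<mu> t = \<gamma> t"
      unfolding \<mu>_def by (rule someI_ex) (use that in blast)
    then obtain I' \<gamma>' where "motion_from Q v p I' \<gamma>'" "t \<in> I'" "\<mu> t = \<gamma>' t" by blast
    then show ?thesis using motion_unique[of v I' \<gamma>' I \<gamma> 0 t] that unfolding motion_from_def by auto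
  qed
  have triv: "motion_from Q v p {0} (\<lambda>_. p)"
  proof -
    obtain U f where "flat_chart Q U f" "p \<in> U" using ex_flat_chart p by blast
    then have "motion Q v {0} (\<lambda>_. p)"
      by (intro motionI) (auto simp: is_interval_1 intro!: exI[of _ U] exI[of _ f] exI[of _ 1])
    then show ?thesis by (simp add: motion_from_def)
  qed
  have M0: "0 \<in> M" unfolding M_def using triv by blast
  have "is_interval M"
  proof -
    have "connected M" unfolding M_def
      by (rule connected_Union) (auto simp: motion_from_def motion_def is_interval_connected)
    then show ?thesis by (simp add: is_interval_connected_1)
  qed
  then have "motion Q v M \<mu>"
  proof (rule motion_compact)
    fix a b assume ab: "a \<in> M" "b \<in> M" "a \<le> b"
    obtain I \<gamma> where I: "motion_from Q v p I \<gamma>" "a \<in> I" using ab unfolding M_def by blast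
    obtain I' \<gamma>' where I': "motion_from Q v p I' \<gamma>'" "b \<in> I'" using ab unfolding M_def by blast
    have "motion Q v I \<mu>" "motion Q v I' \<mu>"
      using motion_cong \<mu> I I' unfolding motion_from_def by metis+
    then have "motion Q v (I \<union> I') \<mu>" using I I' by (intro motion_union) (auto simp: motion_from_def)
    moreover from this have "{a..b} \<subseteq> I \<union> I'"
      using motion_interval I(2) I'(2) unfolding is_interval_1 by fastforce
    ultimately show "motion Q v {a..b} \<mu>"
      using motion_subset[of v "I \<union> I'" \<mu> "{a..b}"] is_interval_cc by blast
  qed
  then have MM: "motion_from Q v p M \<mu>" using M0 \<mu>[OF triv] unfolding motion_from_def by auto
  have sub: "I \<subseteq> M" if "motion_from Q v p I \<gamma>" for I \<gamma> using that unfolding M_def by blast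
  have maxi: "maximal_motion Q v p M \<gamma> \<longleftrightarrow> motion_from Q v p M \<gamma>" for \<gamma>
    unfolding maximal_motion_def using sub by blast
  have Meq: "I = M" if m: "maximal_motion Q v p I \<gamma>" for I \<gamma>
    using m MM \<mu> sub unfolding maximal_motion_def by blast
  have I: "max_interval Q v p = M"
    unfolding max_interval_def using maxi MM Meq by (intro the_equality) blast+
  have ext: "(\<lambda>t. if t \<in> M then \<mu> t else undefined) = \<gamma>"
    if "\<gamma> \<in> extensional M" "maximal_motion Q v p M \<gamma>" for \<gamma>
    using that \<mu>[of M \<gamma>] by (auto simp: extensional_def maximal_motion_def fun_eq_iff)
  \<comment> \<open>The value \<open>undefined\<close> outside \<open>M\<close> is the one that
    \<open>extensional\<close> prescribes; it makes the function unique.\<close>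
  let ?m = "\<lambda>t. if t \<in> M then \<mu> t else undefined"
  have m: "motion_from Q v p M ?m"
    using MM motion_cong[of v M \<mu> ?m] unfolding motion_from_def by auto
  have mm: "max_motion Q v p = ?m"
    unfolding max_motion_def I
  proof (rule the_equality)
    show "?m \<in> extensional M \<and> maximal_motion Q v p M ?m"
      using m maxi by (auto simp: extensional_def)
  qed (use ext in auto)
  show "motion_from Q v p (max_interval Q v p) (max_motion Q v p)" unfolding I mm by (rule m)
  show "motion_from Q v p I \<gamma> \<Longrightarrow> t \<in> I \<Longrightarrow> t \<in> max_interval Q v p \<and> max_motion Q v p t = \<gamma> t"
    unfolding I mm using sub \<mu> by auto
qed

lemma max_scale1:
  assumes p: "p \<in> topspace X" and t: "c * t \<in> max_interval Q v p"
  shows "t \<in> max_interval Q (c *\<^sub>R v) p \<and> max_motion Q (c *\<^sub>R v) p t = max_motion Q v p (c * t)"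
proof (rule max_motion_unique_exists(2)[OF p])
  have "motion_from Q v p (max_interval Q v p) (max_motion Q v p)" using max_motion_unique_exists(1)[OF p] .
  then show "motion_from Q (c *\<^sub>R v) p {t. c * t + 0 \<in> max_interval Q v p} (\<lambda>t. max_motion Q v p (c * t))"
    using motion_affine[of v _ _ c 0] by (auto simp: motion_from_def)
qed (use t in simp)

lemma max_zero: "p \<in> topspace X \<Longrightarrow> 0 \<in> max_interval Q v p"
  and max_motion_zero: "p \<in> topspace X \<Longrightarrow> max_motion Q v p 0 = p"
  using max_motion_unique_exists(1) by (auto simp: motion_from_def)

lemma max_scale:
  assumes p: "p \<in> topspace X"
  shows "t \<in> max_interval Q (c *\<^sub>R v) p \<longleftrightarrow> c * t \<in> max_interval Q v p"
proof
  assume t: "t \<in> max_interval Q (c *\<^sub>R v) p"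
  show "c * t \<in> max_interval Q v p"
  proof (cases "c = 0")
    case False
    then have "inverse c * (c * t) \<in> max_interval Q (c *\<^sub>R v) p" using t by (simp add: field_simps)
    from max_scale1[OF p this] False show ?thesis by simp
  qed (simp add: max_zero p)
qed (use max_scale1[OF p] in blast)

lemma max_motion_in: "p \<in> topspace X \<Longrightarrow> s \<in> max_interval Q v p \<Longrightarrow> max_motion Q v p s \<in> topspace X"
  using motion_in[of v "max_interval Q v p" "max_motion Q v p" s] max_motion_unique_exists(1)[of p v]
  by (simp add: motion_from_def)

lemma max_shift1:
  assumes p: "p \<in> topspace X" and s: "s \<in> max_interval Q v p" and t: "s + t \<in> max_interval Q v p"
  shows "t \<in> max_interval Q v (max_motion Q v p s) \<and>
    max_motion Q v (max_motion Q v p s) t = max_motion Q v p (s + t)"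
proof (rule max_motion_unique_exists(2)[OF max_motion_in[OF p s]])
  have "motion_from Q v p (max_interval Q v p) (max_motion Q v p)" using max_motion_unique_exists(1)[OF p] .
  then show "motion_from Q v (max_motion Q v p s) {t. 1 * t + s \<in> max_interval Q v p} (\<lambda>t. max_motion Q v p (s + t))"
    using motion_affine[of v _ _ 1 s] s by (auto simp: motion_from_def add.commute)
qed (use t in \<open>simp add: add.commute\<close>)

lemma max_shift:
  assumes p: "p \<in> topspace X" and s: "s \<in> max_interval Q v p"
  shows "t \<in> max_interval Q v (max_motion Q v p s) \<longleftrightarrow> s + t \<in> max_interval Q v p"
proof
  let ?q = "max_motion Q v p s"
  assume t: "t \<in> max_interval Q v ?q"
  have q: "?q \<in> topspace X" using max_motion_in p s by blast
  have b: "- s \<in> max_interval Q v ?q" "max_motion Q v ?q (- s) = p"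
    using max_shift1[OF p s, of "- s"] max_zero[OF p] max_motion_zero[OF p] by auto
  have "s + t \<in> max_interval Q v (max_motion Q v ?q (- s))"
    using max_shift1[OF q b(1), of "s + t"] t by simp
  then show "s + t \<in> max_interval Q v p" using b by simp
qed (use max_shift1[OF p s] in blast)

lemma D_at_iff: "v \<in> D_at Q p \<longleftrightarrow> v \<in> V \<and> p \<in> topspace X \<and> 1 \<in> max_interval Q v p"
  by (auto simp: D_at_def D_set_def)

lemma D_at_scale:
  "v \<in> V \<Longrightarrow> s *\<^sub>R v \<in> D_at Q p \<longleftrightarrow> p \<in> topspace X \<and> s \<in> max_interval Q v p"
  using max_scale[of p 1 s v] subspace_scale[OF V_sub] by (auto simp: D_at_iff)

lemma translate_scale:
  "p \<in> topspace X \<Longrightarrow> s \<in> max_interval Q v p \<Longrightarrow> translate Q p (s *\<^sub>R v) = max_motion Q v p s"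
  using max_scale1[of p s 1 v] by (simp add: translate_def)

lemma zero_D: "p \<in> topspace X \<Longrightarrow> 0 \<in> D_at Q p"
  using D_at_scale[of 0 0 p] max_zero subspace_0[OF V_sub] by auto

lemma translate_zero: "p \<in> topspace X \<Longrightarrow> translate Q p 0 = p"
  using translate_scale[of p 0 0] max_zero max_motion_zero by auto

lemma D_at_line:
  assumes s: "s *\<^sub>R v \<in> D_at Q p"
  shows "t *\<^sub>R v \<in> D_at Q (translate Q p (s *\<^sub>R v)) \<longleftrightarrow> (s + t) *\<^sub>R v \<in> D_at Q p"
    and "(s + t) *\<^sub>R v \<in> D_at Q p \<Longrightarrow>
      translate Q (translate Q p (s *\<^sub>R v)) (t *\<^sub>R v) = translate Q p ((s + t) *\<^sub>R v)"
proof -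
  have p: "p \<in> topspace X" "s *\<^sub>R v \<in> V" using s D_at_iff by auto
  have "(t *\<^sub>R v \<in> D_at Q (translate Q p (s *\<^sub>R v)) \<longleftrightarrow> (s + t) *\<^sub>R v \<in> D_at Q p) \<and>
    ((s + t) *\<^sub>R v \<in> D_at Q p \<longrightarrow>
      translate Q (translate Q p (s *\<^sub>R v)) (t *\<^sub>R v) = translate Q p ((s + t) *\<^sub>R v))"
  proof (cases "s = 0")
    \<comment> \<open>Here \<open>v\<close> may lie outside the model space, so that
      \<open>D_at_scale\<close> does not apply.\<close>
    case True
    then show ?thesis using translate_zero p by simp
  next
    case False
    then have v: "v \<in> V" using p(2) subspace_scale[OF V_sub, of "s *\<^sub>R v" "inverse s"] by simp
    then have sm: "s \<in> max_interval Q v p" using s D_at_scale by blast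
    have tr: "translate Q p (s *\<^sub>R v) = max_motion Q v p s" using translate_scale p sm by blast
    show ?thesis
      unfolding tr D_at_scale[OF v]
      using max_shift[OF p(1) sm, of t] max_shift1[OF p(1) sm, of t] max_motion_in[OF p(1) sm]
        translate_scale[of "max_motion Q v p s" t v] translate_scale[of p "s + t" v] p by auto
  qed
  then show "t *\<^sub>R v \<in> D_at Q (translate Q p (s *\<^sub>R v)) \<longleftrightarrow> (s + t) *\<^sub>R v \<in> D_at Q p"
    "(s + t) *\<^sub>R v \<in> D_at Q p \<Longrightarrow>
      translate Q (translate Q p (s *\<^sub>R v)) (t *\<^sub>R v) = translate Q p ((s + t) *\<^sub>R v)" by auto
qed

lemma D_at_shrink:
  assumes v: "v \<in> D_at Q p" and s: "0 \<le> s" "s \<le> 1"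
  shows "s *\<^sub>R v \<in> D_at Q p"
proof -
  have *: "v \<in> V" "p \<in> topspace X" "1 \<in> max_interval Q v p" using v D_at_iff by auto
  have "is_interval (max_interval Q v p)"
    using max_motion_unique_exists(1)[OF *(2)] motion_interval unfolding motion_from_def by blast
  then have "s \<in> max_interval Q v p" using max_zero[OF *(2)] *(3) s unfolding is_interval_1 by blast
  then show ?thesis using D_at_scale * by blast
qed

lemma translate_in: "v \<in> D_at Q p \<Longrightarrow> translate Q p v \<in> topspace X"
  using max_motion_in[of p 1 v] by (simp add: D_at_iff translate_def)

lemma D_at_motion:
  assumes "v \<in> D_at Q p"
  shows "motion Q v {0..1} (\<lambda>t. translate Q p (t *\<^sub>R v))"
proof -
  have *: "v \<in> V" "p \<in> topspace X" "1 \<in> max_interval Q v p" using assms D_at_iff by auto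
  have m: "motion Q v (max_interval Q v p) (max_motion Q v p)"
    using max_motion_unique_exists(1)[OF *(2)] unfolding motion_from_def by blast
  have "{0..1} \<subseteq> max_interval Q v p"
  proof
    fix t :: real assume "t \<in> {0..1}"
    then show "t \<in> max_interval Q v p"
      using motion_interval[OF m] max_zero[OF *(2)] *(3) unfolding is_interval_1 by (meson atLeastAtMost_iff)
  qed
  then show ?thesis
    using translate_scale[OF *(2)] by (intro motion_cong[OF motion_subset[OF m]]) (auto simp: is_interval_cc)
qed

text \<open>The straight segment between the coordinates stays in the convex image, and its preimage
  is a motion.\<close>

lemma flat_chart_segment:
  assumes U: "flat_chart Q U f" and x: "x \<in> U" and y: "y \<in> U"
  shows "f y - f x \<in> D_at Q x" "translate Q x (f y - f x) = y"
proof -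
  let ?g = "\<lambda>t. inv_into U f (f x + t *\<^sub>R (f y - f x))"
  have im: "f x + t *\<^sub>R (f y - f x) \<in> f ` U" if "t \<in> {0..1}" for t
    using convexD_alt[OF flat_chart_convex[OF U], of "f x" "f y" t] x y that by (auto simp: algebra_simps)
  have g: "?g t \<in> U" "f (?g t) = f x + t *\<^sub>R (f y - f x)" if "t \<in> {0..1}" for t
    using inv_into_into[OF im[OF that]] f_inv_into_f[OF im[OF that]] by auto
  have m: "motion Q (f y - f x) {0..1} ?g"
  proof (rule motionI)
    fix a :: real assume a: "a \<in> {0..1}"
    have "?g t \<in> U \<and> f (?g t) = f (?g a) + (t - a) *\<^sub>R (f y - f x)" if "t \<in> {0..1}" for t
      using g[OF that] g(2)[OF a] by (simp add: algebra_simps)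
    then show "\<exists>W h e. flat_chart Q W h \<and> e > 0 \<and> (\<forall>t\<in>{0..1}. \<bar>t - a\<bar> < e \<longrightarrow>
        ?g t \<in> W \<and> h (?g t) = h (?g a) + (t - a) *\<^sub>R (f y - f x))"
      using U by (intro exI[of _ U] exI[of _ f] exI[of _ 1]) auto
  qed (simp add: is_interval_cc)
  have inv: "inv_into U f (f z) = z" if "z \<in> U" for z using flat_chart_inj[OF U] that by simp
  have "motion_from Q (f y - f x) x {0..1} ?g" using m inv[OF x] by (simp add: motion_from_def)
  from max_motion_unique_exists(2)[OF flat_chart_in[OF U x] this, of 1]
  have "1 \<in> max_interval Q (f y - f x) x" "max_motion Q (f y - f x) x 1 = y" using inv[OF y] by auto
  then show "f y - f x \<in> D_at Q x" "translate Q x (f y - f x) = y"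
    using flat_chart_in[OF U x] flat_chart_model[OF U] x y subspace_diff[OF V_sub, of "f y" "f x"]
    by (auto simp: D_at_iff translate_def)
qed

text \<open>In general a motion may leave \<open>U\<close> where the image lacks a boundary point.
  Compactness of the image inside the ball excludes this: the corresponding part \<open>C\<close> of
  \<open>U\<close> is compact, hence closed in the Hausdorff space, so the times spent in
  \<open>C\<close> with the expected coordinates form an open and closed set.\<close>

lemma flat_chart_stay:
  assumes U: "flat_chart Q U f" and K: "compact (f ` U \<inter> cball c r)"
    and x: "x \<in> U" "dist c (f x) < r" and b: "b \<in> D_at Q x" "dist c (f x + b) < r"
  shows "translate Q x b \<in> U" "f (translate Q x b) = f x + b"
proof -
  let ?g = "\<lambda>t. translate Q x (t *\<^sub>R b)"
  have m: "motion Q b {0..1} ?g" by (rule D_at_motion[OF b(1)])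
  have ball: "dist c (f x + t *\<^sub>R b) < r" if "t \<in> {0..1}" for t
    using convexD_alt[OF convex_ball, of "f x" c r "f x + b" t] x(2) b(2) that by (simp add: algebra_simps)
  define C where Ceq: "C = {z \<in> U. f z \<in> cball c r}"
  have "compactin X C"
  proof -
    obtain h where h: "homeomorphic_maps (subtopology X U) (top_of_set (f ` U)) f h"
      using flat_chart_homeo[OF U] unfolding homeomorphic_map_maps by blast
    have hc: "continuous_map (top_of_set (f ` U)) (subtopology X U) h" "\<And>z. z \<in> U \<Longrightarrow> h (f z) = z"
      using h flat_chart_topspace[OF U] unfolding homeomorphic_maps_def by auto
    have "continuous_map (top_of_set (f ` U)) X h" using hc(1) by (simp add: continuous_map_in_subtopology)
    moreover have "compactin (top_of_set (f ` U)) (f ` U \<inter> cball c r)"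
      using K by (simp add: compactin_subtopology)
    ultimately have "compactin X (h ` (f ` U \<inter> cball c r))" by (rule image_compactin[rotated])
    moreover have "h ` (f ` U \<inter> cball c r) = C"
      unfolding Ceq using hc(2) by force
    ultimately show ?thesis by simp
  qed
  then have Ccl: "closedin X C" using X_haus compactin_imp_closedin by blast
  define P where "P t \<longleftrightarrow> ?g t \<in> C \<and> f (?g t) = f x + t *\<^sub>R b" for t
  have gcont: "continuous_map (top_of_set {0..1}) X ?g" using m by (simp add: motion_def)
  have "P 1"
  proof (rule connected_induction_simple[of "{0..1::real}" 0 1])
    show "P 0" unfolding P_def using x flat_chart_in[OF U] translate_zero by (simp add: Ceq)
    fix a :: real assume a: "a \<in> {0..1}"
    show "\<exists>T. openin (top_of_set {0..1}) T \<and> a \<in> T \<and> (\<forall>s\<in>T. \<forall>t\<in>T. P s \<longrightarrow> P t)"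
    proof (cases "?g a \<in> C")
      case True
      then have aU: "?g a \<in> U" by (simp add: Ceq)
      obtain e where e: "e > 0" "\<And>t. t \<in> {0..1} \<Longrightarrow> \<bar>t - a\<bar> < e \<Longrightarrow>
          ?g t \<in> U \<and> f (?g t) = f (?g a) + (t - a) *\<^sub>R b"
        using motion_chart_near[OF m a U aU] by blast
      have PP: "P t" if st: "s \<in> {0..1} \<inter> ball a e" "t \<in> {0..1} \<inter> ball a e" and P: "P s" for s t
      proof -
        have "?g s \<in> U" "f (?g s) = f (?g a) + (s - a) *\<^sub>R b" "?g t \<in> U" "f (?g t) = f (?g a) + (t - a) *\<^sub>R b"
          using e(2)[of s] e(2)[of t] st by (auto simp: dist_real_def abs_minus_commute)
        moreover from this P have "f (?g t) = f x + t *\<^sub>R b" unfolding P_def affine_shift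
          by (simp add: diff_eq_eq)
        moreover have "dist c (f x + t *\<^sub>R b) < r" using ball st by blast
        ultimately show ?thesis unfolding P_def Ceq by auto
      qed
      show ?thesis
      proof (intro exI conjI ballI impI)
        show "openin (top_of_set {0..1}) ({0..1} \<inter> ball a e)" by (rule openin_open_Int) simp
        show "a \<in> {0..1} \<inter> ball a e" using a e(1) by simp
      qed (rule PP)
    next
      case False
      have "openin (top_of_set {0..1}) {t \<in> topspace (top_of_set {0..1}). ?g t \<in> topspace X - C}"
        using gcont Ccl unfolding continuous_map by blast
      moreover have "a \<in> {t \<in> topspace (top_of_set {0..1}). ?g t \<in> topspace X - C}"
        using a False motion_in[OF m a] by simp
      ultimately show ?thesis unfolding P_def by blast
    qed
  qed auto
  then show "translate Q x b \<in> U" "f (translate Q x b) = f x + b" unfolding P_def Ceq by auto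
qed

text \<open>By \<open>flat_chart_stay\<close>, near 0 the set \<open>D_at Q p\<close> is the chart
  image moved to the origin, and \<open>translate Q p\<close> is the inverse chart. Each clause of
  \<open>good\<close> is read off there.\<close>

lemma good_of_chart:
  assumes U: "flat_chart Q U f" and K: "compact (f ` U \<inter> cball (f p) r)" and p: "p \<in> U" and r: "r > 0"
  shows "good X (D_at Q) (translate Q) p r"
proof -
  let ?D = "D_at Q" let ?t = "translate Q"
  have st: "?t p a \<in> U" "f (?t p a) = f p + a" if "a \<in> ?D p" "norm a < r" for a
    using flat_chart_stay[OF U K p _ that(1)] that(2) r by (auto simp: dist_norm)
  have mem: "a \<in> ?D p" "?t p a = y" if "y \<in> U" "f y = f p + a" for a y
    using flat_chart_segment[OF U p that(1)] that(2) by auto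
  have LA: "a + b \<in> ?D p \<and> ?t p (a + b) = ?t (?t p a) b"
    if "a \<in> ?D p" "b \<in> ?D (?t p a)" "norm a < r" "norm (a + b) < r" for a b
  proof -
    note s = st[OF that(1,3)]
    have "?t (?t p a) b \<in> U" "f (?t (?t p a) b) = f p + (a + b)"
      using flat_chart_stay[OF U K s(1) _ that(2)] that s(2) by (auto simp: dist_add_self add.assoc)
    then show ?thesis using mem by blast
  qed
  have LB: "b - a \<in> ?D (?t p a) \<and> ?t (?t p a) (b - a) = ?t p b"
    if "a \<in> ?D p" "b \<in> ?D p" "norm a < r" "norm b < r" for a b
    using flat_chart_segment[OF U st(1)[OF that(1,3)] st(1)[OF that(2,4)]] st(2) that by auto
  have LC: "closed (?D p \<inter> cball 0 r')" if "r' < r" for r'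
  proof -
    have "?D p \<inter> cball 0 r' = (\<lambda>y. - f p + y) ` ((f ` U \<inter> cball (f p) r) \<inter> cball (f p) r')" (is "?L = ?R")
    proof (intro set_eqI iffI)
      fix a assume "a \<in> ?L"
      then have a: "a \<in> ?D p" "norm a \<le> r'" by auto
      then have "f p + a \<in> f ` U" using st[of a] that by (metis image_eqI le_less_trans)
      moreover have "dist (f p) (f p + a) \<le> r'" using a by (simp add: dist_norm)
      ultimately show "a \<in> ?R" using that by (intro image_eqI[of _ _ "f p + a"]) auto
    next
      fix a assume "a \<in> ?R"
      then obtain y where y: "a = - f p + f y" "y \<in> U" "dist (f p) (f y) \<le> r'" by auto
      then have "a \<in> ?D p" using mem[of y a] by auto
      then show "a \<in> ?L" using y by (simp add: dist_norm norm_minus_commute)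
    qed
    moreover have "closed ?R"
      by (rule closed_translation[OF closed_Int[OF compact_imp_closed[OF K] closed_cball]])
    ultimately show ?thesis by simp
  qed
  have LT1: "continuous_map (top_of_set (?D p \<inter> ball 0 r)) X (?t p)"
  proof (rule continuous_map_locally)
    show "?t p a \<in> topspace X" if "a \<in> topspace (top_of_set (?D p \<inter> ball 0 r))" for a
      using translate_in that by auto
    fix a W assume "a \<in> topspace (top_of_set (?D p \<inter> ball 0 r))" and W: "openin X W" "?t p a \<in> W"
    then have a: "a \<in> ?D p" "norm a < r" by auto
    obtain e where e: "e > 0" "\<forall>x\<in>U. dist (f (?t p a)) (f x) < e \<longrightarrow> x \<in> W"
      using flat_chart_ball[OF U W(1) st(1)[OF a] W(2)] by blast
    have "?t p b \<in> W" if "b \<in> ?D p" "norm b < r" "dist a b < e" for b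
      using e(2) st[OF that(1,2)] st(2)[OF a] that(3) by (auto simp: dist_norm)
    then have "?t p ` (?D p \<inter> ball 0 r \<inter> ball a e) \<subseteq> W" by auto
    moreover have "openin (top_of_set (?D p \<inter> ball 0 r)) (?D p \<inter> ball 0 r \<inter> ball a e)" by (rule openin_open_Int) simp
    ultimately show "\<exists>S. openin (top_of_set (?D p \<inter> ball 0 r)) S \<and> a \<in> S \<and> ?t p ` S \<subseteq> W"
      using a e(1) by (intro exI[of _ "?D p \<inter> ball 0 r \<inter> ball a e"]) auto
  qed
  have LT2: "open_map (top_of_set (?D p \<inter> ball 0 r)) X (?t p)"
    unfolding open_map_def
  proof (intro allI impI)
    fix S assume "openin (top_of_set (?D p \<inter> ball 0 r)) S"
    then obtain T where T: "open T" "S = ?D p \<inter> ball 0 r \<inter> T" by (auto simp: openin_open)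
    have "?t p ` S = {x \<in> U. f x \<in> ((\<lambda>y. f p + y) ` (ball 0 r \<inter> T))}"
    proof (intro set_eqI iffI)
      fix x assume "x \<in> ?t p ` S"
      then show "x \<in> {x \<in> U. f x \<in> ((\<lambda>y. f p + y) ` (ball 0 r \<inter> T))}" using st T by auto
    next
      fix x assume "x \<in> {x \<in> U. f x \<in> ((\<lambda>y. f p + y) ` (ball 0 r \<inter> T))}"
      then obtain a where "x \<in> U" "f x = f p + a" "norm a < r" "a \<in> T" by auto
      then show "x \<in> ?t p ` S" using mem[of x a] T by (intro image_eqI[of _ _ a]) auto
    qed
    moreover have "open ((\<lambda>y. f p + y) ` (ball 0 r \<inter> T))" using T by (intro open_translation open_Int open_ball)
    ultimately show "openin X (?t p ` S)" using flat_chart_open_vimage[OF U] by simp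
  qed
  have LT3: "inj_on (?t p) (?D p \<inter> ball 0 r)"
    by (rule inj_onI) (use st(2) in \<open>metis (no_types) IntE add_left_cancel dist_0_norm mem_ball\<close>)
  show ?thesis unfolding good_def using r LA LB LC LT1 LT2 LT3 by blast
qed

end

locale locally_compact_parallel = convex_parallel +
  assumes compact_charts: "p \<in> topspace X \<Longrightarrow>
    \<exists>U f r. flat_chart Q U f \<and> p \<in> U \<and> r > 0 \<and> compact (f ` U \<inter> cball (f p) r)"

sublocale locally_compact_parallel \<subseteq> flat_action X "D_at Q" "translate Q"
proof
  show "v \<in> D_at Q p \<Longrightarrow> p \<in> topspace X" for v p by (simp add: D_at_iff)
  show "\<exists>r. good X (D_at Q) (translate Q) p r" if "p \<in> topspace X" for p
    using compact_charts[OF that] good_of_chart by blast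
qed (simp_all add: zero_D translate_zero translate_in D_at_shrink D_at_line)

section \<open>Completeness and compactness\<close>

text \<open>The source of new charts, applied both to \<open>translate Q p\<close> and to the
  projection onto the torus.\<close>

lemma open_map_inverse_homeomorphic:
  assumes cont: "continuous_map (top_of_set S) Y e" and opn: "open_map (top_of_set S) Y e"
    and G: "openin (top_of_set S) G" "inj_on e G"
  shows "openin Y (e ` G)" "homeomorphic_map (subtopology Y (e ` G)) (top_of_set G) (inv_into G e)"
proof -
  have GS: "G \<subseteq> S" using G(1) openin_imp_subset by blast
  show op: "openin Y (e ` G)" using opn G(1) by (simp add: open_map_def)
  have "homeomorphic_map (top_of_set G) (subtopology Y (e ` G)) e"
  proof (rule bijective_open_imp_homeomorphic_map)
    show "continuous_map (top_of_set G) (subtopology Y (e ` G)) e"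
      using continuous_map_from_subtopology_mono[OF cont GS] by (simp add: continuous_map_in_subtopology)
    show "open_map (top_of_set G) (subtopology Y (e ` G)) e"
      unfolding open_map_def
    proof (intro allI impI)
      fix T assume T: "openin (top_of_set G) T"
      then have "openin (top_of_set S) T" using G(1) openin_trans by blast
      then have "openin Y (e ` T)" using opn by (simp add: open_map_def)
      moreover have "e ` T \<subseteq> e ` G" using openin_imp_subset[OF T] by blast
      ultimately show "openin (subtopology Y (e ` G)) (e ` T)"
        by (metis inf.absorb_iff1 openin_subtopology)
    qed
    show "e ` topspace (top_of_set G) = topspace (subtopology Y (e ` G))"
      using openin_subset[OF op] by auto
    show "inj_on e (topspace (top_of_set G))" using G(2) by simp
  qed
  then obtain g where g: "homeomorphic_maps (top_of_set G) (subtopology Y (e ` G)) e g"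
    unfolding homeomorphic_map_maps by blast
  then have "homeomorphic_map (subtopology Y (e ` G)) (top_of_set G) g"
    using homeomorphic_maps_sym homeomorphic_maps_map by blast
  moreover have "g z = inv_into G e z" if "z \<in> topspace (subtopology Y (e ` G))" for z
    using g that G(2) unfolding homeomorphic_maps_def by auto
  ultimately show "homeomorphic_map (subtopology Y (e ` G)) (top_of_set G) (inv_into G e)"
    by (rule homeomorphic_map_eq)
qed

section \<open>Compact chart neighbourhoods and small entourages\<close>

context convex_parallel begin

text \<open>A compact Hausdorff space is regular, so \<open>U\<close> contains a closed, hence
  compact neighbourhood of \<open>p\<close>. Its chart image is compact and comprises the whole
  image of \<open>U\<close> near \<open>f p\<close>.\<close>

lemma compact_space_charts:
  assumes c: "compact_space X" and p: "p \<in> topspace X"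
  shows "\<exists>U f r. flat_chart Q U f \<and> p \<in> U \<and> r > 0 \<and> compact (f ` U \<inter> cball (f p) r)"
proof -
  obtain U f where U: "flat_chart Q U f" "p \<in> U" using ex_flat_chart p by blast
  have "regular_space X" using compact_Hausdorff_imp_regular_space c X_haus by blast
  moreover have "closedin X (topspace X - U)" "p \<in> topspace X - (topspace X - U)"
    using flat_chart_openin[OF U(1)] U(2) p by auto
  ultimately obtain W W' where W: "openin X W" "openin X W'" "p \<in> W" "topspace X - U \<subseteq> W'" "disjnt W W'"
    unfolding regular_space_def by meson
  define C where "C = topspace X - W'"
  have CU: "C \<subseteq> U" "W \<subseteq> C"
    unfolding C_def using W openin_subset[OF W(1)] by (auto simp: disjnt_iff)
  have "closedin X C" unfolding C_def using W(2) by blast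
  then have "compactin X C" using c closedin_compact_space by blast
  then have "compactin (subtopology X U) C" using CU by (simp add: compactin_subtopology)
  then have "compactin (top_of_set (f ` U)) (f ` C)"
    using homeomorphic_imp_continuous_map[OF flat_chart_homeo[OF U(1)]] image_compactin by blast
  then have fC: "compact (f ` C)" by (simp add: compactin_subtopology)
  obtain e where e: "e > 0" "\<forall>x\<in>U. dist (f p) (f x) < e \<longrightarrow> x \<in> W"
    using flat_chart_ball[OF U(1) W(1) U(2) W(3)] by blast
  have "f ` U \<inter> cball (f p) (e / 2) = f ` C \<inter> cball (f p) (e / 2)"
  proof -
    have "x \<in> C" if "x \<in> U" "dist (f p) (f x) \<le> e / 2" for x
    proof -
      have "dist (f p) (f x) < e" using that(2) e(1) by linarith
      then show ?thesis using e(2) that(1) CU(2) by blast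
    qed
    then show ?thesis using CU(1) by auto
  qed
  then have "compact (f ` U \<inter> cball (f p) (e / 2))" using fC by (simp add: compact_Int_closed)
  then show ?thesis using U e(1) by (intro exI[of _ U] exI[of _ f] exI[of _ "e/2"]) auto
qed

definition small :: "real \<Rightarrow> 'v set" where "small r = V \<inter> ball 0 r"

abbreviation ent where "ent \<equiv> entourage (saturate Q)"

lemma ent_iff: "(x, y) \<in> ent V0 \<longleftrightarrow> (\<exists>U f. flat_chart Q U f \<and> x \<in> U \<and> y \<in> U \<and> f x - f y \<in> V0)"
  by (auto simp: entourage_def flat_chart_def saturate_def)

lemma small_nhd: "r > 0 \<Longrightarrow> small r \<in> zero_nhds V"
  unfolding zero_nhds_def small_def
  by (intro CollectI conjI exI[of _ "V \<inter> ball 0 r"]) (auto simp: openin_open_Int subspace_0[OF V_sub])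

lemma nhd_small: "V0 \<in> zero_nhds V \<Longrightarrow> \<exists>r>0. small r \<subseteq> V0"
proof -
  assume "V0 \<in> zero_nhds V"
  then obtain T where T: "openin (top_of_set V) T" "0 \<in> T" "T \<subseteq> V0" unfolding zero_nhds_def by blast
  then obtain e where "e > 0" "ball 0 e \<inter> V \<subseteq> T" unfolding openin_contains_ball by blast
  then show ?thesis using T(3) by (intro exI[of _ e]) (auto simp: small_def)
qed

lemma ent_mono: "V0 \<subseteq> V1 \<Longrightarrow> ent V0 \<subseteq> ent V1"
  by (auto simp: entourage_def)

lemma ent_smallI:
  assumes "flat_chart Q U f" "x \<in> U" "y \<in> U" "dist (f x) (f y) < r"
  shows "(x, y) \<in> ent (small r)"
proof -
  have "f x - f y \<in> V" using flat_chart_model[OF assms(1)] assms(2,3) subspace_diff[OF V_sub, of "f x" "f y"] by auto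
  then have "f x - f y \<in> small r" using assms(4) by (simp add: small_def dist_norm norm_minus_commute)
  then show ?thesis using assms ent_iff by blast
qed

lemma ent_sym: "(x, y) \<in> ent (small r) \<Longrightarrow> (y, x) \<in> ent (small r)"
proof -
  assume "(x, y) \<in> ent (small r)"
  then obtain U f where "flat_chart Q U f" "x \<in> U" "y \<in> U" "f x - f y \<in> small r" using ent_iff by blast
  then show ?thesis by (intro ent_smallI) (auto simp: small_def dist_norm norm_minus_commute)
qed

lemma ent_refl: "x \<in> topspace X \<Longrightarrow> r > 0 \<Longrightarrow> (x, x) \<in> ent (small r)"
  using ex_flat_chart ent_smallI[of _ _ x x r] by fastforce

end

section \<open>Local consequences of completeness\<close>

locale complete_flat = convex_parallel +
  assumes complete: "complete_parallel Q"
begin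

text \<open>Halving of entourages comes from \<open>fundamental_system\<close>. It is what allows
  closeness to be composed through different charts.\<close>

lemma ent_comp:
  assumes "V0 \<in> zero_nhds V"
  shows "\<exists>r>0. ent (small r) O ent (small r) \<subseteq> ent V0"
proof -
  have "fundamental_system (topspace X) (ent ` zero_nhds V)"
    using complete by (simp add: complete_parallel_def chartwise_complete_def saturate_def)
  then have "\<forall>E\<in>ent ` zero_nhds V. \<exists>F\<in>ent ` zero_nhds V. F O F \<subseteq> E"
    unfolding fundamental_system_def by (elim conjE)
  then obtain V1 where V1: "V1 \<in> zero_nhds V" "ent V1 O ent V1 \<subseteq> ent V0"
    using assms by blast
  then obtain r where "r > 0" "small r \<subseteq> V1" using nhd_small by blast
  moreover from this have "ent (small r) O ent (small r) \<subseteq> ent V1 O ent V1" using ent_mono by blast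
  ultimately show ?thesis using V1(2) by blast
qed

lemma Cauchy_limit:
  assumes "F \<noteq> bot" "eventually (\<lambda>x. x \<in> topspace X) F"
    and C: "\<And>V0. V0 \<in> zero_nhds V \<Longrightarrow> \<exists>M. eventually (\<lambda>x. x \<in> M) F \<and> M \<times> M \<subseteq> ent V0"
  shows "\<exists>x\<in>topspace X. F \<le> nhdsin X x"
proof -
  have "F \<le> principal (topspace X)" using assms(2) by (simp add: le_principal)
  then show ?thesis
    using complete assms(1) C unfolding complete_parallel_def chartwise_complete_def
    by (simp add: saturate_def)
qed

lemma le_nhdsinD:
  assumes "F \<le> nhdsin X x" "openin X W" "x \<in> W"
  shows "eventually (\<lambda>y. y \<in> W) F"
proof -
  have "eventually (\<lambda>y. y \<in> W) (nhdsin X x)" using assms by (auto simp: eventually_nhdsin)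
  then show ?thesis using assms(1) by (rule filter_leD[rotated])
qed

text \<open>If points \<open>q n\<close> outside \<open>W\<close> were uniformly closer and closer
  to \<open>p\<close>, they would generate a Cauchy filter together with \<open>p\<close>. Its limit
  is \<open>p\<close>, so the \<open>q n\<close> would enter \<open>W\<close>.\<close>

lemma ent_nhd:
  assumes W: "openin X W" and p: "p \<in> W"
  shows "\<exists>r>0. \<forall>q. (p, q) \<in> ent (small r) \<longrightarrow> q \<in> W"
proof (rule ccontr)
  assume "\<not> ?thesis"
  then have "\<forall>n::nat. \<exists>q. (p, q) \<in> ent (small (1 / (real n + 1))) \<and> q \<notin> W" by auto
  then obtain q where q: "\<And>n::nat. (p, q n) \<in> ent (small (1 / (real n + 1)))" "\<And>n. q n \<notin> W" by metis
  have pX: "p \<in> topspace X" using W p openin_subset by blast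
  have qX: "q n \<in> topspace X" for n using q(1)[of n] ent_iff flat_chart_in by blast
  \<comment> \<open>Joining the principal filter of \<open>p\<close> forces the limit to be
    \<open>p\<close>, since every neighbourhood of the limit must then contain
    \<open>p\<close>.\<close>
  define F where "F = sup (principal {p}) (filtermap q sequentially)"
  have evF: "eventually P F \<longleftrightarrow> P p \<and> eventually (\<lambda>n. P (q n)) sequentially" for P
    by (auto simp: F_def eventually_sup eventually_principal eventually_filtermap)
  have "\<exists>x\<in>topspace X. F \<le> nhdsin X x"
  proof (rule Cauchy_limit)
    show "F \<noteq> bot" using evF[of "\<lambda>_. False"] by (auto simp: trivial_limit_def)
    show "eventually (\<lambda>x. x \<in> topspace X) F" using evF pX qX by simp
    fix V0 assume "V0 \<in> zero_nhds V"
    then obtain r where r: "r > 0" "ent (small r) O ent (small r) \<subseteq> ent V0" using ent_comp by blast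
    obtain N :: nat where N: "1 / (real N + 1) < r"
      using reals_Archimedean[OF r(1)] by (auto simp: inverse_eq_divide add.commute)
    let ?M = "insert p (q ` {N..})"
    have pM: "(p, y) \<in> ent (small r)" if "y \<in> ?M" for y
    proof (cases "y = p")
      case True then show ?thesis using ent_refl pX r(1) by simp
    next
      case False
      then obtain n where n: "n \<ge> N" "y = q n" using \<open>y \<in> ?M\<close> by auto
      have "1 / (real n + 1) \<le> 1 / (real N + 1)" using n(1) by (simp add: frac_le)
      then have "small (1 / (real n + 1)) \<subseteq> small r" using N by (auto simp: small_def)
      then show ?thesis using q(1)[of n] n(2) ent_mono by blast
    qed
    then have "?M \<times> ?M \<subseteq> ent V0" using ent_sym[OF pM] r(2) by blast
    moreover have "eventually (\<lambda>x. x \<in> ?M) F"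
      unfolding evF by (auto simp: eventually_sequentially)
    ultimately show "\<exists>M. eventually (\<lambda>x. x \<in> M) F \<and> M \<times> M \<subseteq> ent V0" by blast
  qed
  then obtain x where x: "x \<in> topspace X" "F \<le> nhdsin X x" by blast
  have "x = p"
  proof (rule ccontr)
    assume "x \<noteq> p"
    then obtain A B where AB: "openin X A" "openin X B" "x \<in> A" "p \<in> B" "disjnt A B"
      using X_haus x(1) pX unfolding Hausdorff_space_def by meson
    have "p \<in> A" using le_nhdsinD[OF x(2) AB(1,3)] unfolding evF by blast
    then show False using AB by (auto simp: disjnt_iff)
  qed
  then have "eventually (\<lambda>n. q n \<in> W) sequentially" using le_nhdsinD[OF x(2) W] p unfolding evF by blast
  then show False using q(2) by simp
qed

text \<open>A convergent sequence of coordinates comes from a Cauchy sequence in \<open>Q\<close>.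
  Its limit \<open>y\<close> might lie outside \<open>U\<close>, but the radius is so small that two
  uniform steps, from \<open>p\<close> to \<open>q n\<close> and on to \<open>y\<close>, cannot
  leave \<open>U\<close>.\<close>

lemma complete_charts:
  assumes p: "p \<in> topspace X"
  shows "\<exists>U f r. flat_chart Q U f \<and> p \<in> U \<and> r > 0 \<and> compact (f ` U \<inter> cball (f p) r)"
proof -
  obtain U f where U: "flat_chart Q U f" "p \<in> U" using ex_flat_chart p by blast
  obtain r where r: "r > 0" "\<And>q. (p, q) \<in> ent (small r) \<Longrightarrow> q \<in> U"
    using ent_nhd[OF flat_chart_openin[OF U(1)] U(2)] by blast
  obtain r1 where r1: "r1 > 0" "ent (small r1) O ent (small r1) \<subseteq> ent (small r)"
    using ent_comp[OF small_nhd[OF r(1)]] by blast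
  have "closed (f ` U \<inter> cball (f p) (r1 / 2))"
    unfolding closed_sequential_limits
  proof (intro allI impI)
    fix x l assume "(\<forall>n. x n \<in> f ` U \<inter> cball (f p) (r1 / 2)) \<and> x \<longlonglongrightarrow> l"
    then have x: "\<And>n. x n \<in> f ` U" "\<And>n. dist (f p) (x n) \<le> r1 / 2" "x \<longlonglongrightarrow> l" by auto
    from x(1) have "\<forall>n. \<exists>q. q \<in> U \<and> f q = x n" by (metis imageE)
    then obtain q where q: "\<And>n. q n \<in> U" "\<And>n. f (q n) = x n" by metis
    have "\<exists>y\<in>topspace X. filtermap q sequentially \<le> nhdsin X y"
    proof (rule Cauchy_limit)
      show "filtermap q sequentially \<noteq> bot" by (simp add: filtermap_bot_iff)
      show "eventually (\<lambda>x. x \<in> topspace X) (filtermap q sequentially)"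
        using q(1) flat_chart_in[OF U(1)] by (simp add: eventually_filtermap)
      fix V0 assume "V0 \<in> zero_nhds V"
      then obtain e where e: "e > 0" "small e \<subseteq> V0" using nhd_small by blast
      have "Cauchy x" using x(3) by (rule LIMSEQ_imp_Cauchy)
      then obtain N where N: "\<forall>m\<ge>N. \<forall>n\<ge>N. dist (x m) (x n) < e" using e(1) unfolding Cauchy_def by blast
      have "q ` {N..} \<times> q ` {N..} \<subseteq> ent (small e)"
        using N q by (auto intro!: ent_smallI[OF U(1)])
      then have "q ` {N..} \<times> q ` {N..} \<subseteq> ent V0" using ent_mono[OF e(2)] by blast
      moreover have "eventually (\<lambda>x. x \<in> q ` {N..}) (filtermap q sequentially)"
        by (auto simp: eventually_filtermap eventually_sequentially)
      ultimately show "\<exists>M. eventually (\<lambda>x. x \<in> M) (filtermap q sequentially) \<and> M \<times> M \<subseteq> ent V0" by blast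
    qed
    then obtain y where y: "y \<in> topspace X" "filtermap q sequentially \<le> nhdsin X y" by blast
    obtain U' f' where U': "flat_chart Q U' f'" "y \<in> U'" using ex_flat_chart y(1) by blast
    have near: "eventually (\<lambda>n. q n \<in> {z \<in> U. f z \<in> ball (f y) e}) sequentially"
      if U: "flat_chart Q U f" "y \<in> U" and e: "e > 0" for U f e
      using le_nhdsinD[OF y(2) flat_chart_open_vimage[OF U(1) open_ball, of "f y" e]] U(2) e by (simp add: eventually_filtermap)
    obtain n where n: "q n \<in> U'" "dist (f' y) (f' (q n)) < r1"
      using eventually_happens'[OF sequentially_bot near[OF U' r1(1)]] by auto
    have "(p, q n) \<in> ent (small r1)"
      using x(2)[of n] q r1(1) by (intro ent_smallI[OF U(1) U(2)]) auto
    moreover have "(q n, y) \<in> ent (small r1)"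
      using n U'(2) by (intro ent_smallI[OF U'(1)]) (auto simp: dist_commute)
    ultimately have yU: "y \<in> U" using r1(2) r(2) by blast
    have "x \<longlonglongrightarrow> f y"
    proof (rule tendstoI)
      fix e :: real assume "e > 0"
      from near[OF U(1) yU this] show "eventually (\<lambda>n. dist (x n) (f y) < e) sequentially"
        by eventually_elim (simp add: q dist_commute)
    qed
    then have "l = f y" using x(3) LIMSEQ_unique by blast
    moreover have "l \<in> cball (f p) (r1 / 2)"
      by (rule closed_sequentially[OF closed_cball _ x(3)]) (use x(2) in simp)
    ultimately show "l \<in> f ` U \<inter> cball (f p) (r1 / 2)" using yU by blast
  qed
  then have "compact (f ` U \<inter> cball (f p) (r1 / 2))"
    by (simp add: compact_eq_bounded_closed bounded_Int)
  then show ?thesis using U r1(1) by (intro exI[of _ U] exI[of _ f] exI[of _ "r1/2"]) auto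
qed

end

sublocale complete_flat \<subseteq> locally_compact_parallel
  by unfold_locales (rule complete_charts)

section \<open>Charts from tubes, and the existence of end points\<close>

context locally_compact_parallel begin

text \<open>The vector leading from \<open>p\<close> to a point serves as its coordinate. For
  \<open>y\<close> near \<open>x\<close>, the coordinate differences in this and in a given chart
  are both short vectors leading from \<open>x\<close> to \<open>y\<close>, and such a vector is
  unique.\<close>

lemma flat_chart_of_convex:
  assumes op: "openin (top_of_set (D_at Q p)) G" and G: "convex G" "inj_on (translate Q p) G"
  shows "flat_chart Q (translate Q p ` G) (inv_into G (translate Q p))"
proof -
  let ?e = "translate Q p" let ?f = "inv_into G (translate Q p)" let ?U = "translate Q p ` G"
  have GD: "G \<subseteq> D_at Q p" using op openin_imp_subset by blast
  have U: "openin X ?U" and homeo: "homeomorphic_map (subtopology X ?U) (top_of_set G) ?f"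
    using open_map_inverse_homeomorphic[OF act_continuous act_open op G(2)] by auto
  have inv: "?f (?e x) = x" if "x \<in> G" for x using G(2) that by simp
  have fU: "?f ` ?U = G" using inv by force
  have "locally_constant_on X (?U \<inter> cdom Q \<alpha>) (\<lambda>x. ?f x - chart Q \<alpha> x)" if \<alpha>: "\<alpha> \<in> index Q" for \<alpha>
    unfolding locally_constant_on_def
  proof (intro ballI)
    fix x assume x: "x \<in> ?U \<inter> cdom Q \<alpha>"
    then obtain a where a: "a \<in> G" "x = ?e a" by blast
    obtain r where r: "r > 0" "gd (?e a) r"
      "\<And>c'. c' \<in> D_at Q p \<Longrightarrow> norm (c' - a) < r \<Longrightarrow> c' - a \<in> D_at Q (?e a)"
      "\<And>c'. c' \<in> D_at Q p \<Longrightarrow> norm (c' - a) < r \<Longrightarrow> translate Q (?e a) (c' - a) = ?e c'"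
      by (rule nearby[of a p]) (use a GD in blast)+
    let ?W1 = "?e ` (G \<inter> ball a r)" let ?W2 = "{y \<in> cdom Q \<alpha>. chart Q \<alpha> y \<in> ball (chart Q \<alpha> x) r}"
    have "openin (top_of_set (D_at Q p)) (G \<inter> ball a r)"
      using op openin_open_Int[OF open_ball] by (metis inf_assoc openin_Int_open open_ball)
    then have W1: "openin X ?W1" using act_open[of p] by (simp add: open_map_def)
    have W2: "openin X ?W2" using flat_chart_open_vimage[OF chart_flat[OF \<alpha>] open_ball] .
    have "?f y - chart Q \<alpha> y = ?f x - chart Q \<alpha> x" if y: "y \<in> ?W1 \<inter> ?W2" for y
    proof -
      obtain b where b: "b \<in> G" "dist a b < r" "y = ?e b" using y by auto
      have 1: "b - a \<in> D_at Q x" "translate Q x (b - a) = y" "norm (b - a) < r"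
        using r(3,4)[of b] b a(2) GD by (auto simp: dist_norm norm_minus_commute)
      have 2: "chart Q \<alpha> y - chart Q \<alpha> x \<in> D_at Q x" "translate Q x (chart Q \<alpha> y - chart Q \<alpha> x) = y"
         "norm (chart Q \<alpha> y - chart Q \<alpha> x) < r"
        using flat_chart_segment[OF chart_flat[OF \<alpha>], of x y] x y by (auto simp: dist_norm norm_minus_commute)
      have "b - a = chart Q \<alpha> y - chart Q \<alpha> x"
        by (rule inj_onD[OF gd_inj[OF r(2)]]) (use 1 2 a(2) in auto)
      then show ?thesis using inv b a by (simp add: algebra_simps)
    qed
    moreover have "openin (subtopology X (?U \<inter> cdom Q \<alpha>)) (?W1 \<inter> ?W2)"
      unfolding openin_subtopology using W1 W2 by (intro exI[of _ "?W1 \<inter> ?W2"]) auto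
    moreover have "x \<in> ?W1 \<inter> ?W2" using a x r(1) by auto
    ultimately show "\<exists>W. openin (subtopology X (?U \<inter> cdom Q \<alpha>)) W \<and> x \<in> W \<and>
        (\<forall>y\<in>W. ?f y - chart Q \<alpha> y = ?f x - chart Q \<alpha> x)" by blast
  qed
  moreover have "G \<subseteq> V" using GD D_at_iff by blast
  ultimately show ?thesis
    unfolding flat_chart_iff is_chart_def fU using U homeo G(1) by simp
qed

text \<open>A motion that passes twice through a point can run through its loop arbitrarily often,
  hence beyond time 1.\<close>

lemma extend_of_loop:
  assumes v: "\<And>s. 0 \<le> s \<Longrightarrow> s < 1 \<Longrightarrow> s *\<^sub>R v \<in> D_at Q p"
    and st: "0 \<le> s" "s < t" "t < 1" and eq: "translate Q p (s *\<^sub>R v) = translate Q p (t *\<^sub>R v)"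
  shows "v \<in> D_at Q p"
proof -
  let ?q = "translate Q p (s *\<^sub>R v)" let ?h = "(t - s) *\<^sub>R v"
  have sD: "s *\<^sub>R v \<in> D_at Q p" using v st by auto
  have h: "?h \<in> D_at Q ?q" "translate Q ?q ?h = ?q"
    using line_iff[OF sD, of "t - s"] line_eq[OF sD, of "t - s"] v[of t] st eq by auto
  have n: "real n *\<^sub>R ?h \<in> D_at Q ?q \<and> translate Q ?q (real n *\<^sub>R ?h) = ?q" for n
  proof (induction n)
    case 0 then show ?case using zero_in act_zero act_in[OF sD] by simp
  next
    case (Suc n)
    then show ?case
      using line_iff[of "real n" ?h ?q 1] line_eq[of "real n" ?h ?q 1] h by (simp add: add.commute)
  qed
  obtain n :: nat where "1 - s < real n * (t - s)" using reals_Archimedean3[of "t - s"] st by auto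
  then have k: "1 - s \<le> real n * (t - s)" "real n * (t - s) > 0" using st by auto
  then have "((1 - s) / (real n * (t - s))) *\<^sub>R real n *\<^sub>R ?h \<in> D_at Q ?q"
    using st by (intro shrink[OF conjunct1[OF n[of n]]]) (auto simp: divide_le_eq)
  moreover have "((1 - s) / (real n * (t - s))) *\<^sub>R real n *\<^sub>R ?h = (1 - s) *\<^sub>R v"
    using k(2) by (cases "n = 0") auto
  ultimately have "(1 - s) *\<^sub>R v \<in> D_at Q ?q" by (simp only:)
  then show ?thesis using line_iff[OF sD, of "1 - s"] by simp
qed

text \<open>Otherwise no point is a cluster point of the motion at time 1, so each has a
  neighbourhood that the motion eventually avoids. Finitely many of these cover the space and leave
  no place for the motion.\<close>

lemma extend_of_compact:
  assumes c: "compact_space X" and v: "\<And>s. 0 \<le> s \<Longrightarrow> s < 1 \<Longrightarrow> s *\<^sub>R v \<in> D_at Q p"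
  shows "v \<in> D_at Q p"
proof (rule ccontr)
  let ?g = "\<lambda>s. translate Q p (s *\<^sub>R v)"
  assume n: "v \<notin> D_at Q p"
  have "\<exists>W s0. openin X W \<and> q \<in> W \<and> s0 < 1 \<and> (\<forall>s. s0 \<le> s \<longrightarrow> 0 \<le> s \<longrightarrow> s < 1 \<longrightarrow> ?g s \<notin> W)"
    if q: "q \<in> topspace X" for q
    using cluster_extend[of v p q, OF v q] n by blast
  then obtain W s0 where W: "\<And>q. q \<in> topspace X \<Longrightarrow> openin X (W q)" "\<And>q. q \<in> topspace X \<Longrightarrow> q \<in> W q"
     "\<And>q. q \<in> topspace X \<Longrightarrow> s0 q < 1"
     "\<And>q s. q \<in> topspace X \<Longrightarrow> s0 q \<le> s \<Longrightarrow> 0 \<le> s \<Longrightarrow> s < (1::real) \<Longrightarrow> ?g s \<notin> W q" by metis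
  have "(\<forall>U\<in>W ` topspace X. openin X U) \<and> topspace X \<subseteq> \<Union>(W ` topspace X)"
    using W(1,2) by blast
  then have "\<exists>F. finite F \<and> F \<subseteq> W ` topspace X \<and> topspace X \<subseteq> \<Union>F"
    using c unfolding compact_space_alt by blast
  then obtain A where A: "finite A" "A \<subseteq> topspace X" "topspace X \<subseteq> \<Union>(W ` A)"
    by (metis finite_subset_image)
  define s where "s = Max (insert 0 (s0 ` A))"
  have fin: "finite (insert 0 (s0 ` A))" using A by simp
  have s: "0 \<le> s" "\<And>q. q \<in> A \<Longrightarrow> s0 q \<le> s" unfolding s_def using Max_ge[OF fin] by auto
  have "s \<in> insert 0 (s0 ` A)" unfolding s_def by (rule Max_in[OF fin]) simp
  then have "s < 1" using W(3) A(2) by auto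
  then have "?g s \<in> topspace X" using act_in v s(1) by blast
  then obtain q where "q \<in> A" "?g s \<in> W q" using A(3) by blast
  then show False using W(4)[of q s] s \<open>s < 1\<close> A(2) by blast
qed

end

context complete_flat begin

lemma extend_of_complete:
  assumes v: "\<And>s. 0 \<le> s \<Longrightarrow> s < 1 \<Longrightarrow> s *\<^sub>R v \<in> D_at Q p"
  shows "v \<in> D_at Q p"
proof (rule ccontr)
  assume n: "v \<notin> D_at Q p"
  let ?g = "\<lambda>s. translate Q p (s *\<^sub>R v)"
  \<comment> \<open>A self-intersection would already give the end point, so every piece of the
    motion has a tube.\<close>
  have inj: "?g s \<noteq> ?g t" if "0 \<le> s" "s < t" "t < 1" for s t
    using extend_of_loop[OF v that] n by blast
  have pair: "(?g s, ?g t) \<in> ent (small e)" if st: "0 \<le> s" "s < t" "t < 1" and e: "norm ((t - s) *\<^sub>R v) < e" for s t e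
  proof -
    let ?q = "?g s" let ?c = "(t - s) *\<^sub>R v"
    have sD: "s *\<^sub>R v \<in> D_at Q p" and tD: "t *\<^sub>R v \<in> D_at Q p" using v st by auto
    have c: "?c \<in> D_at Q ?q" using line_iff[OF sD, of "t - s"] tD by simp
    have lin: "translate Q ?q (u *\<^sub>R ?c) = ?g (s + u * (t - s))" and le: "s + u * (t - s) < 1" "0 \<le> s + u * (t - s)"
      if u: "u \<in> {0..1}" for u
    proof -
      have "u * (t - s) \<le> 1 * (t - s)" using u st by (intro mult_right_mono) auto
      then have "s + u * (t - s) \<le> s + (t - s)" by (simp only: mult_1_left add_left_mono)
      also have "\<dots> < 1" using st by simp
      finally show 1: "s + u * (t - s) < 1" .
      show 2: "0 \<le> s + u * (t - s)" using u st by simp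
      from 1 2 show "translate Q ?q (u *\<^sub>R ?c) = ?g (s + u * (t - s))"
        using line_eq[OF sD, of "u * (t - s)"] v by simp
    qed
    have "inj_on (\<lambda>u. translate Q ?q (u *\<^sub>R ?c)) {0..1}"
    proof (rule linorder_inj_onI')
      fix i j :: real assume ij: "i \<in> {0..1}" "j \<in> {0..1}" "i < j"
      have "s + i * (t - s) < s + j * (t - s)" using ij(3) st by simp
      then show "translate Q ?q (i *\<^sub>R ?c) \<noteq> translate Q ?q (j *\<^sub>R ?c)"
        unfolding lin[OF ij(1)] lin[OF ij(2)] using le[OF ij(1)] le[OF ij(2)] by (intro inj)
    qed
    then obtain G where G: "openin (top_of_set (D_at Q ?q)) G" "convex G" "0 \<in> G" "?c \<in> G" "inj_on (translate Q ?q) G"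
      using tube[OF X_haus c] by blast
    \<comment> \<open>In this chart the coordinates are the vectors themselves, so the two points
      differ by \<open>?c\<close>.\<close>
    have "(translate Q ?q 0, translate Q ?q ?c) \<in> ent (small e)"
      by (rule ent_smallI[OF flat_chart_of_convex[OF G(1,2,5)]]) (use G e in auto)
    moreover have "translate Q ?q 0 = ?q" using act_zero act_in[OF sD] by simp
    moreover have "translate Q ?q ?c = ?g t" using lin[of 1] by simp
    ultimately show ?thesis by simp
  qed
  have p: "p \<in> topspace X" using v[of 0] D_base by auto
  have "\<exists>q\<in>topspace X. filtermap ?g (at_left 1) \<le> nhdsin X q"
  proof (rule Cauchy_limit)
    show "filtermap ?g (at_left 1) \<noteq> bot" by (simp add: filtermap_bot_iff)
    have "eventually (\<lambda>s::real. s \<in> {0<..<1}) (at_left 1)" by (rule eventually_at_left_real) simp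
    then show "eventually (\<lambda>x. x \<in> topspace X) (filtermap ?g (at_left 1))"
      unfolding eventually_filtermap by eventually_elim (use act_in v in auto)
    fix V0 assume "V0 \<in> zero_nhds V"
    then obtain e where e: "e > 0" "small e \<subseteq> V0" using nhd_small by blast
    have pos: "norm v + 1 > 0" by (simp add: add_nonneg_pos)
    \<comment> \<open>The bound 0 keeps the times nonnegative; the other one makes the length that
      remains after \<open>d\<close> less than \<open>e\<close>.\<close>
    define d where "d = max 0 (1 - e / (norm v + 1))"
    have "(?g s, ?g t) \<in> ent (small e)" if st: "s \<in> {d<..<1}" "t \<in> {d<..<1}" for s t
    proof -
      have *: "(?g s, ?g t) \<in> ent (small e)" if st: "s \<in> {d<..<1}" "t \<in> {d<..<1}" "s < t" for s t
      proof (rule pair)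
        show "0 \<le> s" "s < t" "t < 1" using st unfolding d_def by auto
        have "t - s < e / (norm v + 1)" using st unfolding d_def by auto
        then have "(t - s) * (norm v + 1) < e" using pos by (simp add: pos_less_divide_eq)
        moreover have "norm ((t - s) *\<^sub>R v) \<le> (t - s) * (norm v + 1)" using st(3) by (simp add: mult_left_mono)
        ultimately show "norm ((t - s) *\<^sub>R v) < e" by linarith
      qed
      consider "s < t" | "t < s" | "s = t" by linarith
      then show ?thesis
      proof cases
        case 3
        have "0 \<le> t" "t < 1" using st unfolding d_def by auto
        then show ?thesis using 3 ent_refl act_in v e(1) by simp
      qed (use * st ent_sym in blast)+
    qed
    then have "?g ` {d<..<1} \<times> ?g ` {d<..<1} \<subseteq> ent V0" using ent_mono[OF e(2)] by blast
    moreover have "d < 1" unfolding d_def using e(1) pos by simp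
    then have "eventually (\<lambda>s::real. s \<in> {d<..<1}) (at_left 1)" by (rule eventually_at_left_real)
    then have "eventually (\<lambda>x. x \<in> ?g ` {d<..<1}) (filtermap ?g (at_left 1))"
      unfolding eventually_filtermap by eventually_elim blast
    ultimately show "\<exists>M. eventually (\<lambda>x. x \<in> M) (filtermap ?g (at_left 1)) \<and> M \<times> M \<subseteq> ent V0" by blast
  qed
  then obtain q where q: "q \<in> topspace X" "filtermap ?g (at_left 1) \<le> nhdsin X q" by blast
  have "v \<in> D_at Q p"
  proof (rule cluster_extend[OF v q(1)])
    fix W and s0 :: real assume W: "openin X W" "q \<in> W" "s0 < 1"
    have "eventually (\<lambda>s. ?g s \<in> W) (at_left 1)" using le_nhdsinD[OF q(2) W(1,2)] by (simp add: eventually_filtermap)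
    moreover have "eventually (\<lambda>s::real. s \<in> {max 0 s0<..<1}) (at_left 1)" using W(3) by (intro eventually_at_left_real) auto
    ultimately have "eventually (\<lambda>s. ?g s \<in> W \<and> s \<in> {max 0 s0<..<1}) (at_left 1)" by (rule eventually_conj)
    then obtain s where "?g s \<in> W \<and> s \<in> {max 0 s0<..<1}" 
      using eventually_happens'[OF trivial_limit_at_left_real] by blast
    then show "\<exists>s\<ge>s0. 0 \<le> s \<and> s < 1 \<and> ?g s \<in> W" by (intro exI[of _ s]) auto
  qed auto
  then show False using n by blast
qed

end

section \<open>Tori and products\<close>

lemma topspace_quotient_topology: "topspace (quotient_topology X f) = f ` topspace X"
proof -
  have "{x \<in> topspace X. f x \<in> f ` topspace X} = topspace X" by auto
  then have "openin (quotient_topology X f) (f ` topspace X)" by (simp add: openin_quotient_topology)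
  then have "f ` topspace X \<subseteq> topspace (quotient_topology X f)" by (rule openin_subset)
  moreover have "topspace (quotient_topology X f) \<subseteq> f ` topspace X"
    using openin_topspace[of "quotient_topology X f"] unfolding openin_quotient_topology by blast
  ultimately show ?thesis by blast
qed

lemma quotient_map_quotient_topology: "quotient_map X (quotient_topology X f) f"
  unfolding quotient_map_def topspace_quotient_topology openin_quotient_topology by auto

definition additive_subgroup :: "'v::real_vector set \<Rightarrow> bool" where
  "additive_subgroup P \<longleftrightarrow> 0 \<in> P \<and> (\<forall>x\<in>P. \<forall>y\<in>P. x - y \<in> P)"

lemma additive_subgroup_neg: "additive_subgroup P \<Longrightarrow> x \<in> P \<Longrightarrow> - x \<in> P"
  unfolding additive_subgroup_def by (metis diff_0)

lemma additive_subgroup_add: "additive_subgroup P \<Longrightarrow> x \<in> P \<Longrightarrow> y \<in> P \<Longrightarrow> x + y \<in> P"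
  using additive_subgroup_neg[of P y] unfolding additive_subgroup_def by (metis diff_minus_eq_add)

lemma translates_self: "additive_subgroup P \<Longrightarrow> x \<in> translates P x"
  unfolding additive_subgroup_def translates_def by force

lemma in_translates: "y \<in> translates P x \<longleftrightarrow> y - x \<in> P"
  unfolding translates_def by (auto simp: image_iff) (metis add_diff_cancel_left' diff_add_cancel add.commute)

lemma translates_eq:
  assumes "additive_subgroup P"
  shows "translates P x = translates P y \<longleftrightarrow> y - x \<in> P"
proof
  assume "translates P x = translates P y"
  then show "y - x \<in> P" using translates_self[OF assms, of y] in_translates by metis
next
  assume xy: "y - x \<in> P"
  have "z - x \<in> P \<longleftrightarrow> z - y \<in> P" for z
  proof
    assume "z - x \<in> P"
    then have "(z - x) - (y - x) \<in> P" using xy assms unfolding additive_subgroup_def by blast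
    then show "z - y \<in> P" by simp
  next
    assume "z - y \<in> P"
    then have "(z - y) + (y - x) \<in> P" using xy additive_subgroup_add[OF assms] by blast
    then show "z - x \<in> P" by simp
  qed
  then show "translates P x = translates P y" by (auto simp: in_translates)
qed

text \<open>\<open>\<rho>\<close> quantifies discreteness: distinct elements of the subgroup
  \<open>P\<close> are at distance at least \<open>\<rho>\<close>.\<close>

locale lattice_torus =
  fixes U P :: "'v::euclidean_space set" and \<rho> :: real
  assumes U: "subspace U" and P: "additive_subgroup P" "P \<subseteq> U"
    and \<rho>: "\<rho> > 0" "\<And>x. x \<in> P \<Longrightarrow> norm x < \<rho> \<Longrightarrow> x = 0"
begin

abbreviation T where "T \<equiv> quotient_group_topology U P"

lemma topspace_T: "topspace T = translates P ` U"
  by (simp add: quotient_group_topology_def topspace_quotient_topology)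

lemma quotient_T: "quotient_map (top_of_set U) T (translates P)"
  unfolding quotient_group_topology_def by (rule quotient_map_quotient_topology)

lemma continuous_T: "continuous_map (top_of_set U) T (translates P)"
  using quotient_imp_continuous_map[OF quotient_T] .

text \<open>The saturation of an open set is the union of its translates by
  \<open>P\<close>.\<close>

lemma open_T: "open_map (top_of_set U) T (translates P)"
  unfolding open_map_def
proof (intro allI impI)
  fix S assume S: "openin (top_of_set U) S"
  then obtain W where W: "open W" "S = U \<inter> W" by (auto simp: openin_open)
  have "{x \<in> U. translates P x \<in> translates P ` S} = U \<inter> (\<Union>p\<in>P. (\<lambda>x. p + x) ` W)"
  proof (intro set_eqI iffI)
    fix x assume "x \<in> {x \<in> U. translates P x \<in> translates P ` S}"
    then obtain s where s: "x \<in> U" "s \<in> U" "s \<in> W" "translates P x = translates P s" using W by auto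
    then have "x - s \<in> P" using translates_eq[OF P(1), of s x] by simp
    then show "x \<in> U \<inter> (\<Union>p\<in>P. (\<lambda>x. p + x) ` W)" using s by (auto intro!: bexI[of _ "x - s"] image_eqI[of _ _ s])
  next
    fix x assume "x \<in> U \<inter> (\<Union>p\<in>P. (\<lambda>x. p + x) ` W)"
    then obtain p w where pw: "x \<in> U" "p \<in> P" "w \<in> W" "x = p + w" by auto
    have "w = x - p" using pw by simp
    then have "w \<in> U" using pw P subspace_diff[OF U, of x p] by auto
    moreover have "translates P x = translates P w"
      using translates_eq[OF P(1), of w x] pw by simp
    ultimately show "x \<in> {x \<in> U. translates P x \<in> translates P ` S}" using pw W by auto
  qed
  moreover have "open (\<Union>p\<in>P. (\<lambda>x. p + x) ` W)" using W by (auto intro: open_translation)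
  ultimately have "openin (top_of_set U) {x \<in> U. translates P x \<in> translates P ` S}"
    by (simp add: openin_open_Int)
  then show "openin T (translates P ` S)"
    using openin_imp_subset[OF S] by (auto simp: quotient_group_topology_def openin_quotient_topology)
qed

text \<open>Two points of a ball of radius \<open>\<rho> / 2\<close> are less than
  \<open>\<rho>\<close> apart, so they cannot differ by a nonzero element of
  \<open>P\<close>.\<close>

lemma ball_chart:
  assumes "x \<in> U" shows "U \<inter> ball x (\<rho> / 2) \<in> index (torus_parallel U P)"
proof -
  have "inj_on (translates P) (U \<inter> ball x (\<rho> / 2))"
  proof (rule inj_onI)
    fix y z assume yz: "y \<in> U \<inter> ball x (\<rho> / 2)" "z \<in> U \<inter> ball x (\<rho> / 2)" "translates P y = translates P z"
    then have "z - y \<in> P" using translates_eq P by blast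
    moreover have "norm (z - y) < \<rho>"
      using yz dist_triangle_half_r[of x z \<rho> y] by (auto simp: dist_norm)
    ultimately show "y = z" using \<rho>(2)[of "z - y"] by simp
  qed
  then show ?thesis
    using U by (simp add: torus_parallel_def openin_open_Int convex_Int subspace_imp_convex)
qed

lemma torus_chart_inv: "B \<in> index (torus_parallel U P) \<Longrightarrow> y \<in> B \<Longrightarrow> inv_into B (translates P) (translates P y) = y"
  by (simp add: torus_parallel_def)

lemma torus_index_sub: "B \<in> index (torus_parallel U P) \<Longrightarrow> B \<subseteq> U"
  by (auto simp: torus_parallel_def dest: openin_imp_subset)

text \<open>The Hausdorff property is a hypothesis here; for the period group it will be inherited
  from \<open>Q\<close>.\<close>

lemma torus_locally_convex:
  assumes H: "Hausdorff_space T"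
  shows "locally_convex (torus_parallel U P)"
proof -
  let ?i = "\<lambda>B. inv_into B (translates P)"
  have im: "?i B ` translates P ` B = B" if "B \<in> index (torus_parallel U P)" for B
    using torus_chart_inv[OF that] by force
  have chart: "is_chart T U (translates P ` B) (?i B)" if B: "B \<in> index (torus_parallel U P)" for B
    unfolding is_chart_def im[OF B]
    using open_map_inverse_homeomorphic[OF continuous_T open_T, of B] B torus_index_sub[OF B]
    by (auto simp: torus_parallel_def)
  have cover: "topspace T = (\<Union>B\<in>index (torus_parallel U P). translates P ` B)"
  proof (intro equalityI subsetI)
    fix A assume "A \<in> topspace T"
    then obtain x where "x \<in> U" "A = translates P x" unfolding topspace_T by blast
    then have "A \<in> translates P ` (U \<inter> ball x (\<rho> / 2))" using \<rho>(1) by auto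
    then show "A \<in> (\<Union>B\<in>index (torus_parallel U P). translates P ` B)" using ball_chart[OF \<open>x \<in> U\<close>] by blast
  next
    fix A assume "A \<in> (\<Union>B\<in>index (torus_parallel U P). translates P ` B)"
    then show "A \<in> topspace T" unfolding topspace_T using torus_index_sub by blast
  qed
  have lc: "locally_constant_on T (translates P ` B \<inter> translates P ` B') (\<lambda>A. ?i B A - ?i B' A)"
    if B: "B \<in> index (torus_parallel U P)" "B' \<in> index (torus_parallel U P)" for B B'
    unfolding locally_constant_on_def
  proof (intro ballI)
    fix A assume A: "A \<in> translates P ` B \<inter> translates P ` B'"
    then obtain a b where a: "a \<in> B" "A = translates P a" and b: "b \<in> B'" "A = translates P b" by blast
    \<comment> \<open>On these pieces each of the two coordinates moves by less than
      \<open>\<rho> / 2\<close>, so their difference, which changes by an element of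
      \<open>P\<close>, cannot jump.\<close>
    let ?W = "translates P ` (B \<inter> ball a (\<rho> / 2)) \<inter> translates P ` (B' \<inter> ball b (\<rho> / 2))"
    have "openin T (translates P ` (B \<inter> ball x (\<rho> / 2)))" if "B \<in> index (torus_parallel U P)" for B x
    proof -
      have "openin (top_of_set U) (B \<inter> ball x (\<rho> / 2))"
        using that by (auto simp: torus_parallel_def intro: openin_Int_open)
      then show ?thesis using open_T by (simp add: open_map_def)
    qed
    then have "openin T ?W" using B by blast
    then have "openin (subtopology T (translates P ` B \<inter> translates P ` B')) ?W"
      unfolding openin_subtopology by (intro exI[of _ ?W]) auto
    moreover have "A \<in> ?W" using a b \<rho>(1) by auto
    moreover have "?i B A' - ?i B' A' = ?i B A - ?i B' A" if A': "A' \<in> ?W" for A'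
    proof -
      obtain x y where x: "x \<in> B" "dist a x < \<rho> / 2" "A' = translates P x"
        and y: "y \<in> B'" "dist b y < \<rho> / 2" "A' = translates P y" using A' by auto
      have "translates P x = translates P y" "translates P a = translates P b" using x y a b by auto
      then have "y - x \<in> P" "b - a \<in> P" using translates_eq[OF P(1)] by blast+
      then have "(y - x) - (b - a) \<in> P" using P(1) unfolding additive_subgroup_def by blast
      moreover have "norm ((y - x) - (b - a)) < \<rho>"
      proof -
        have "(y - x) - (b - a) = (y - b) - (x - a)" by simp
        also have "norm \<dots> \<le> norm (y - b) + norm (x - a)" by (rule norm_triangle_ineq4)
        finally show ?thesis using x(2) y(2) by (simp add: dist_norm norm_minus_commute)
      qed
      ultimately have "(y - x) - (b - a) = 0" using \<rho>(2) by blast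
      then have "x - y = a - b" by (simp add: algebra_simps)
      moreover have "?i B A' = x" "?i B A = a" using torus_chart_inv[OF B(1)] x a by auto
      moreover have "?i B' A' = y" "?i B' A = b"
        unfolding y(3) b(2) using torus_chart_inv[OF B(2)] y(1) b(1) by auto
      ultimately show ?thesis by simp
    qed
    ultimately show "\<exists>W. openin (subtopology T (translates P ` B \<inter> translates P ` B')) W \<and> A \<in> W \<and>
        (\<forall>A'\<in>W. ?i B A' - ?i B' A' = ?i B A - ?i B' A)" by blast
  qed
  have idx: "index (torus_parallel U P) = {B. openin (top_of_set U) B \<and> convex B \<and> inj_on (translates P) B}"
    by (simp add: torus_parallel_def)
  have "parallel_space (torus_parallel U P)"
    using U H chart cover lc unfolding parallel_space_def by (simp add: torus_parallel_def)
  moreover have "convex (?i B ` translates P ` B)" if "B \<in> index (torus_parallel U P)" for B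
    using im[OF that] that unfolding idx by simp
  ultimately show ?thesis unfolding locally_convex_def by (simp add: torus_parallel_def)
qed

end

text \<open>A basis of the span can be chosen in \<open>P\<close>. Subtracting the integer parts of
  the coordinates moves every vector into a bounded parallelepiped.\<close>

lemma compact_space_span_quotient:
  fixes P :: "'v::euclidean_space set"
  assumes P: "additive_subgroup P"
  shows "compact_space (quotient_group_topology (span P) P)"
proof -
  let ?T = "quotient_group_topology (span P) P"
  obtain B where B: "B \<subseteq> P" "independent B" "P \<subseteq> span B"
    using maximal_independent_subset[of P] by blast
  have fB: "finite B" using B(2) by (rule finiteI_independent)
  have sp: "span P \<subseteq> span B" using B(3) span_minimal by blast
  define M where "M = (\<Sum>b\<in>B. norm b)"
  have intP: "of_int n *\<^sub>R b \<in> P" if b: "b \<in> P" for n :: int and b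
  proof -
    have nat: "real k *\<^sub>R x \<in> P" if x: "x \<in> P" for k x
    proof (induction k)
      case 0 then show ?case using P by (simp add: additive_subgroup_def)
    next
      case (Suc k)
      then show ?case using additive_subgroup_add[OF P x Suc] by (simp add: algebra_simps)
    qed
    show ?thesis
    proof (cases "n \<ge> 0")
      case True then show ?thesis using nat[OF b, of "nat n"] by simp
    next
      case False then show ?thesis using nat[OF additive_subgroup_neg[OF P b], of "nat (- n)"] by simp
    qed
  qed
  have dec: "\<exists>k\<in>span P \<inter> cball 0 M. translates P x = translates P k" if x: "x \<in> span P" for x
  proof -
    have "x \<in> span B" using sp x by blast
    then obtain t where t: "x = (\<Sum>b\<in>B. t b *\<^sub>R b)" using span_finite[OF fB] by auto
    define y where "y = (\<Sum>b\<in>B. of_int \<lfloor>t b\<rfloor> *\<^sub>R b)"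
    define k where "k = (\<Sum>b\<in>B. frac (t b) *\<^sub>R b)"
    have "y + k = x" unfolding y_def k_def t sum.distrib[symmetric] by (simp add: frac_def algebra_simps)
    have "y \<in> P"
      unfolding y_def using fB B(1)
    proof (induction B rule: finite_induct)
      case empty then show ?case using P by (simp add: additive_subgroup_def)
    next
      case (insert b F) then show ?case using additive_subgroup_add[OF P intP[of b "\<lfloor>t b\<rfloor>"]] by simp
    qed
    have "norm k \<le> (\<Sum>b\<in>B. norm (frac (t b) *\<^sub>R b))" unfolding k_def by (rule norm_sum)
    also have "\<dots> \<le> M" unfolding M_def
      by (intro sum_mono) (simp add: mult_left_le_one_le less_imp_le frac_lt_1)
    finally have "norm k \<le> M" .
    moreover have "k = x - y" using \<open>y + k = x\<close> by (simp add: algebra_simps)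
    then have "k \<in> span P" using x \<open>y \<in> P\<close> by (simp add: span_diff span_base)
    moreover have "translates P x = translates P k"
      using translates_eq[OF P, of k x] \<open>y + k = x\<close> \<open>y \<in> P\<close> by (simp add: algebra_simps \<open>k = x - y\<close>)
    ultimately show ?thesis by auto
  qed
  have "compact (span P \<inter> cball 0 M)"
    by (simp add: closed_Int_compact closed_subspace)
  then have "compactin (top_of_set (span P)) (span P \<inter> cball 0 M)" by (simp add: compactin_subtopology)
  moreover have "continuous_map (top_of_set (span P)) ?T (translates P)"
    unfolding quotient_group_topology_def
    by (rule quotient_imp_continuous_map[OF quotient_map_quotient_topology])
  ultimately have "compactin ?T (translates P ` (span P \<inter> cball 0 M))" by (rule image_compactin)
  moreover have "translates P ` (span P \<inter> cball 0 M) = topspace ?T"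
  proof -
    have "topspace ?T = translates P ` span P"
      by (simp add: quotient_group_topology_def topspace_quotient_topology)
    moreover have "translates P ` span P \<subseteq> translates P ` (span P \<inter> cball 0 M)"
    proof
      fix A assume "A \<in> translates P ` span P"
      then obtain x where "x \<in> span P" "A = translates P x" by blast
      then show "A \<in> translates P ` (span P \<inter> cball 0 M)" using dec[of x] by auto
    qed
    ultimately show ?thesis by blast
  qed
  ultimately show ?thesis by (simp add: compact_space_def)
qed

lemma top_of_set_Times:
  "top_of_set (A \<times> B) = prod_topology (top_of_set A) (top_of_set B)"
  by (metis subtopology_Times prod_topology_euclidean)

lemma locally_convex_prod:
  assumes Q: "locally_convex Q" and R: "locally_convex R"
  shows "locally_convex (prod_parallel Q R)"
proof -
  let ?X = "qtop Q" let ?Y = "qtop R"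
  have q: "subspace (model Q)" "Hausdorff_space ?X" "topspace ?X = (\<Union>\<alpha>\<in>index Q. cdom Q \<alpha>)"
     "\<And>\<alpha>. \<alpha> \<in> index Q \<Longrightarrow> is_chart ?X (model Q) (cdom Q \<alpha>) (chart Q \<alpha>)"
     "\<And>\<alpha> \<beta>. \<alpha> \<in> index Q \<Longrightarrow> \<beta> \<in> index Q \<Longrightarrow> locally_constant_on ?X (cdom Q \<alpha> \<inter> cdom Q \<beta>) (\<lambda>x. chart Q \<alpha> x - chart Q \<beta> x)"
     "\<And>\<alpha>. \<alpha> \<in> index Q \<Longrightarrow> convex (chart Q \<alpha> ` cdom Q \<alpha>)"
    using Q unfolding locally_convex_def parallel_space_def by auto
  have r: "subspace (model R)" "Hausdorff_space ?Y" "topspace ?Y = (\<Union>\<alpha>\<in>index R. cdom R \<alpha>)"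
     "\<And>\<alpha>. \<alpha> \<in> index R \<Longrightarrow> is_chart ?Y (model R) (cdom R \<alpha>) (chart R \<alpha>)"
     "\<And>\<alpha> \<beta>. \<alpha> \<in> index R \<Longrightarrow> \<beta> \<in> index R \<Longrightarrow> locally_constant_on ?Y (cdom R \<alpha> \<inter> cdom R \<beta>) (\<lambda>x. chart R \<alpha> x - chart R \<beta> x)"
     "\<And>\<alpha>. \<alpha> \<in> index R \<Longrightarrow> convex (chart R \<alpha> ` cdom R \<alpha>)"
    using R unfolding locally_convex_def parallel_space_def by auto
  have im: "map_prod f g ` (A \<times> B) = f ` A \<times> g ` B" for f :: "'b \<Rightarrow> 'c" and g :: "'e \<Rightarrow> 'f" and A B
    by auto
  have ch: "is_chart (prod_topology ?X ?Y) (model Q \<times> model R) (A \<times> B) (map_prod f g)"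
    if c: "is_chart ?X (model Q) A f" "is_chart ?Y (model R) B g" for A B f g
  proof -
    obtain f' where "homeomorphic_maps (subtopology ?X A) (top_of_set (f ` A)) f f'"
      using c(1) by (auto simp: is_chart_def homeomorphic_map_maps)
    moreover obtain g' where "homeomorphic_maps (subtopology ?Y B) (top_of_set (g ` B)) g g'"
      using c(2) by (auto simp: is_chart_def homeomorphic_map_maps)
    ultimately have "homeomorphic_maps (prod_topology (subtopology ?X A) (subtopology ?Y B))
        (prod_topology (top_of_set (f ` A)) (top_of_set (g ` B))) (\<lambda>(x, y). (f x, g y)) (\<lambda>(x, y). (f' x, g' y))"
      unfolding homeomorphic_maps_prod by blast
    then have "homeomorphic_map (prod_topology (subtopology ?X A) (subtopology ?Y B))
        (prod_topology (top_of_set (f ` A)) (top_of_set (g ` B))) (map_prod f g)"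
      unfolding map_prod_def using homeomorphic_map_maps by blast
    then have "homeomorphic_map (subtopology (prod_topology ?X ?Y) (A \<times> B))
        (top_of_set (map_prod f g ` (A \<times> B))) (map_prod f g)"
      by (simp only: im top_of_set_Times subtopology_Times)
    then show ?thesis using c unfolding is_chart_def im by (auto simp: openin_prod_Times_iff)
  qed
  have lc: "locally_constant_on (prod_topology ?X ?Y) ((A \<times> B) \<inter> (A' \<times> B')) (\<lambda>x. map_prod f g x - map_prod f' g' x)"
    if l: "locally_constant_on ?X (A \<inter> A') (\<lambda>x. f x - f' x)" "locally_constant_on ?Y (B \<inter> B') (\<lambda>x. g x - g' x)"
    for A A' B B' and f f' :: "_ \<Rightarrow> 'c" and g g' :: "_ \<Rightarrow> 'f"
    unfolding locally_constant_on_def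
  proof (intro ballI)
    fix z assume "z \<in> (A \<times> B) \<inter> (A' \<times> B')"
    then obtain x y where z: "z = (x, y)" "x \<in> A \<inter> A'" "y \<in> B \<inter> B'" by auto
    obtain W where W: "openin (subtopology ?X (A \<inter> A')) W" "x \<in> W" "\<forall>w\<in>W. f w - f' w = f x - f' x"
      using l(1) z(2) unfolding locally_constant_on_def by blast
    obtain W' where W': "openin (subtopology ?Y (B \<inter> B')) W'" "y \<in> W'" "\<forall>w\<in>W'. g w - g' w = g y - g' y"
      using l(2) z(3) unfolding locally_constant_on_def by blast
    have op: "openin (subtopology (prod_topology ?X ?Y) ((A \<times> B) \<inter> (A' \<times> B'))) (W \<times> W')"
      unfolding Times_Int_Times subtopology_Times using W W' by (simp add: openin_prod_Times_iff)
    show "\<exists>W. openin (subtopology (prod_topology ?X ?Y) ((A \<times> B) \<inter> (A' \<times> B'))) W \<and> z \<in> W \<and>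
       (\<forall>y\<in>W. map_prod f g y - map_prod f' g' y = map_prod f g z - map_prod f' g' z)"
    proof (intro exI conjI ballI)
      show "z \<in> W \<times> W'" using W(2) W'(2) z(1) by simp
      fix w assume "w \<in> W \<times> W'"
      then obtain a b where w: "w = (a, b)" "a \<in> W" "b \<in> W'" by blast
      show "map_prod f g w - map_prod f' g' w = map_prod f g z - map_prod f' g' z"
        using W(3) W'(3) w(2,3) unfolding w(1) z(1) by simp
    qed (rule op)
  qed
  have "parallel_space (prod_parallel Q R)"
    unfolding parallel_space_def prod_parallel_def
    using q(1-3) r(1-3) ch[OF q(4) r(4)] lc[OF q(5) r(5)]
    by (auto simp: subspace_Times Hausdorff_space_prod_topology)
  moreover have "convex (map_prod (chart Q \<alpha>) (chart R \<beta>) ` (cdom Q \<alpha> \<times> cdom R \<beta>))"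
    if "\<alpha> \<in> index Q" "\<beta> \<in> index R" for \<alpha> \<beta>
    unfolding im using q(6) r(6) that by (simp add: convex_Times)
  ultimately show ?thesis unfolding locally_convex_def by (auto simp: prod_parallel_def)
qed

lemma locally_convex_restrict_vector:
  assumes "subspace C" "convex \<Delta>" "\<Delta> \<subseteq> C"
  shows "locally_convex (restrict_parallel (vector_parallel C) \<Delta>)"
proof -
  have e: "C \<inter> \<Delta> = \<Delta>" using assms(3) by blast
  have "locally_constant_on (top_of_set \<Delta>) \<Delta> (\<lambda>x. 0 :: 'a)"
    unfolding locally_constant_on_def by (intro ballI exI[of _ \<Delta>]) (auto simp: subtopology_subtopology)
  moreover have "homeomorphic_map (top_of_set \<Delta>) (top_of_set \<Delta>) (\<lambda>x. x)"
    using homeomorphic_map_id[of "top_of_set \<Delta>"] by (simp add: id_def)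
  ultimately show ?thesis
    using assms unfolding locally_convex_def parallel_space_def is_chart_def
    by (simp add: restrict_parallel_def vector_parallel_def subtopology_subtopology e Hausdorff_space_subtopology)
qed

section \<open>The period group and the splitting\<close>

locale connected_flat = locally_compact_parallel Q + complete_action "qtop Q" "D_at Q" "translate Q"
  for Q :: "('a, 'q, 'v::euclidean_space) parallel"
begin

abbreviation act (infixl "\<oplus>" 65) where "act \<equiv> translate Q"

abbreviation P where "P \<equiv> periods Q"
abbreviation R where "R \<equiv> span (periods Q)"

lemma periods_eq: "P = Per"
  unfolding periods_def Per_def D_set_def by (auto simp: D_at_iff)

lemma P_sub: "P \<subseteq> V"
  by (auto simp: periods_def)

lemma R_sub: "R \<subseteq> V"
  using span_minimal[OF P_sub V_sub] .

lemma D_sub: "D_at Q q \<subseteq> V"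
  by (auto simp: D_at_iff)

lemma D_add_R: "x \<in> D_at Q q \<Longrightarrow> w \<in> R \<Longrightarrow> x + w \<in> D_at Q q"
  using D_add_span unfolding periods_eq by blast

lemma D_diff_R: "x + w \<in> D_at Q q \<Longrightarrow> w \<in> R \<Longrightarrow> x \<in> D_at Q q"
  using D_add_R[of "x + w" q "- w"] by (simp add: span_neg)

lemma R_D: "q \<in> topspace X \<Longrightarrow> w \<in> R \<Longrightarrow> w \<in> D_at Q q"
  using D_add_R[OF zero_in] by simp

lemma P_subgroup: "topspace X \<noteq> {} \<Longrightarrow> additive_subgroup P"
  unfolding additive_subgroup_def periods_eq using Per_zero Per_diff by blast

lemma lattice_torus_R:
  assumes "topspace X \<noteq> {}" shows "\<exists>\<rho>. lattice_torus R P \<rho>"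
proof -
  obtain q where "q \<in> topspace X" using assms by blast
  then obtain r where "r > 0" "\<forall>v\<in>P. norm v < r \<longrightarrow> v = 0" using Per_separated unfolding periods_eq by blast
  then have "lattice_torus R P r"
    using P_subgroup[OF assms] span_superset[of P] by unfold_locales auto
  then show ?thesis by blast
qed

lemma discrete_P:
  assumes "topspace X \<noteq> {}" shows "discrete_subgroup R P"
proof -
  obtain \<rho> where "lattice_torus R P \<rho>" using lattice_torus_R[OF assms] by blast
  then interpret lattice_torus R P \<rho> .
  have "x isolated_in P" if x: "x \<in> P" for x
    unfolding isolated_in_dist_Ex_iff
  proof (intro conjI exI[of _ \<rho>] ballI impI)
    fix y assume y: "y \<in> P" "dist x y < \<rho>"
    then have "y - x \<in> P" "norm (y - x) < \<rho>"
      using x P(1) by (auto simp: additive_subgroup_def dist_norm norm_minus_commute)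
    then show "y = x" using \<rho>(2)[of "y - x"] by simp
  qed (use x \<rho> in auto)
  then have "discrete P" by (rule discreteI)
  then show ?thesis using P unfolding discrete_subgroup_def additive_subgroup_def by blast
qed

lemma cocompact_P: "topspace X \<noteq> {} \<Longrightarrow> cocompact_subgroup R P"
  unfolding cocompact_subgroup_def by (intro compact_space_span_quotient P_subgroup)

text \<open>All half-spaces containing the closed convex set \<open>D_at Q q\<close> are taken; any
  other point is cut off by a separating hyperplane.\<close>

lemma halfspace_exists:
  "\<exists>(I :: (('v \<Rightarrow> real) \<times> real) set) f c. halfspace_description V (D_at Q q) I f c"
proof -
  define I where "I = {(f :: 'v \<Rightarrow> real, c). linear f \<and> (\<forall>v\<in>D_at Q q. f v \<ge> c)}"
  have "v \<in> D_at Q q" if v: "v \<in> V" "\<forall>i\<in>I. fst i v \<ge> snd i" for v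
  proof (rule ccontr)
    assume "v \<notin> D_at Q q"
    then obtain a b where ab: "inner a v < b" "\<forall>x\<in>D_at Q q. inner a x > b"
      using separating_hyperplane_closed_point[OF D_convex D_closed] by blast
    then have "(inner a, b) \<in> I"
      unfolding I_def by (auto simp: less_imp_le bounded_linear.linear bounded_linear_inner_right)
    then show False using v(2) ab(1) by force
  qed
  then have "halfspace_description V (D_at Q q) I fst snd"
    unfolding halfspace_description_def using D_sub by (auto simp: I_def)
  then show ?thesis by blast
qed

text \<open>A linear form that is bounded below on a full line is constant on it. Conversely
  \<open>0 \<in> D_at Q p\<close> gives \<open>c i \<le> 0\<close>, so multiples of a common zero
  satisfy all inequalities.\<close>

lemma N_iff_halfspace:
  assumes h: "halfspace_description V (D_at Q p) I f c" and p: "p \<in> topspace X" and v: "v \<in> V"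
  shows "v \<in> N_space Q \<longleftrightarrow> (\<forall>i\<in>I. f i v = 0)"
    and "v \<in> N_space Q \<longleftrightarrow> (\<forall>t. t *\<^sub>R v \<in> D_at Q p)"
proof -
  have Nq: "v \<in> N_space Q \<longleftrightarrow> (\<exists>q\<in>topspace X. \<forall>t. t *\<^sub>R v \<in> D_at Q q)"
    using v by (auto simp: N_space_def D_at_scale[OF v] set_eq_iff)
  have lin: "linear (f i)" if "i \<in> I" for i using h that by (auto simp: halfspace_description_def)
  have D: "x \<in> D_at Q p \<longleftrightarrow> x \<in> V \<and> (\<forall>i\<in>I. f i x \<ge> c i)" for x
    using h unfolding halfspace_description_def by blast
  have 1: "f i v = 0" if N: "v \<in> N_space Q" and i: "i \<in> I" for i
  proof (rule ccontr)
    assume n: "f i v \<noteq> 0"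
    \<comment> \<open>The full line may start at another point \<open>q\<close>;
      \<open>D_shift\<close> carries it over to a line in \<open>D_at Q p\<close>.\<close>
    obtain q where q: "q \<in> topspace X" "\<forall>t. t *\<^sub>R v \<in> D_at Q q" using N Nq by blast
    obtain u where u: "u \<in> D_at Q p" "q = p \<oplus> u" using reach[OF p q(1)] by blast
    have "u + t *\<^sub>R v \<in> D_at Q p" for t using q(2) D_shift[OF u(1)] u(2) by blast
    then have "f i (u + t *\<^sub>R v) \<ge> c i" for t using D i by blast
    then have "f i u + t * f i v \<ge> c i" for t
      using lin[OF i] by (simp add: linear_add linear_scale)
    \<comment> \<open>At this parameter the form takes the value \<open>c i - 1\<close>.\<close>
    from this[of "(c i - f i u - 1) / f i v"] show False using n by simp
  qed
  have 2: "t *\<^sub>R v \<in> D_at Q p" if "\<forall>i\<in>I. f i v = 0" for t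
  proof -
    have "c i \<le> 0" if "i \<in> I" for i
      using D[of 0] zero_in[OF p] lin[OF that] that linear_0[of "f i"] by auto
    then show ?thesis using D lin that subspace_scale[OF V_sub v] by (simp add: linear_scale)
  qed
  show "v \<in> N_space Q \<longleftrightarrow> (\<forall>i\<in>I. f i v = 0)" using 1 2 Nq p by blast
  show "v \<in> N_space Q \<longleftrightarrow> (\<forall>t. t *\<^sub>R v \<in> D_at Q p)" using 1 2 Nq p by blast
qed

lemma N_eq_halfspace:
  assumes "halfspace_description V (D_at Q p) I f c" "p \<in> topspace X"
  shows "N_space Q = {v \<in> V. \<forall>i\<in>I. f i v = 0}"
  using N_iff_halfspace(1)[OF assms] by (auto simp: N_space_def)

lemma N_eq:
  assumes p: "p \<in> topspace X" shows "N_space Q = {v \<in> V. \<forall>t. t *\<^sub>R v \<in> D_at Q p}"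
proof -
  obtain I :: "(('v \<Rightarrow> real) \<times> real) set" and f c where h: "halfspace_description V (D_at Q p) I f c"
    using halfspace_exists by blast
  have "N_space Q \<subseteq> V" by (auto simp: N_space_def)
  then show ?thesis using N_iff_halfspace(2)[OF h p] by blast
qed

end

text \<open>Used to pass from \<open>\<Delta>\<close> to coordinates on the orbit space. The inverse
  comes from a linear left inverse of \<open>\<pi>\<close> on \<open>C\<close>.\<close>

lemma homeomorphic_map_affine:
  fixes \<pi> :: "'v::euclidean_space \<Rightarrow> 'w::euclidean_space"
  assumes \<pi>: "linear \<pi>" "inj_on \<pi> C" and C: "subspace C" "S \<subseteq> C"
  shows "homeomorphic_map (top_of_set S) (top_of_set ((\<lambda>v. \<pi> v + k) ` S)) (\<lambda>v. \<pi> v + k)"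
proof -
  obtain g where g: "linear g" "\<And>v. v \<in> C \<Longrightarrow> g (\<pi> v) = v"
    using real_vector.linear_exists_left_inverse_on[OF \<pi>(1) C(1) \<pi>(2)] by blast
  have lin: "continuous_on A h" if "linear h" for A and h :: "'x::euclidean_space \<Rightarrow> 'y::euclidean_space"
    using that by (simp add: linear_continuous_on linear_conv_bounded_linear)
  have "homeomorphic_maps (top_of_set S) (top_of_set ((\<lambda>v. \<pi> v + k) ` S)) (\<lambda>v. \<pi> v + k) (\<lambda>y. g (y - k))"
    unfolding homeomorphic_maps_def
  proof (intro conjI)
    have "continuous_on S (\<lambda>v. \<pi> v + k)" by (intro continuous_on_add lin \<pi>(1) continuous_on_const)
    then show "continuous_map (top_of_set S) (top_of_set ((\<lambda>v. \<pi> v + k) ` S)) (\<lambda>v. \<pi> v + k)"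
      by (auto simp: continuous_map_in_subtopology)
    have "continuous_on A (\<lambda>y. g (y - k))" for A
      by (rule continuous_on_compose2[OF lin[OF g(1), of UNIV]]) (auto intro!: continuous_intros)
    then show "continuous_map (top_of_set ((\<lambda>v. \<pi> v + k) ` S)) (top_of_set S) (\<lambda>y. g (y - k))"
      using g(2) C(2) by (auto simp: continuous_map_in_subtopology subset_iff)
  qed (use g C(2) in auto)
  then show ?thesis using homeomorphic_map_maps by blast
qed

section \<open>Splitting off the torus\<close>

locale split_flat = connected_flat Q
  for Q :: "('a, 'q, 'v::euclidean_space) parallel" +
  fixes C :: "'v set" and p :: 'q
  assumes complement: "linear_complement V R C" and p: "p \<in> topspace X"
begin

abbreviation \<Delta> where "\<Delta> \<equiv> D_at Q p \<inter> C"

lemma C_sub: "subspace C" "C \<subseteq> V" and C_R: "x \<in> C \<Longrightarrow> x \<in> R \<Longrightarrow> x = 0"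
  and decompose: "v \<in> V \<Longrightarrow> \<exists>c\<in>C. \<exists>u\<in>R. v = c + u"
  using complement unfolding linear_complement_def by blast+

lemma nonempty: "topspace X \<noteq> {}" using p by blast

sublocale torus: lattice_torus R P "SOME \<rho>. lattice_torus R P \<rho>"
  using lattice_torus_R[OF nonempty] by (rule someI_ex)

lemma \<Delta>_closed: "closed \<Delta>" and \<Delta>_convex: "convex \<Delta>"
  using D_closed D_convex closed_subspace[OF C_sub(1)] subspace_imp_convex[OF C_sub(1)]
  by (auto intro: convex_Int)

lemma zero_\<Delta>: "0 \<in> \<Delta>"
  using zero_in[OF p] subspace_0[OF C_sub(1)] by simp

lemma D_decompose:
  assumes x: "x \<in> D_at Q p" shows "\<exists>v\<in>\<Delta>. \<exists>w\<in>R. x = v + w"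
proof -
  obtain c u where c: "c \<in> C" "u \<in> R" "x = c + u" using x decompose D_sub by blast
  then have "c \<in> D_at Q p" using x D_diff_R[of c u p] by blast
  then show ?thesis using c by blast
qed

lemma D_eq: "D_at Q p = {v + w |v w. v \<in> \<Delta> \<and> w \<in> R}"
proof (intro equalityI subsetI)
  fix x assume "x \<in> {v + w |v w. v \<in> \<Delta> \<and> w \<in> R}"
  then show "x \<in> D_at Q p" using D_add_R by auto
qed (use D_decompose in blast)

lemma decomp_unique:
  assumes "v \<in> C" "v' \<in> C" "w \<in> R" "w' \<in> R" "v + w = v' + w'"
  shows "v = v'" "w = w'"
proof -
  have "v - v' = w' - w" using assms(5) by (simp add: algebra_simps)
  then have "v - v' = 0" using assms C_sub(1) by (metis C_R span_diff subspace_diff)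
  then show "v = v'" by simp
  then show "w = w'" using assms(5) by simp
qed

lemma linear_sum: "linear (\<lambda>(w::'v, z::'v). w + z)"
  by (rule linearI) (auto simp: algebra_simps)

lemma sum_bij: "bij_betw (\<lambda>(w, z). w + z) (C \<times> R) V"
proof (rule bij_betw_imageI)
  show "inj_on (\<lambda>(w, z). w + z) (C \<times> R)" using decomp_unique by (auto simp: inj_on_def)
  show "(\<lambda>(w, z). w + z) ` (C \<times> R) = V"
    using complement unfolding linear_complement_def by (force simp: image_iff)
qed

text \<open>Both components of a vector depend linearly, hence continuously, on it.\<close>

lemma projection:
  obtains g where "linear g" "\<And>v w. v \<in> C \<Longrightarrow> w \<in> R \<Longrightarrow> g (v + w) = (v, w)"
proof -
  have "subspace (C \<times> R)" using C_sub by (simp add: subspace_Times)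
  then obtain g where "linear g" "\<forall>x\<in>C \<times> R. g ((\<lambda>(w, z). w + z) x) = x"
    using real_vector.linear_exists_left_inverse_on[OF linear_sum _ bij_betw_imp_inj_on[OF sum_bij]] by blast
  then show ?thesis using that[of g] by auto
qed

lemma sum_homeomorphic: "homeomorphic_map (top_of_set (\<Delta> \<times> R)) (top_of_set (D_at Q p)) (\<lambda>(v, w). v + w)"
proof -
  obtain g where g: "linear g" "\<And>v w. v \<in> C \<Longrightarrow> w \<in> R \<Longrightarrow> g (v + w) = (v, w)" by (rule projection) blast
  have "homeomorphic_maps (top_of_set (\<Delta> \<times> R)) (top_of_set (D_at Q p)) (\<lambda>(v, w). v + w) g"
    unfolding homeomorphic_maps_def
  proof (intro conjI)
    show "continuous_map (top_of_set (\<Delta> \<times> R)) (top_of_set (D_at Q p)) (\<lambda>(v, w). v + w)"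
      using D_add_R by (auto simp: continuous_map_in_subtopology linear_continuous_on linear_sum linear_conv_bounded_linear[symmetric])
    have gx: "g x \<in> \<Delta> \<times> R \<and> (\<lambda>(v, w). v + w) (g x) = x" if x: "x \<in> D_at Q p" for x
    proof -
      obtain v w where "v \<in> \<Delta>" "w \<in> R" "x = v + w" using D_decompose[OF x] by blast
      then show ?thesis using g(2) by auto
    qed
    then show "continuous_map (top_of_set (D_at Q p)) (top_of_set (\<Delta> \<times> R)) g"
      using g(1) by (auto simp: continuous_map_in_subtopology linear_continuous_on linear_conv_bounded_linear[symmetric])
    show "\<forall>y\<in>topspace (top_of_set (D_at Q p)). (\<lambda>(v, w). v + w) (g y) = y" using gx by simp
    show "\<forall>x\<in>topspace (top_of_set (\<Delta> \<times> R)). g ((\<lambda>(v, w). v + w) x) = x" using g(2) by auto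
  qed
  then show ?thesis using homeomorphic_map_maps by blast
qed

text \<open>A point of the torus is a coset of the period group. Any representative leads to the
  same end point, so an arbitrary one is chosen.\<close>

definition \<Phi> :: "'v \<times> 'v set \<Rightarrow> 'q" where
  "\<Phi> = (\<lambda>(v, A). translate Q p (v + (SOME w. w \<in> A)))"

lemma act_add_P:
  assumes "x \<in> D_at Q p" "w \<in> P" shows "p \<oplus> (x + w) = p \<oplus> x"
proof -
  have "x + w \<in> D_at Q p" using D_add_R[OF assms(1) span_base[OF assms(2)]] .
  moreover have "x + w - x \<in> Per" using assms(2) by (simp add: periods_eq)
  ultimately have "p \<oplus> x = p \<oplus> (x + w)" using act_eq_iff[OF assms(1)] by blast
  then show ?thesis by simp
qed

lemma \<Phi>_eq:
  assumes "v \<in> \<Delta>" "w \<in> R" shows "\<Phi> (v, translates P w) = translate Q p (v + w)"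
proof -
  have "(SOME w'. w' \<in> translates P w) \<in> translates P w"
    using translates_self[OF torus.P(1)] by (rule someI)
  then have "(SOME w'. w' \<in> translates P w) - w \<in> P" (is "?w - w \<in> P") by (simp add: in_translates)
  then have "translate Q p ((v + w) + (?w - w)) = translate Q p (v + w)"
    using assms D_add_R by (intro act_add_P) auto
  then show ?thesis by (simp add: \<Phi>_def)
qed

text \<open>\<open>?E\<close> is the map on vectors and \<open>?m\<close> the projection in the
  torus factor. Both are continuous and open, and \<open>?m\<close> is onto, so the induced map
  \<open>\<Phi>\<close> is continuous and open too. Injectivity combines \<open>act_eq_iff\<close>
  with the directness of the sum of \<open>C\<close> and \<open>R\<close>.\<close>

lemma \<Phi>_homeomorphic: "homeomorphic_map (prod_topology (top_of_set \<Delta>) torus.T) X \<Phi>"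
proof -
  let ?Y = "prod_topology (top_of_set \<Delta>) torus.T"
  let ?E = "\<lambda>(v, w). p \<oplus> (v + w)" let ?m = "\<lambda>(v, w). (v, translates P w)"
  have E: "?E = act p \<circ> (\<lambda>(v, w). v + w)" by auto
  have Ec: "continuous_map (top_of_set (\<Delta> \<times> R)) X ?E"
    unfolding E using homeomorphic_imp_continuous_map[OF sum_homeomorphic] act_continuous by (rule continuous_map_compose)
  have Eo: "open_map (top_of_set (\<Delta> \<times> R)) X ?E"
    unfolding E using homeomorphic_imp_open_map[OF sum_homeomorphic] act_open by (rule open_map_compose)
  have mc: "continuous_map (top_of_set (\<Delta> \<times> R)) ?Y ?m"
    unfolding top_of_set_Times
    by (intro iffD2[OF continuous_map_prod_top] disjI2 conjI torus.continuous_T) simp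
  have mo: "open_map (top_of_set (\<Delta> \<times> R)) ?Y ?m"
    unfolding open_map_def
  proof (intro allI impI)
    fix S assume "openin (top_of_set (\<Delta> \<times> R)) S"
    then have S: "openin (prod_topology (top_of_set \<Delta>) (top_of_set R)) S" by (simp only: top_of_set_Times)
    show "openin ?Y (?m ` S)"
      unfolding openin_prod_topology_alt
    proof (intro allI impI)
      fix x A assume "(x, A) \<in> ?m ` S"
      then obtain w where w: "(x, w) \<in> S" "A = translates P w" by auto
      then obtain S1 S2 where S12: "openin (top_of_set \<Delta>) S1" "openin (top_of_set R) S2" "x \<in> S1" "w \<in> S2" "S1 \<times> S2 \<subseteq> S"
        using S[unfolded openin_prod_topology_alt, rule_format, OF w(1)] by blast
      have "openin torus.T (translates P ` S2)" using torus.open_T S12(2) by (simp add: open_map_def)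
      moreover have "S1 \<times> translates P ` S2 \<subseteq> ?m ` S" using S12(5) by force
      ultimately show "\<exists>U W. openin (top_of_set \<Delta>) U \<and> openin torus.T W \<and> x \<in> U \<and> A \<in> W \<and> U \<times> W \<subseteq> ?m ` S"
        using S12 w(2) by (intro exI[of _ S1] exI[of _ "translates P ` S2"]) auto
    qed
  qed
  have top: "topspace ?Y = ?m ` (\<Delta> \<times> R)" by (auto simp: torus.topspace_T)
  have \<Phi>m: "\<Phi> (?m z) = ?E z" if "z \<in> \<Delta> \<times> R" for z using that \<Phi>_eq by auto
  have Esurj: "?E ` (\<Delta> \<times> R) = topspace X"
  proof -
    have "(\<lambda>(v, w). v + w) ` (\<Delta> \<times> R) = D_at Q p"
      using homeomorphic_imp_surjective_map[OF sum_homeomorphic] by simp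
    then have "?E ` (\<Delta> \<times> R) = act p ` D_at Q p" unfolding E by (metis image_comp)
    also have "\<dots> = topspace X"
    proof (intro equalityI subsetI)
      fix q assume "q \<in> topspace X"
      then show "q \<in> act p ` D_at Q p" using reach[OF p] by auto
    qed (use act_in in auto)
    finally show ?thesis .
  qed
  show ?thesis
  proof (rule bijective_open_imp_homeomorphic_map)
    show "continuous_map ?Y X \<Phi>"
      unfolding continuous_map
    proof (intro conjI allI impI)
      show "\<Phi> ` topspace ?Y \<subseteq> topspace X" unfolding top using \<Phi>m Esurj by (auto simp del: split_paired_All)
      fix W assume W: "openin X W"
      have "{z \<in> topspace ?Y. \<Phi> z \<in> W} = ?m ` {z \<in> \<Delta> \<times> R. ?E z \<in> W}"
      proof (intro equalityI subsetI)
        fix y assume "y \<in> {z \<in> topspace ?Y. \<Phi> z \<in> W}"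
        then obtain z where z: "z \<in> \<Delta> \<times> R" "y = ?m z" "\<Phi> y \<in> W" unfolding top by blast
        then show "y \<in> ?m ` {z \<in> \<Delta> \<times> R. ?E z \<in> W}" using \<Phi>m[OF z(1)] by (intro image_eqI[of _ _ z]) auto
      next
        fix y assume "y \<in> ?m ` {z \<in> \<Delta> \<times> R. ?E z \<in> W}"
        then obtain z where z: "z \<in> \<Delta> \<times> R" "y = ?m z" "?E z \<in> W" by blast
        then have "\<Phi> y \<in> W" using \<Phi>m[OF z(1)] by simp
        then show "y \<in> {z \<in> topspace ?Y. \<Phi> z \<in> W}" unfolding top using z(1,2) by blast
      qed
      moreover have "openin (top_of_set (\<Delta> \<times> R)) {z \<in> \<Delta> \<times> R. ?E z \<in> W}"
        using Ec W unfolding continuous_map by simp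
      ultimately show "openin ?Y {z \<in> topspace ?Y. \<Phi> z \<in> W}" using mo by (simp add: open_map_def)
    qed
    show "open_map ?Y X \<Phi>"
      unfolding open_map_def
    proof (intro allI impI)
      fix S assume S: "openin ?Y S"
      have "openin (top_of_set (\<Delta> \<times> R)) {z \<in> \<Delta> \<times> R. ?m z \<in> S}"
        using mc S unfolding continuous_map by simp
      then have "openin X (?E ` {z \<in> \<Delta> \<times> R. ?m z \<in> S})" using Eo by (simp add: open_map_def)
      moreover have "?E ` {z \<in> \<Delta> \<times> R. ?m z \<in> S} = \<Phi> ` S"
      proof (intro equalityI subsetI)
        fix y assume "y \<in> ?E ` {z \<in> \<Delta> \<times> R. ?m z \<in> S}"
        then obtain z where "z \<in> \<Delta> \<times> R" "?m z \<in> S" "y = ?E z" by blast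
        then show "y \<in> \<Phi> ` S" using \<Phi>m[of z] by (metis image_eqI)
      next
        fix y assume "y \<in> \<Phi> ` S"
        then obtain a where a: "a \<in> S" "y = \<Phi> a" by blast
        then have "a \<in> ?m ` (\<Delta> \<times> R)" using openin_subset[OF S] top by blast
        then obtain z where z: "z \<in> \<Delta> \<times> R" "a = ?m z" by blast
        then show "y \<in> ?E ` {z \<in> \<Delta> \<times> R. ?m z \<in> S}" using a \<Phi>m[OF z(1)] by (intro image_eqI[of _ _ z]) auto
      qed
      ultimately show "openin X (\<Phi> ` S)" by simp
    qed
    show "\<Phi> ` topspace ?Y = topspace X"
      unfolding top Esurj[symmetric] image_image using \<Phi>m by (intro image_cong) auto
    show "inj_on \<Phi> (topspace ?Y)"
    proof (rule inj_onI)
      fix a b assume ab: "a \<in> topspace ?Y" "b \<in> topspace ?Y" "\<Phi> a = \<Phi> b"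
      then obtain v w v' w' where a: "a = (v, translates P w)" "v \<in> \<Delta>" "w \<in> R" and b: "b = (v', translates P w')" "v' \<in> \<Delta>" "w' \<in> R"
        unfolding top by auto
      then have "p \<oplus> (v + w) = p \<oplus> (v' + w')" using ab(3) \<Phi>_eq by simp
      then have P: "(v' + w') - (v + w) \<in> P"
        using act_eq_iff[of "v + w" p "v' + w'"] D_add_R a b periods_eq by auto
      then have "(v' + w') - (v + w) \<in> R" by (rule span_base)
      then have "((v' + w') - (v + w)) + w - w' \<in> R" using span_diff[OF span_add[OF _ a(3)] b(3)] by blast
      then have "v' - v \<in> R" by (simp add: algebra_simps)
      moreover have "v' - v \<in> C" using a b subspace_diff[OF C_sub(1)] by blast
      ultimately have "v' = v" using C_R by (metis eq_iff_diff_eq_0)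
      then have "w' - w \<in> P" using P by (simp add: algebra_simps)
      then show "a = b" using a b \<open>v' = v\<close> translates_eq[OF torus.P(1)] by simp
    qed
  qed
qed

text \<open>On the slice over \<open>0 \<in> \<Delta>\<close>, \<open>\<Phi>\<close> is a continuous
  injection of the torus into the Hausdorff space \<open>Q\<close>.\<close>

lemma torus_lc: "locally_convex (torus_parallel R P)"
proof (rule torus.torus_locally_convex)
  let ?i = "\<lambda>A. (0::'v, A)"
  have "continuous_map torus.T (prod_topology (top_of_set \<Delta>) torus.T) ?i"
    using zero_\<Delta> by (simp add: continuous_map_pairwise o_def)
  then have "continuous_map torus.T X (\<Phi> \<circ> ?i)"
    using homeomorphic_imp_continuous_map[OF \<Phi>_homeomorphic] by (rule continuous_map_compose)
  moreover have "inj_on (\<Phi> \<circ> ?i) (topspace torus.T)"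
  proof (rule inj_onI)
    fix A B assume AB: "A \<in> topspace torus.T" "B \<in> topspace torus.T" "(\<Phi> \<circ> ?i) A = (\<Phi> \<circ> ?i) B"
    then have "?i A = ?i B"
      using inj_onD[OF homeomorphic_imp_injective_map[OF \<Phi>_homeomorphic], of "?i A" "?i B"] zero_\<Delta> by simp
    then show "A = B" by simp
  qed
  ultimately show "Hausdorff_space torus.T"
    using Hausdorff_space_injective_preimage X_haus by blast
qed

abbreviation \<Delta>_space where "\<Delta>_space \<equiv> restrict_parallel (vector_parallel C) \<Delta>"

lemma \<Delta>_lc: "locally_convex \<Delta>_space"
  using C_sub \<Delta>_convex by (intro locally_convex_restrict_vector) auto

lemma \<Delta>_space_simps: "qtop \<Delta>_space = top_of_set \<Delta>" "model \<Delta>_space = C" "index \<Delta>_space = UNIV"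
    "cdom \<Delta>_space = (\<lambda>_. \<Delta>)" "chart \<Delta>_space = (\<lambda>_ x. x)"
  by (auto simp: restrict_parallel_def vector_parallel_def subtopology_subtopology Int_absorb1)

lemma \<Phi>_iso: "parallel_iso (\<lambda>(w, z). w + z) (prod_parallel \<Delta>_space (torus_parallel R P)) Q \<Phi>"
proof -
  let ?R = "prod_parallel \<Delta>_space (torus_parallel R P)"
  have q: "qtop ?R = prod_topology (top_of_set \<Delta>) torus.T"
    by (simp add: prod_parallel_def \<Delta>_space_simps torus_parallel_def)
  have m: "model ?R = C \<times> R" by (simp add: prod_parallel_def \<Delta>_space_simps torus_parallel_def)
  have "chart Q \<alpha> (\<Phi> r) - chart Q \<alpha> (\<Phi> s) = (\<lambda>(w, z). w + z) (chart ?R \<beta> r - chart ?R \<beta> s)"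
    if \<alpha>: "\<alpha> \<in> index Q" and \<beta>: "\<beta> \<in> index ?R" and U: "U \<subseteq> cdom ?R \<beta>" "\<Phi> ` U \<subseteq> cdom Q \<alpha>" "convex (chart ?R \<beta> ` U)"
      and rs: "r \<in> U" "s \<in> U" for \<alpha> \<beta> U r s
  proof -
    obtain B where B: "B \<in> index (torus_parallel R P)" "\<beta> = ((), B)"
      using \<beta> by (auto simp: prod_parallel_def)
    let ?c = "\<lambda>z. (fst z, inv_into B (translates P) (snd z))"
    have ch: "chart ?R \<beta> = ?c" and dom: "cdom ?R \<beta> = \<Delta> \<times> translates P ` B"
      by (auto simp: B(2) prod_parallel_def \<Delta>_space_simps torus_parallel_def map_prod_def fun_eq_iff)
    have U1: "z = (fst (?c z), translates P (snd (?c z)))" "fst (?c z) \<in> \<Delta>" "snd (?c z) \<in> R" if z: "z \<in> U" for z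
    proof -
      obtain v b where vb: "z = (v, translates P b)" "v \<in> \<Delta>" "b \<in> B" using U(1) z unfolding dom by blast
      then have "?c z = (v, b)" using torus.torus_chart_inv[OF B(1)] by simp
      then show "z = (fst (?c z), translates P (snd (?c z)))" "fst (?c z) \<in> \<Delta>" "snd (?c z) \<in> R"
        using vb torus.torus_index_sub[OF B(1)] by auto
    qed
    \<comment> \<open>The vector from \<open>p\<close> to the image of \<open>z\<close>, with its
      torus part unwrapped by the chart.\<close>
    define x where "x = (\<lambda>z. fst (?c z) + snd (?c z))"
    have xD: "x z \<in> D_at Q p" and \<Phi>x: "\<Phi> z = p \<oplus> x z" if "z \<in> U" for z
      using U1[OF that] D_add_R \<Phi>_eq[of "fst (?c z)" "snd (?c z)"] unfolding x_def by auto
    define d where "d = x r - x s"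
    have d: "d \<in> D_at Q (\<Phi> s)" using diff_in(1)[OF xD xD] rs unfolding d_def \<Phi>x[OF rs(2)] by blast
    \<comment> \<open>This is where convexity of the image of \<open>U\<close> enters: the straight
      path from \<open>s\<close> to \<open>r\<close> stays in \<open>U\<close>, so its image stays
      in one chart of \<open>Q\<close>, in which motions are affine.\<close>
    have "\<Phi> s \<oplus> t *\<^sub>R d \<in> cdom Q \<alpha>" if t: "t \<in> {0..1}" for t
    proof -
      have "(1 - t) *\<^sub>R ?c s + t *\<^sub>R ?c r \<in> ?c ` U"
        using convexD_alt[OF U(3)[unfolded ch], of "?c s" "?c r" t] rs t by auto
      then obtain z where z: "z \<in> U" "(1 - t) *\<^sub>R ?c s + t *\<^sub>R ?c r = ?c z" by (rule imageE) blast
      have "x z = (1 - t) *\<^sub>R x s + t *\<^sub>R x r"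
        unfolding x_def z(2)[symmetric] by (simp add: algebra_simps)
      then have xz: "x z = x s + t *\<^sub>R d" unfolding d_def by (simp add: algebra_simps)
      have "\<Phi> z = \<Phi> s \<oplus> t *\<^sub>R d"
        unfolding \<Phi>x[OF z(1)] \<Phi>x[OF rs(2)] using act_act[OF xD[OF rs(2)], of "t *\<^sub>R d"] xD[OF z(1)] xz by simp
      then show ?thesis using U(2) z(1) by auto
    qed
    then have "chart Q \<alpha> (\<Phi> s \<oplus> 1 *\<^sub>R d) = chart Q \<alpha> (\<Phi> s \<oplus> 0 *\<^sub>R d) + (1 - 0) *\<^sub>R d"
      by (intro motion_chart[OF D_at_motion[OF d] chart_flat[OF \<alpha>], of "{0..1}"]) (auto simp: is_interval_cc)
    moreover have "\<Phi> s \<oplus> 1 *\<^sub>R d = \<Phi> r"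
      using diff_in(2)[OF xD[OF rs(2)] xD[OF rs(1)]] unfolding \<Phi>x[OF rs(1)] \<Phi>x[OF rs(2)] d_def by simp
    moreover have "\<Phi> s \<oplus> 0 *\<^sub>R d = \<Phi> s" using act_zero D_base[OF d] by simp
    ultimately have "chart Q \<alpha> (\<Phi> r) - chart Q \<alpha> (\<Phi> s) = d" by simp
    then show ?thesis unfolding ch d_def x_def by simp
  qed
  then have "L_map (\<lambda>(w, z). w + z) ?R Q \<Phi>"
    unfolding L_map_def q m
    using locally_convex_prod[OF \<Delta>_lc torus_lc] lc linear_sum bij_betw_imp_surj_on[OF sum_bij]
      homeomorphic_imp_continuous_map[OF \<Phi>_homeomorphic] by blast
  then show ?thesis unfolding parallel_iso_def q m using \<Phi>_homeomorphic sum_bij by blast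
qed

lemma compact_iff: "compact_space X \<longleftrightarrow> compact \<Delta>"
proof -
  have "compact_space X \<longleftrightarrow> compact_space (prod_topology (top_of_set \<Delta>) torus.T)"
    using homeomorphic_compact_space homeomorphic_map_imp_homeomorphic_space[OF \<Phi>_homeomorphic] by blast
  also have "\<dots> \<longleftrightarrow> compact_space (top_of_set \<Delta>) \<and> compact_space torus.T"
  proof -
    \<comment> \<open>Compactness of a product passes to its factors only if the product is
      nonempty.\<close>
    have "(0, translates P 0) \<in> topspace (prod_topology (top_of_set \<Delta>) torus.T)"
      using zero_\<Delta> by (simp add: torus.topspace_T span_zero)
    then have "prod_topology (top_of_set \<Delta>) torus.T \<noteq> trivial_topology"
      by (metis empty_iff topspace_discrete_topology)
    then show ?thesis by (simp only: compact_space_prod_topology simp_thms)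
  qed
  also have "\<dots> \<longleftrightarrow> compact \<Delta>"
    using cocompact_P[OF nonempty] by (simp add: cocompact_subgroup_def compact_space_subtopology compact_space_def compactin_subtopology)
  finally show ?thesis .
qed

text \<open>Along \<open>R\<close>, a full line in direction \<open>v\<close> projects to a line in
  the bounded set \<open>\<Delta>\<close>, so the \<open>C\<close> component of \<open>v\<close>
  vanishes.\<close>

lemma N_eq_R:
  assumes "compact \<Delta>" shows "N_space Q = R"
proof
  show "R \<subseteq> N_space Q"
    unfolding N_eq[OF p] using R_sub R_D[OF p] by (auto intro: span_scale)
  show "N_space Q \<subseteq> R"
  proof
    fix v assume "v \<in> N_space Q"
    then have v: "v \<in> V" "\<And>t. t *\<^sub>R v \<in> D_at Q p" unfolding N_eq[OF p] by auto
    obtain c u where c: "c \<in> C" "u \<in> R" "v = c + u" using decompose v(1) by blast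
    have t: "t *\<^sub>R c \<in> \<Delta>" for t
    proof -
      have "t *\<^sub>R c + t *\<^sub>R u \<in> D_at Q p" using v(2)[of t] c(3) by (simp add: scaleR_add_right)
      then have "t *\<^sub>R c \<in> D_at Q p" using D_diff_R c(2) span_scale by blast
      then show ?thesis using c(1) subspace_scale[OF C_sub(1)] by blast
    qed
    obtain B where B: "\<And>x. x \<in> \<Delta> \<Longrightarrow> norm x \<le> B" using compact_imp_bounded[OF assms] unfolding bounded_iff by blast
    have "c = 0"
    proof (rule ccontr)
      assume "c \<noteq> 0"
      then have "norm (((\<bar>B\<bar> + 1) / norm c) *\<^sub>R c) = \<bar>B\<bar> + 1" by simp
      then show False using B[OF t[of "(\<bar>B\<bar> + 1) / norm c"]] by linarith
    qed
    then show "v \<in> R" using c by simp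
  qed
qed

end

section \<open>The orbit space\<close>

context split_flat begin

lemma orbit_act: "u \<in> D_at Q p \<Longrightarrow> orbit Q R (p \<oplus> u) = act p ` ((+) u ` R)"
  unfolding orbit_def image_image using act_act D_add_R by (intro image_cong) auto

lemma orbit_iff:
  assumes u: "u \<in> D_at Q p" "u' \<in> D_at Q p"
  shows "orbit Q R (p \<oplus> u) = orbit Q R (p \<oplus> u') \<longleftrightarrow> u' - u \<in> R"
proof
  assume e: "orbit Q R (p \<oplus> u) = orbit Q R (p \<oplus> u')"
  have "p \<oplus> u \<in> orbit Q R (p \<oplus> u)" unfolding orbit_act[OF u(1)] using span_zero by force
  then obtain w where w: "w \<in> R" "p \<oplus> u = p \<oplus> (u' + w)" unfolding e orbit_act[OF u(2)] by auto
  then have "(u' + w) - u \<in> P" using act_eq_iff[OF u(1) D_add_R[OF u(2) w(1)]] by (simp add: periods_eq)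
  then have "(u' + w) - u - w \<in> R" by (intro span_diff span_base w(1))
  then show "u' - u \<in> R" by (simp add: algebra_simps)
next
  assume d: "u' - u \<in> R"
  have "(+) u ` R = (+) u' ` R"
  proof (intro equalityI subsetI)
    fix x assume "x \<in> (+) u ` R"
    then obtain w where "w \<in> R" "x = u + w" by auto
    then show "x \<in> (+) u' ` R" using span_diff[OF _ d] by (intro image_eqI[of _ _ "w - (u' - u)"]) auto
  next
    fix x assume "x \<in> (+) u' ` R"
    then obtain w where "w \<in> R" "x = u' + w" by auto
    then show "x \<in> (+) u ` R" using span_add[OF _ d] by (intro image_eqI[of _ _ "w + (u' - u)"]) auto
  qed
  then show "orbit Q R (p \<oplus> u) = orbit Q R (p \<oplus> u')" by (simp add: orbit_act u)
qed

lemma orbit_shift_iff: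
  assumes d: "d \<in> D_at Q q" shows "orbit Q R q = orbit Q R (q \<oplus> d) \<longleftrightarrow> d \<in> R"
proof -
  obtain u where u: "u \<in> D_at Q p" "q = p \<oplus> u" using reach[OF p D_base[OF d]] by blast
  have "u + d \<in> D_at Q p" "q \<oplus> d = p \<oplus> (u + d)" using add_in[OF u(1)] d u(2) by auto
  then show ?thesis using orbit_iff[OF u(1), of "u + d"] u(2) by simp
qed

abbreviation Y where "Y \<equiv> quotient_topology X (orbit Q R)"
abbreviation h where "h v \<equiv> orbit Q R (translate Q p v)"

text \<open>The saturation is computed in \<open>D_at Q p\<close>, where it is a union of translates
  by vectors of \<open>R\<close>; the open map \<open>act p\<close> brings it back.\<close>

lemma orbit_open:
  assumes W: "openin X W" shows "openin Y (orbit Q R ` W)"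
proof -
  have "openin (top_of_set (D_at Q p)) {x \<in> D_at Q p. p \<oplus> x \<in> W}"
    using act_continuous[of p] W unfolding continuous_map by simp
  then obtain T where T: "open T" "{x \<in> D_at Q p. p \<oplus> x \<in> W} = D_at Q p \<inter> T" by (auto simp: openin_open)
  define S where "S = D_at Q p \<inter> (\<Union>w\<in>R. (+) w ` T)"
  have "openin (top_of_set (D_at Q p)) S"
    unfolding S_def using T(1) by (intro openin_open_Int open_UN ballI open_translation)
  then have "openin X (act p ` S)" using act_open[of p] by (simp add: open_map_def)
  moreover have "{x \<in> topspace X. orbit Q R x \<in> orbit Q R ` W} = act p ` S"
  proof (intro equalityI subsetI)
    fix x assume "x \<in> {x \<in> topspace X. orbit Q R x \<in> orbit Q R ` W}"
    then obtain y where y: "x \<in> topspace X" "y \<in> W" "orbit Q R x = orbit Q R y" by blast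
    obtain u where u: "u \<in> D_at Q p" "x = p \<oplus> u" using reach[OF p y(1)] by blast
    have "y \<in> topspace X" using openin_subset[OF W] y(2) by blast
    then obtain u' where u': "u' \<in> D_at Q p" "y = p \<oplus> u'" using reach[OF p] by blast
    have "u - u' \<in> R" using orbit_iff[OF u'(1) u(1)] y(3) u u' by simp
    moreover have "u' \<in> T" using T(2) u' y(2) by blast
    ultimately have "u \<in> (+) (u - u') ` T" by (intro image_eqI[of _ _ u']) auto
    then have "u \<in> S" unfolding S_def using u(1) \<open>u - u' \<in> R\<close> by blast
    then show "x \<in> act p ` S" using u(2) by blast
  next
    fix x assume "x \<in> act p ` S"
    then obtain t w where t: "t \<in> T" "w \<in> R" "w + t \<in> D_at Q p" "x = p \<oplus> (w + t)" unfolding S_def by auto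
    have tD: "t \<in> D_at Q p" using D_diff_R[of t w p] t by (simp add: add.commute)
    then have "p \<oplus> t \<in> W" using T(2) t(1) by blast
    moreover have "orbit Q R x = orbit Q R (p \<oplus> t)"
      using orbit_iff[OF tD t(3)] t(2,4) by simp
    ultimately show "x \<in> {x \<in> topspace X. orbit Q R x \<in> orbit Q R ` W}" using act_in t(3,4) by blast
  qed
  ultimately show ?thesis using openin_subset[OF W] by (auto simp: openin_quotient_topology)
qed

lemma h_homeomorphic: "homeomorphic_map (top_of_set \<Delta>) Y h"
proof (rule bijective_open_imp_homeomorphic_map)
  have q: "continuous_map X Y (orbit Q R)"
    by (rule quotient_imp_continuous_map[OF quotient_map_quotient_topology])
  have a: "continuous_map (top_of_set \<Delta>) X (act p)"
    by (rule continuous_map_from_subtopology_mono[OF act_continuous]) simp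
  show "continuous_map (top_of_set \<Delta>) Y h" using continuous_map_compose[OF a q] by (simp add: o_def)
  obtain g where g: "linear g" "\<And>v w. v \<in> C \<Longrightarrow> w \<in> R \<Longrightarrow> g (v + w) = (v, w)" by (rule projection) blast
  show "open_map (top_of_set \<Delta>) Y h"
    unfolding open_map_def
  proof (intro allI impI)
    fix S assume "openin (top_of_set \<Delta>) S"
    then obtain T where T: "open T" "S = \<Delta> \<inter> T" by (auto simp: openin_open)
    \<comment> \<open>\<open>fst (g x)\<close> is the \<open>C\<close> component of
      \<open>x\<close>. Its preimage thickens \<open>S\<close> along \<open>R\<close> to a
      relatively open subset of \<open>D_at Q p\<close> that meets the same orbits.\<close>
    have "continuous_on (D_at Q p) (\<lambda>x. fst (g x))"
      using g(1) by (intro continuous_on_fst) (simp add: linear_continuous_on linear_conv_bounded_linear)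
    then have "openin (top_of_set (D_at Q p)) (D_at Q p \<inter> (\<lambda>x. fst (g x)) -` T)"
      using T(1) continuous_openin_preimage_gen by blast
    then have "openin X (act p ` (D_at Q p \<inter> (\<lambda>x. fst (g x)) -` T))"
      using act_open[of p] by (simp add: open_map_def)
    then have "openin Y (orbit Q R ` act p ` (D_at Q p \<inter> (\<lambda>x. fst (g x)) -` T))" by (rule orbit_open)
    moreover have "orbit Q R ` act p ` (D_at Q p \<inter> (\<lambda>x. fst (g x)) -` T) = h ` S"
    proof (intro equalityI subsetI)
      fix z assume "z \<in> orbit Q R ` act p ` (D_at Q p \<inter> (\<lambda>x. fst (g x)) -` T)"
      then obtain x where x: "x \<in> D_at Q p" "fst (g x) \<in> T" "z = h x" by blast
      obtain v w where vw: "v \<in> \<Delta>" "w \<in> R" "x = v + w" using D_decompose[OF x(1)] by blast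
      have "v \<in> S" using T(2) x(2) vw g(2) by auto
      moreover have "h v = h x" using orbit_iff[of v x] vw x(1) by simp
      ultimately show "z \<in> h ` S" using x(3) by blast
    next
      fix z assume "z \<in> h ` S"
      then obtain v where v: "v \<in> \<Delta>" "v \<in> T" "z = h v" using T(2) by blast
      have "g (v + 0) = (v, 0)" using v(1) by (intro g(2) span_zero) simp
      then have "fst (g v) = v" by simp
      then show "z \<in> orbit Q R ` act p ` (D_at Q p \<inter> (\<lambda>x. fst (g x)) -` T)" using v by auto
    qed
    ultimately show "openin Y (h ` S)" by simp
  qed
  show "h ` topspace (top_of_set \<Delta>) = topspace Y"
  proof (intro equalityI subsetI)
    fix z assume "z \<in> h ` topspace (top_of_set \<Delta>)"
    then show "z \<in> topspace Y" using act_in by (auto simp: topspace_quotient_topology)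
  next
    fix z assume "z \<in> topspace Y"
    then obtain q where q: "q \<in> topspace X" "z = orbit Q R q" by (auto simp: topspace_quotient_topology)
    obtain u where u: "u \<in> D_at Q p" "q = p \<oplus> u" using reach[OF p q(1)] by blast
    obtain v w where vw: "v \<in> \<Delta>" "w \<in> R" "u = v + w" using D_decompose[OF u(1)] by blast
    have "h v = h u" using orbit_iff[of v u] vw u(1) by simp
    then show "z \<in> h ` topspace (top_of_set \<Delta>)" using q u vw(1) by auto
  qed
  show "inj_on h (topspace (top_of_set \<Delta>))"
  proof (rule inj_onI)
    fix v v' assume v: "v \<in> topspace (top_of_set \<Delta>)" "v' \<in> topspace (top_of_set \<Delta>)" "h v = h v'"
    then have "v' - v \<in> R" using orbit_iff[of v v'] by simp
    moreover have "v' - v \<in> C" using v subspace_diff[OF C_sub(1)] by simp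
    ultimately have "v' - v = 0" by (metis C_R)
    then show "v = v'" by simp
  qed
qed

lemma orbit_iso:
  fixes \<pi> :: "'v \<Rightarrow> 'w::euclidean_space"
  assumes \<pi>: "quotient_projection V R \<pi>"
  shows "parallel_iso \<pi> \<Delta>_space (orbit_parallel Q R \<pi>) h"
proof -
  let ?O = "orbit_parallel Q R \<pi>"
  have lin: "linear \<pi>" and ker: "v \<in> V \<Longrightarrow> \<pi> v = 0 \<longleftrightarrow> v \<in> R" for v
    using \<pi> R_sub unfolding quotient_projection_def by blast+
  have O: "qtop ?O = Y" "model ?O = \<pi> ` V" "index ?O = index Q" "cdom ?O \<alpha> = orbit Q R ` cdom Q \<alpha>" for \<alpha>
    by (simp_all add: orbit_parallel_def)
  have cO: "chart ?O \<alpha> (orbit Q R q) = \<pi> (chart Q \<alpha> q)" if \<alpha>: "\<alpha> \<in> index Q" and q: "q \<in> cdom Q \<alpha>" for \<alpha> q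
  proof -
    \<comment> \<open>Makes the definite description in the orbit chart single-valued: two points of
      one chart in the same orbit differ by a vector of \<open>R\<close>, which \<open>\<pi>\<close>
      kills.\<close>
    have "\<pi> (chart Q \<alpha> q') = \<pi> (chart Q \<alpha> q)" if q': "q' \<in> cdom Q \<alpha>" "orbit Q R q' = orbit Q R q" for q'
    proof -
      let ?d = "chart Q \<alpha> q' - chart Q \<alpha> q"
      have d: "?d \<in> D_at Q q" "q \<oplus> ?d = q'" using flat_chart_segment[OF chart_flat[OF \<alpha>] q q'(1)] .
      then have "?d \<in> R" using orbit_shift_iff[OF d(1)] q'(2) by simp
      then have "\<pi> ?d = 0" using ker R_sub by blast
      then show ?thesis using lin by (simp add: linear_diff)
    qed
    then show ?thesis unfolding orbit_parallel_def by simp (rule the_equality, use q in blast, blast)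
  qed
  \<comment> \<open>Read through \<open>h\<close>, an orbit chart is \<open>\<pi>\<close> plus one
    constant on its whole domain. The chart property, compatibility and the equation of
    \<open>L_map\<close> all follow from this.\<close>
  have key: "\<exists>k. \<forall>v\<in>\<Delta>. h v \<in> cdom ?O \<alpha> \<longrightarrow> chart ?O \<alpha> (h v) = \<pi> v + k" if \<alpha>: "\<alpha> \<in> index Q" for \<alpha>
  proof (cases "cdom Q \<alpha> = {}")
    case False
    then obtain q0 where q0: "q0 \<in> cdom Q \<alpha>" by blast
    obtain a where a: "a \<in> D_at Q p" "q0 = p \<oplus> a" using reach[OF p flat_chart_in[OF chart_flat[OF \<alpha>] q0]] by blast
    have "chart ?O \<alpha> (h v) = \<pi> v + (\<pi> (chart Q \<alpha> q0) - \<pi> a)" if v: "v \<in> \<Delta>" and hv: "h v \<in> cdom ?O \<alpha>" for v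
    proof -
      obtain q where q: "q \<in> cdom Q \<alpha>" "h v = orbit Q R q" using hv unfolding O by blast
      let ?d = "chart Q \<alpha> q - chart Q \<alpha> q0"
      have d: "?d \<in> D_at Q q0" "q0 \<oplus> ?d = q" using flat_chart_segment[OF chart_flat[OF \<alpha>] q0 q(1)] .
      have ad: "a + ?d \<in> D_at Q p" "p \<oplus> (a + ?d) = q" using add_in[OF a(1)] d a(2) by auto
      then have "a + ?d - v \<in> R" using orbit_iff[of v "a + ?d"] v q(2) by simp
      then have "\<pi> (a + ?d - v) = 0" using ker R_sub by blast
      then have "\<pi> (chart Q \<alpha> q) = \<pi> v + (\<pi> (chart Q \<alpha> q0) - \<pi> a)"
        using lin by (simp add: linear_diff linear_add algebra_simps)
      then show ?thesis using cO[OF \<alpha> q(1)] q(2) by simp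
    qed
    then show ?thesis by blast
  qed (simp add: O)
  have inj: "inj_on \<pi> C"
  proof (rule inj_onI)
    fix x y assume xy: "x \<in> C" "y \<in> C" "\<pi> x = \<pi> y"
    then have "x - y \<in> C" using subspace_diff[OF C_sub(1)] by blast
    moreover have "\<pi> (x - y) = 0" using xy lin by (simp add: linear_diff)
    ultimately have "x - y = 0" using C_sub(2) ker C_R by blast
    then show "x = y" by simp
  qed
  have img: "chart ?O \<alpha> ` cdom ?O \<alpha> = \<pi> ` chart Q \<alpha> ` cdom Q \<alpha>" if "\<alpha> \<in> index Q" for \<alpha>
    unfolding O image_image using cO[OF that] by (intro image_cong) auto
  have hs: "\<exists>v\<in>\<Delta>. z = h v" if "z \<in> topspace Y" for z
    using homeomorphic_imp_surjective_map[OF h_homeomorphic] that by auto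
  have sub: "cdom ?O \<alpha> \<subseteq> topspace Y" if "\<alpha> \<in> index Q" for \<alpha>
    using flat_chart_in[OF chart_flat[OF that]] by (auto simp: O topspace_quotient_topology)
  have chart: "is_chart Y (\<pi> ` V) (cdom ?O \<alpha>) (chart ?O \<alpha>)" if \<alpha>: "\<alpha> \<in> index Q" for \<alpha>
    unfolding is_chart_def
  proof (intro conjI)
    let ?S = "cdom ?O \<alpha>" let ?f = "chart ?O \<alpha>"
    show "openin Y ?S" unfolding O by (rule orbit_open[OF flat_chart_openin[OF chart_flat[OF \<alpha>]]])
    show "?f ` ?S \<subseteq> \<pi> ` V" unfolding img[OF \<alpha>] using flat_chart_model[OF chart_flat[OF \<alpha>]] by blast
    define \<Delta>S where "\<Delta>S = {v \<in> \<Delta>. h v \<in> ?S}"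
    obtain k where k: "\<forall>v\<in>\<Delta>. h v \<in> ?S \<longrightarrow> ?f (h v) = \<pi> v + k" using key[OF \<alpha>] by blast
    have "homeomorphic_map (subtopology (top_of_set \<Delta>) \<Delta>S) (subtopology Y ?S) h"
      by (rule homeomorphic_map_subtopologies_alt[OF h_homeomorphic]) (auto simp: \<Delta>S_def)
    moreover have "subtopology (top_of_set \<Delta>) \<Delta>S = top_of_set \<Delta>S"
    proof -
      have "\<Delta> \<inter> \<Delta>S = \<Delta>S" unfolding \<Delta>S_def by blast
      then show ?thesis by (simp add: subtopology_subtopology)
    qed
    ultimately have hS: "homeomorphic_map (top_of_set \<Delta>S) (subtopology Y ?S) h" by simp
    then obtain g where g: "homeomorphic_maps (top_of_set \<Delta>S) (subtopology Y ?S) h g"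
      using homeomorphic_map_maps by blast
    then have gh: "homeomorphic_map (subtopology Y ?S) (top_of_set \<Delta>S) g"
      using homeomorphic_maps_sym homeomorphic_maps_map by blast
    have "\<Delta>S \<subseteq> C" by (auto simp: \<Delta>S_def)
    from homeomorphic_map_affine[OF lin inj C_sub(1) this, of k]
    have "homeomorphic_map (subtopology Y ?S) (top_of_set ((\<lambda>v. \<pi> v + k) ` \<Delta>S)) ((\<lambda>v. \<pi> v + k) \<circ> g)"
      by (rule homeomorphic_map_compose[OF gh])
    moreover have fg: "((\<lambda>v. \<pi> v + k) \<circ> g) z = ?f z" if z: "z \<in> topspace (subtopology Y ?S)" for z
    proof -
      have "g z \<in> \<Delta>S" using homeomorphic_imp_surjective_map[OF gh] z by auto
      then have "?f (h (g z)) = \<pi> (g z) + k" using k unfolding \<Delta>S_def by blast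
      moreover have "h (g z) = z" using g z unfolding homeomorphic_maps_def by blast
      ultimately show ?thesis by (simp only: o_apply)
    qed
    moreover have "(\<lambda>v. \<pi> v + k) ` \<Delta>S = ?f ` ?S"
    proof -
      have "topspace (subtopology Y ?S) = ?S" using sub[OF \<alpha>] by auto
      then have "?S = h ` \<Delta>S" using homeomorphic_imp_surjective_map[OF hS] by simp
      then have "?f ` ?S = ?f ` h ` \<Delta>S" by (rule arg_cong)
      also have "\<dots> = (\<lambda>v. \<pi> v + k) ` \<Delta>S"
        unfolding image_image by (rule image_cong) (use k in \<open>auto simp: \<Delta>S_def\<close>)
      finally show ?thesis by (rule sym)
    qed
    ultimately show "homeomorphic_map (subtopology Y ?S) (top_of_set (?f ` ?S)) ?f"
      using homeomorphic_map_eq[of "subtopology Y ?S" _ "(\<lambda>v. \<pi> v + k) \<circ> g" ?f] by simp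
  qed
  have lcst: "locally_constant_on Y (cdom ?O \<alpha> \<inter> cdom ?O \<beta>) (\<lambda>x. chart ?O \<alpha> x - chart ?O \<beta> x)"
    if \<alpha>: "\<alpha> \<in> index Q" and \<beta>: "\<beta> \<in> index Q" for \<alpha> \<beta>
    unfolding locally_constant_on_def
  proof (intro ballI exI conjI)
    let ?W = "cdom ?O \<alpha> \<inter> cdom ?O \<beta>"
    have "openin Y ?W" using chart[OF \<alpha>] chart[OF \<beta>] by (auto simp: is_chart_def)
    then show "openin (subtopology Y ?W) ?W" unfolding openin_subtopology by blast
    fix x y assume xy: "x \<in> ?W" "y \<in> ?W"
    obtain k where k: "\<forall>v\<in>\<Delta>. h v \<in> cdom ?O \<alpha> \<longrightarrow> chart ?O \<alpha> (h v) = \<pi> v + k"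
      using key[OF \<alpha>] by blast
    obtain l where l: "\<forall>v\<in>\<Delta>. h v \<in> cdom ?O \<beta> \<longrightarrow> chart ?O \<beta> (h v) = \<pi> v + l"
      using key[OF \<beta>] by blast
    have "chart ?O \<alpha> z - chart ?O \<beta> z = k - l" if z: "z \<in> ?W" for z
    proof -
      obtain v where v: "v \<in> \<Delta>" "z = h v" using hs[of z] sub[OF \<alpha>] z by blast
      have "chart ?O \<alpha> z = \<pi> v + k" "chart ?O \<beta> z = \<pi> v + l" using k l z v by blast+
      then show ?thesis by simp
    qed
    then show "chart ?O \<alpha> y - chart ?O \<beta> y = chart ?O \<alpha> x - chart ?O \<beta> x" using xy by metis
  qed
  have haus: "Hausdorff_space Y"
    using homeomorphic_Hausdorff_space[OF homeomorphic_map_imp_homeomorphic_space[OF h_homeomorphic]]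
    by (simp add: Hausdorff_space_subtopology)
  have top: "topspace Y = (\<Union>\<alpha>\<in>index Q. cdom ?O \<alpha>)"
  proof -
    have "topspace X = (\<Union>\<alpha>\<in>index Q. cdom Q \<alpha>)" using ps by (simp add: parallel_space_def)
    then show ?thesis by (auto simp: topspace_quotient_topology O)
  qed
  have "locally_convex ?O"
    unfolding locally_convex_def parallel_space_def O(1-3)
  proof (intro conjI ballI)
    show "subspace (\<pi> ` V)" using lin V_sub by (rule linear_subspace_image)
    show "convex (chart ?O \<alpha> ` cdom ?O \<alpha>)" if "\<alpha> \<in> index Q" for \<alpha>
      unfolding img[OF that] using flat_chart_convex[OF chart_flat[OF that]] lin by (rule convex_linear_image[rotated])
  qed (use haus top chart lcst in auto)
  moreover have "chart ?O \<alpha> (h r) - chart ?O \<alpha> (h s) = \<pi> (r - s)"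
    if a: "\<alpha> \<in> index Q" "U \<subseteq> \<Delta>" "h ` U \<subseteq> cdom ?O \<alpha>" "r \<in> U" "s \<in> U" for \<alpha> U r s
  proof -
    obtain k where "\<forall>v\<in>\<Delta>. h v \<in> cdom ?O \<alpha> \<longrightarrow> chart ?O \<alpha> (h v) = \<pi> v + k" using key[OF a(1)] by blast
    then have "chart ?O \<alpha> (h r) = \<pi> r + k" "chart ?O \<alpha> (h s) = \<pi> s + k" using a by blast+
    then show ?thesis using lin by (simp add: linear_diff)
  qed
  ultimately have "L_map \<pi> \<Delta>_space ?O h"
    unfolding L_map_def \<Delta>_space_simps O(1-3)
    using \<Delta>_lc lin C_sub(2) homeomorphic_imp_continuous_map[OF h_homeomorphic] by blast
  moreover have "\<pi> ` C = \<pi> ` V"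
  proof (intro equalityI subsetI)
    fix y assume "y \<in> \<pi> ` V"
    then obtain v where v: "v \<in> V" "y = \<pi> v" by blast
    obtain c u where c: "c \<in> C" "u \<in> R" "v = c + u" using decompose[OF v(1)] by blast
    have "\<pi> u = 0" using ker c(2) R_sub by blast
    then show "y \<in> \<pi> ` C" using c v(2) lin by (simp add: linear_add)
  qed (use C_sub(2) in blast)
  then have "bij_betw \<pi> C (\<pi> ` V)" using inj by (simp add: bij_betw_def)
  ultimately show ?thesis
    unfolding parallel_iso_def \<Delta>_space_simps O using h_homeomorphic by blast
qed

text \<open>Inequalities that are strict at \<open>q\<close> persist nearby. The others have value 0
  at \<open>q\<close> and are homogeneous in the displacement, so doubling a short displacement
  preserves them.\<close>

lemma polyhedral_midpoint:
  assumes poly: "locally_convex_polyhedral Q" and q: "q \<in> topspace X"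
  shows "\<exists>e>0. \<forall>d\<in>D_at Q q. norm d < e \<longrightarrow> 2 *\<^sub>R d \<in> D_at Q q"
proof -
  obtain \<alpha> where \<alpha>: "\<alpha> \<in> index Q" "q \<in> cdom Q \<alpha>" using ex_chart q by blast
  let ?c = "chart Q \<alpha> q"
  obtain V' m f where f: "openin (top_of_set V) V'" "\<And>j. j \<in> {1..m} \<Longrightarrow> linear (f j)"
      "chart Q \<alpha> ` cdom Q \<alpha> = {v \<in> V'. \<forall>j\<in>{1..m::nat}. f j v \<ge> (0::real)}"
    using poly \<alpha>(1) unfolding locally_convex_polyhedral_def by blast
  have cV: "?c \<in> V'" "\<And>j. j \<in> {1..m} \<Longrightarrow> f j ?c \<ge> 0" using f(3) \<alpha>(2) by blast+
  have V'V: "V' \<subseteq> V" using f(1) openin_imp_subset by blast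
  obtain e1 where e1: "e1 > 0" "ball ?c e1 \<inter> V \<subseteq> V'" using f(1) cV(1) unfolding openin_contains_ball by blast
  let ?J = "{j \<in> {1..m}. f j ?c > 0}"
  have "open (\<Inter>j\<in>?J. {z. f j z > 0})"
    using f(2) by (intro open_INT ballI open_Collect_less continuous_on_const)
      (auto simp: linear_continuous_on linear_conv_bounded_linear)
  moreover have "?c \<in> (\<Inter>j\<in>?J. {z. f j z > 0})" by simp
  ultimately obtain e2 where e2: "e2 > 0" "ball ?c e2 \<subseteq> (\<Inter>j\<in>?J. {z. f j z > 0})"
    unfolding open_contains_ball by blast
  have "openin (top_of_set (D_at Q q)) {d \<in> D_at Q q. q \<oplus> d \<in> cdom Q \<alpha>}"
    using act_continuous[of q] flat_chart_openin[OF chart_flat[OF \<alpha>(1)]] unfolding continuous_map by simp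
  moreover have "0 \<in> {d \<in> D_at Q q. q \<oplus> d \<in> cdom Q \<alpha>}" using zero_in[OF q] act_zero[OF q] \<alpha>(2) by simp
  ultimately obtain e3 where e3: "e3 > 0" "ball 0 e3 \<inter> D_at Q q \<subseteq> {d \<in> D_at Q q. q \<oplus> d \<in> cdom Q \<alpha>}"
    unfolding openin_contains_ball by blast
  \<comment> \<open>\<open>e1\<close> and \<open>e2\<close> are halved because they are applied to
    \<open>2 *\<^sub>R d\<close>; \<open>e3\<close> keeps the motion along \<open>d\<close> in the
    chart.\<close>
  define e where "e = min e3 (min e1 e2 / 2)"
  have "2 *\<^sub>R d \<in> D_at Q q" if d: "d \<in> D_at Q q" "norm d < e" for d
  proof -
    have "q \<oplus> t *\<^sub>R d \<in> cdom Q \<alpha>" if t: "t \<in> {0..1}" for t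
    proof -
      have "norm (t *\<^sub>R d) \<le> 1 * norm d" unfolding norm_scaleR using t by (intro mult_right_mono) auto
      moreover have "norm d < e3" using d(2) unfolding e_def by simp
      ultimately have "t *\<^sub>R d \<in> ball 0 e3" by simp
      moreover have "t *\<^sub>R d \<in> D_at Q q" using shrink[OF d(1)] t by simp
      ultimately show ?thesis using e3(2) by blast
    qed
    then have "chart Q \<alpha> (q \<oplus> 1 *\<^sub>R d) = chart Q \<alpha> (q \<oplus> 0 *\<^sub>R d) + (1 - 0) *\<^sub>R d"
      by (intro motion_chart[OF D_at_motion[OF d(1)] chart_flat[OF \<alpha>(1)], of "{0..1}"]) (auto simp: is_interval_cc)
    then have cd: "chart Q \<alpha> (q \<oplus> d) = ?c + d" using act_zero[OF q] by simp
    have "q \<oplus> d \<in> cdom Q \<alpha>" using e3(2) d unfolding e_def by auto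
    then have "?c + d \<in> chart Q \<alpha> ` cdom Q \<alpha>" using cd by (metis image_eqI)
    then have fd: "f j (?c + d) \<ge> 0" if "j \<in> {1..m}" for j using f(3) that by blast
    have dist: "dist ?c (?c + 2 *\<^sub>R d) < e1" "dist ?c (?c + 2 *\<^sub>R d) < e2"
      using d(2) unfolding e_def by (auto simp: dist_norm)
    have "?c + 2 *\<^sub>R d \<in> V"
      using cV(1) V'V D_sub d(1) by (intro subspace_add[OF V_sub] subspace_scale[OF V_sub]) auto
    then have 1: "?c + 2 *\<^sub>R d \<in> V'" using e1(2) dist(1) by auto
    have 2: "f j (?c + 2 *\<^sub>R d) \<ge> 0" if j: "j \<in> {1..m}" for j
    proof (cases "f j ?c > 0")
      case True
      then have "f j (?c + 2 *\<^sub>R d) > 0" using e2(2) dist(2) j by auto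
      then show ?thesis by simp
    next
      case False
      then have "f j ?c = 0" using cV(2)[OF j] by simp
      then show ?thesis using fd[OF j] f(2)[OF j] by (simp add: linear_add linear_scale)
    qed
    have "?c + 2 *\<^sub>R d \<in> chart Q \<alpha> ` cdom Q \<alpha>" unfolding f(3) using 1 2 by blast
    then obtain y where y: "y \<in> cdom Q \<alpha>" "chart Q \<alpha> y = ?c + 2 *\<^sub>R d" by (metis imageE)
    show ?thesis using flat_chart_segment(1)[OF chart_flat[OF \<alpha>(1)] \<alpha>(2) y(1)] y(2) by simp
  qed
  moreover have "e > 0" unfolding e_def using e1 e2 e3 by simp
  ultimately show ?thesis by blast
qed

text \<open>Near an accumulation point \<open>x\<close> of extreme points there is an extreme point
  \<open>y\<close> for which the segment from \<open>x\<close> to \<open>y\<close> can be doubled,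
  with \<open>y\<close> as midpoint. This is impossible, so there are finitely many, and they span
  \<open>\<Delta>\<close> as a convex hull.\<close>

lemma polytope_\<Delta>:
  assumes comp: "compact \<Delta>" and poly: "locally_convex_polyhedral Q"
  shows "polytope \<Delta>"
proof -
  let ?E = "{x. x extreme_point_of \<Delta>}"
  have "finite ?E"
  proof (rule ccontr)
    assume "infinite ?E"
    moreover have "?E \<subseteq> \<Delta>" by (auto simp: extreme_point_of_def)
    ultimately obtain x where x: "x \<in> \<Delta>" "x islimpt ?E"
      using Heine_Borel_imp_Bolzano_Weierstrass[OF comp] by blast
    have xD: "x \<in> D_at Q p" "x \<in> C" using x by auto
    obtain e where e: "e > 0" "\<forall>d\<in>D_at Q (p \<oplus> x). norm d < e \<longrightarrow> 2 *\<^sub>R d \<in> D_at Q (p \<oplus> x)"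
      using polyhedral_midpoint[OF poly act_in[OF xD(1)]] by blast
    obtain y where y: "y extreme_point_of \<Delta>" "y \<noteq> x" "dist y x < e"
      using x(2) e(1) unfolding islimpt_approachable by blast
    have yD: "y \<in> D_at Q p" "y \<in> C" using y(1) by (auto simp: extreme_point_of_def)
    let ?d = "y - x"
    have "?d \<in> D_at Q (p \<oplus> x)" using diff_in(1)[OF xD(1) yD(1)] .
    then have "2 *\<^sub>R ?d \<in> D_at Q (p \<oplus> x)" using e(2) y(3) by (simp add: dist_norm)
    then have "x + 2 *\<^sub>R ?d \<in> D_at Q p" using D_shift[OF xD(1)] by blast
    moreover have "x + 2 *\<^sub>R ?d \<in> C"
      using xD(2) yD(2) by (intro subspace_add[OF C_sub(1)] subspace_scale[OF C_sub(1)] subspace_diff[OF C_sub(1)])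
    ultimately have z: "x + 2 *\<^sub>R ?d \<in> \<Delta>" by blast
    have "y \<in> open_segment x (x + 2 *\<^sub>R ?d)"
      unfolding in_segment using y(2) by (auto intro!: exI[of _ "1/2"] simp: algebra_simps)
    then show False using y(1) x(1) z unfolding extreme_point_of_def by blast
  qed
  moreover have "\<Delta> = convex hull ?E" using comp \<Delta>_convex by (rule Krein_Milman_Minkowski)
  ultimately show ?thesis unfolding polytope_def by blast
qed

end

section \<open>From completeness or compactness to the splitting\<close>

lemma connected_flat_complete:
  assumes "locally_convex Q" "complete_parallel Q" "connected_space (qtop Q)"
  shows "connected_flat Q"
proof -
  interpret complete_flat Q using assms by unfold_locales
  show ?thesis
  proof
    show "v \<in> D_at Q q" if "\<And>s. 0 \<le> s \<Longrightarrow> s < 1 \<Longrightarrow> s *\<^sub>R v \<in> D_at Q q" for v q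
      using extend_of_complete[OF that] .
  qed (rule assms(3))
qed

lemma connected_flat_compact:
  assumes "locally_convex Q" "compact_space (qtop Q)" "connected_space (qtop Q)"
  shows "connected_flat Q"
proof -
  interpret convex_parallel Q using assms by unfold_locales
  interpret locally_compact_parallel Q using compact_space_charts[OF assms(2)] by unfold_locales
  show ?thesis
  proof
    show "v \<in> D_at Q q" if "\<And>s. 0 \<le> s \<Longrightarrow> s < 1 \<Longrightarrow> s *\<^sub>R v \<in> D_at Q q" for v q
      using extend_of_compact[OF assms(2) that] .
  qed (rule assms(3))
qed

theorem theorem10p12:
  fixes Q :: "('a, 'q, 'v::euclidean_space) parallel"
    and V P RP C :: "'v set" and p :: 'q
  defines "V \<equiv> model Q" and "P \<equiv> periods Q" and "RP \<equiv> span (periods Q)"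
  assumes "locally_convex Q" and "connected_space (qtop Q)"
    and "linear_complement V RP C" and "p \<in> topspace (qtop Q)"
  shows
    "(complete_parallel Q \<longrightarrow>
       discrete_subgroup RP P \<and> cocompact_subgroup RP P \<and>
       (\<exists>\<Delta>. \<Delta> \<subseteq> C \<and> convex \<Delta> \<and> closed \<Delta> \<and>
          D_at Q p = {v + w |v w. v \<in> \<Delta> \<and> w \<in> RP} \<and>
          (\<exists>\<Phi>. (\<forall>v\<in>\<Delta>. \<forall>w\<in>RP. \<Phi> (v, translates P w) = translate Q p (v + w)) \<and>
             parallel_iso (\<lambda>(w, z). w + z)
               (prod_parallel (restrict_parallel (vector_parallel C) \<Delta>) (torus_parallel RP P))
               Q \<Phi>) \<and>
          (\<forall>\<pi> :: 'v \<Rightarrow> 'w::euclidean_space. quotient_projection V RP \<pi> \<longrightarrow>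
             parallel_iso \<pi>
               (restrict_parallel (vector_parallel C) \<Delta>) (orbit_parallel Q RP \<pi>)
               (\<lambda>v. orbit Q RP (translate Q p v))) \<and>
          (compact_space (qtop Q) \<longleftrightarrow> compact \<Delta>) \<and>
          (compact \<Delta> \<longrightarrow>
             N_space Q = RP \<and> discrete_subgroup (N_space Q) P \<and>
             cocompact_subgroup (N_space Q) P)) \<and>
       (\<exists>(I :: (('v \<Rightarrow> real) \<times> real) set) f c. halfspace_description V (D_at Q p) I f c) \<and>
       (\<forall>(I :: 'i set) f c. halfspace_description V (D_at Q p) I f c \<longrightarrow>
          N_space Q = {v \<in> V. \<forall>i\<in>I. f i v = 0}))
     \<and>
     (compact_space (qtop Q) \<and> locally_convex_polyhedral Q \<longrightarrow>
       (\<exists>\<Delta>. \<Delta> \<subseteq> C \<and> polytope \<Delta> \<and>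
          D_at Q p = {v + w |v w. v \<in> \<Delta> \<and> w \<in> RP} \<and>
          (\<forall>\<pi> :: 'v \<Rightarrow> 'w. quotient_projection V RP \<pi> \<longrightarrow>
             polytope (\<pi> ` \<Delta>) \<and>
             parallel_iso \<pi>
               (restrict_parallel (vector_parallel C) \<Delta>) (orbit_parallel Q RP \<pi>)
               (\<lambda>v. orbit Q RP (translate Q p v)))))"
proof (intro conjI impI)
  have split: "split_flat Q C p" if "connected_flat Q"
    using that assms(6,7) unfolding V_def RP_def by (simp add: split_flat_def split_flat_axioms_def)
  note defs = V_def P_def RP_def
  {
    assume "complete_parallel Q"
    then interpret split_flat Q C p using split connected_flat_complete assms(4,5) by blast
    show "discrete_subgroup RP P" unfolding defs by (rule discrete_P[OF nonempty])
    show "cocompact_subgroup RP P" unfolding defs by (rule cocompact_P[OF nonempty])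
    show "\<exists>\<Delta>. \<Delta> \<subseteq> C \<and> convex \<Delta> \<and> closed \<Delta> \<and>
          D_at Q p = {v + w |v w. v \<in> \<Delta> \<and> w \<in> RP} \<and>
          (\<exists>\<Phi>. (\<forall>v\<in>\<Delta>. \<forall>w\<in>RP. \<Phi> (v, translates P w) = translate Q p (v + w)) \<and>
             parallel_iso (\<lambda>(w, z). w + z)
               (prod_parallel (restrict_parallel (vector_parallel C) \<Delta>) (torus_parallel RP P))
               Q \<Phi>) \<and>
          (\<forall>\<pi> :: 'v \<Rightarrow> 'w::euclidean_space. quotient_projection V RP \<pi> \<longrightarrow>
             parallel_iso \<pi>
               (restrict_parallel (vector_parallel C) \<Delta>) (orbit_parallel Q RP \<pi>)
               (\<lambda>v. orbit Q RP (translate Q p v))) \<and>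
          (compact_space (qtop Q) \<longleftrightarrow> compact \<Delta>) \<and>
          (compact \<Delta> \<longrightarrow>
             N_space Q = RP \<and> discrete_subgroup (N_space Q) P \<and>
             cocompact_subgroup (N_space Q) P)"
      unfolding defs
    proof (intro exI[of _ "D_at Q p \<inter> C"] conjI allI impI)
      show "\<exists>\<Phi>. (\<forall>v\<in>D_at Q p \<inter> C. \<forall>w\<in>span (periods Q). \<Phi> (v, translates (periods Q) w) = translate Q p (v + w)) \<and>
             parallel_iso (\<lambda>(w, z). w + z)
               (prod_parallel (restrict_parallel (vector_parallel C) (D_at Q p \<inter> C)) (torus_parallel (span (periods Q)) (periods Q)))
               Q \<Phi>"
        using \<Phi>_eq \<Phi>_iso by blast
    qed (use \<Delta>_convex \<Delta>_closed D_eq orbit_iso compact_iff N_eq_R discrete_P[OF nonempty] cocompact_P[OF nonempty] in \<open>simp_all\<close>)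
    show "\<exists>(I :: (('v \<Rightarrow> real) \<times> real) set) f c. halfspace_description V (D_at Q p) I f c"
      unfolding defs by (rule halfspace_exists)
    show "\<forall>(I :: 'i set) f c. halfspace_description V (D_at Q p) I f c \<longrightarrow>
          N_space Q = {v \<in> V. \<forall>i\<in>I. f i v = 0}"
      unfolding defs using N_eq_halfspace p by blast
  next
    assume c: "compact_space (qtop Q) \<and> locally_convex_polyhedral Q"
    \<comment> \<open>Completeness is not among the assumptions of this case; compactness takes its
      place.\<close>
    then interpret split_flat Q C p using split connected_flat_compact assms(4,5) by blast
    have "polytope (D_at Q p \<inter> C)" using polytope_\<Delta> compact_iff c by blast
    then show "\<exists>\<Delta>. \<Delta> \<subseteq> C \<and> polytope \<Delta> \<and>
          D_at Q p = {v + w |v w. v \<in> \<Delta> \<and> w \<in> RP} \<and>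
          (\<forall>\<pi> :: 'v \<Rightarrow> 'w. quotient_projection V RP \<pi> \<longrightarrow>
             polytope (\<pi> ` \<Delta>) \<and>
             parallel_iso \<pi>
               (restrict_parallel (vector_parallel C) \<Delta>) (orbit_parallel Q RP \<pi>)
               (\<lambda>v. orbit Q RP (translate Q p v)))"
      unfolding defs using D_eq orbit_iso
      by (intro exI[of _ "D_at Q p \<inter> C"]) (auto simp: quotient_projection_def intro: polytope_linear_image)
  }
qed

end
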